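(* Let $m,n\in\mathbb{N}$ with $m\le n$ and let $\mathcal{O}$ be the ring of integers of a number field. The class counting zeta function $\zeta^{\mathrm{k}}_{G_{m,n}(\mathcal{O})}(s)$ is $$\prod_{\mathfrak p}\frac{q^{2mn-m-n+1-2s}-\left((q+1)q^m-(q^m-q-1)q^n-q\right)q^{mn-m-n-s}+1}{(1-q^{mn+m-n-s})(1-q^{mn+n-m-s})(1-q^{mn+1-s})},$$ where $\mathfrak p$ ranges over the non-zero prime ideals of $\mathcal{O}$ and $q$ is the residue field cardinality of $\mathfrak p$ (as an identity of Dirichlet series).
   Context: $\mathbb{N}$ is the set of positive integers. The group scheme $G_{m,n}$: let $\Lambda_{m,n}$ be the $\mathbb{Z}$-Lie lattice with $\mathbb{Z}$-basis $x_1,\dots,x_{m+n}$, $z_{ij}$ ($1\le i\le m$, $1\le j\le n$) and brackets $[x_i,x_{m+j}]=z_{ij}$, all brackets not following formally from these being zero. $G_{m,n}$ is the unipotent group scheme associated with the class-2 nilpotent Lie lattice $\Lambda_{m,n}$ (group commutators $xyx^{-1}y^{-1}$ are given by Lie brackets). Concretely, for a commutative ring $R$, $G_{m,n}(R)$ is the set $R^m\times R^n\times \mathrm{Mat}_{m\times n}(R)$ with multiplication $(a,b,c)(a',b',c')=(a+a',\,b+b',\,c+c'+a\,(b')^{T})$, where $a,b$ are column vectors. For a finite group $H$, $\mathrm{k}(H)$ is the number of conjugacy classes of $H$. The class counting zeta function is $$\zeta^{\mathrm{k}}_{G_{m,n}(\mathcal{O})}(s)=\sum_{(0)\ne I\trianglelefteq\mathcal{O}}\mathrm{k}(G_{m,n}(\mathcal{O}/I))\,|\mathcal{O}:I|^{-s}.$$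 *)

theory Defs
  imports
    "HOL-Algebra.Algebraic_Closure_Type"
    "HOL-Algebra.Group_Action"
    "HOL-Algebra.QuotRing"
    "HOL-Analysis.Infinite_Sum"
    "HOL-Analysis.Complex_Transcendental"
begin

text \<open>A number field is a subfield of an arbitrary field type of characteristic 0 that has
  finite dimension over the rationals. The ambient type may be the number field itself.\<close>

definition number_field :: "'a::field_char_0 set \<Rightarrow> bool" where
  "number_field K \<longleftrightarrow>
     subfield K ring_of_type_algebra \<and> ring.finite_dimension ring_of_type_algebra \<rat> K"

definition ring_of_integers :: "'a::field_char_0 set \<Rightarrow> 'a ring" where
  "ring_of_integers K = ring_of_type_algebra \<lparr>carrier := {x \<in> K. algebraic_int x}\<rparr>"

definition nonzero_ideals :: "('a, 'b) ring_scheme \<Rightarrow> 'a set set" where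
  "nonzero_ideals R = {I. ideal I R \<and> I \<noteq> {\<zero>\<^bsub>R\<^esub>}}"

definition nonzero_primes :: "('a, 'b) ring_scheme \<Rightarrow> 'a set set" where
  "nonzero_primes R = {P. primeideal P R \<and> P \<noteq> {\<zero>\<^bsub>R\<^esub>}}"

definition ideal_norm :: "('a, 'b) ring_scheme \<Rightarrow> 'a set \<Rightarrow> nat" where
  "ideal_norm R I = card (carrier (R Quot I))"

text \<open>The group of \<open>R\<close>-points of the unipotent group scheme attached to the Lie lattice with
  basis \<open>x_1, \<dots>, x_(m+n), z_ij\<close> and brackets \<open>[x_i, x_(m+j)] = z_ij\<close>. Vectors and matrices
  over \<open>R\<close> are extensional functions on their index sets.\<close>

definition unipotent_group ::
  "nat \<Rightarrow> nat \<Rightarrow> ('a, 'b) ring_scheme \<Rightarrow>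
     ((nat \<Rightarrow> 'a) \<times> (nat \<Rightarrow> 'a) \<times> (nat \<times> nat \<Rightarrow> 'a)) monoid" where
  "unipotent_group m n R =
    \<lparr>carrier = ({1..m} \<rightarrow>\<^sub>E carrier R) \<times> ({1..n} \<rightarrow>\<^sub>E carrier R) \<times>
                 ({1..m} \<times> {1..n} \<rightarrow>\<^sub>E carrier R),
     monoid.mult = (\<lambda>(a, b, c) (a', b', c').
       (\<lambda>i\<in>{1..m}. a i \<oplus>\<^bsub>R\<^esub> a' i,
        \<lambda>j\<in>{1..n}. b j \<oplus>\<^bsub>R\<^esub> b' j,
        \<lambda>(i, j)\<in>{1..m} \<times> {1..n}. c (i, j) \<oplus>\<^bsub>R\<^esub> c' (i, j) \<oplus>\<^bsub>R\<^esub> a i \<otimes>\<^bsub>R\<^esub> b' j)),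
     monoid.one = (\<lambda>i\<in>{1..m}. \<zero>\<^bsub>R\<^esub>, \<lambda>j\<in>{1..n}. \<zero>\<^bsub>R\<^esub>, \<lambda>(i, j)\<in>{1..m} \<times> {1..n}. \<zero>\<^bsub>R\<^esub>)\<rparr>"

definition num_conj_classes :: "('a, 'b) monoid_scheme \<Rightarrow> nat" where
  "num_conj_classes G =
     card (orbits G (carrier G) (\<lambda>g. \<lambda>h\<in>carrier G. g \<otimes>\<^bsub>G\<^esub> h \<otimes>\<^bsub>G\<^esub> inv\<^bsub>G\<^esub> g))"

definition class_counting_term ::
  "nat \<Rightarrow> nat \<Rightarrow> ('a, 'b) ring_scheme \<Rightarrow> complex \<Rightarrow> 'a set \<Rightarrow> complex" where
  "class_counting_term m n R s I =
     of_nat (num_conj_classes (unipotent_group m n (R Quot I))) * of_nat (ideal_norm R I) powr (-s)"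

text \<open>The infinite sum is 0 by convention where the family of terms is not summable.\<close>

definition class_counting_zeta ::
  "nat \<Rightarrow> nat \<Rightarrow> ('a, 'b) ring_scheme \<Rightarrow> complex \<Rightarrow> complex" where
  "class_counting_zeta m n R s = (\<Sum>\<^sub>\<infinity>I\<in>nonzero_ideals R. class_counting_term m n R s I)"

text \<open>Absolute convergence of the product of \<open>f x\<close> over \<open>x \<in> A\<close> to \<open>P\<close>: the deviations from 1
  are absolutely summable and the net of finite partial products tends to \<open>P\<close>.\<close>

definition has_abs_prod :: "('i \<Rightarrow> complex) \<Rightarrow> complex \<Rightarrow> 'i set \<Rightarrow> bool" where
  "has_abs_prod f P A \<longleftrightarrow>
     (\<lambda>x. f x - 1) abs_summable_on A \<and> (prod f \<longlongrightarrow> P) (finite_subsets_at_top A)"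

end

theory Submission
  imports Defs "Jordan_Normal_Form.Char_Poly" "HOL-Algebra.Chinese_Remainder"
begin

text \<open>By Burnside's lemma, \<open>|R|^(m+n) k(G(R))\<close> is \<open>|R|^(mn)\<close> times the number of quadruples
  \<open>(a, b, a', b')\<close> with \<open>a b'^T = a' b^T\<close>; this is multiplicative in \<open>R\<close>, so the Chinese remainder
  theorem gives an Euler product. For \<open>R = O/P^k\<close> with residue cardinality \<open>q\<close>, if \<open>a\<close> and \<open>b\<close> have
  valuations \<open>i \<le> j\<close> (capped at \<open>k\<close>), then exactly \<open>q^(k + i n + j (m - 1))\<close> pairs \<open>(a', b')\<close> occur.
  Summing over \<open>i\<close> and \<open>j\<close> yields a linear recurrence in \<open>k\<close>, whose generating function is the local factor.

  Unique factorisation of ideals is only needed in the form that every nonzero ideal is the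
  intersection of symbolic powers of primes. It follows from finiteness of the quotients and complete
  integral closedness: in the finite ring \<open>O/(a)\<close> a prime is the annihilator of some element, hence
  every prime is locally principal.\<close>

section \<open>Algebraic integers\<close>

text \<open>Everything arithmetic rests on one estimate: O/(N) has at most N^d elements if K is
  spanned by d elements over Q. It is proved prime by prime: for elements independent modulo p, an
  integer relation has all coefficients divisible by p, hence by every power of p, so they are
  independent over Q. The estimate provides finite quotients, in which the index is a descent
  measure and the powers of an element repeat. It also bounds the number of primes above N, which
  makes the Euler product converge. Symbolic powers are convenient because membership is
  divisibility by a power of one element after multiplication by something outside P. Valuations are
  then computable without products of ideals, and coprime factors are combined by intersection. In
  the local count, lowering both valuations by one reproduces the count for k - 1 up to a factor
  q^(m+n), so only border terms with a valuation 0 remain to be summed. The factor 1 - q^(m+n) T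
  that this recurrence puts into the denominator cancels in the end. Convergence of the product uses
  only k(G) \<le> |G|, so the half-plane obtained is a crude one.\<close>

lemma algebraic_int_eigenvalue:
  fixes z :: "'a::field_char_0" and n :: nat
  assumes eig: "\<And>i. i < n \<Longrightarrow> z * v i = (\<Sum>j<n. of_int (B i j) * v j)"
    and "k < n" "v k \<noteq> 0"
  shows "algebraic_int z"
proof -
  define A where "A = mat n n (\<lambda>(i, j). B i j)"
  define A' :: "'a mat" where "A' = map_mat of_int A"
  have A: "A \<in> carrier_mat n n" and A': "A' \<in> carrier_mat n n"
    by (auto simp: A_def A'_def)
  have "A' *\<^sub>v vec n v = z \<cdot>\<^sub>v vec n v"
  proof (rule eq_vecI)
    fix i assume i: "i < dim_vec (z \<cdot>\<^sub>v vec n v)"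
    then have "vec_index (A' *\<^sub>v vec n v) i = (\<Sum>j<n. of_int (B i j) * v j)"
      by (simp add: A'_def A_def scalar_prod_def atLeast0LessThan)
    then show "vec_index (A' *\<^sub>v vec n v) i = vec_index (z \<cdot>\<^sub>v vec n v) i"
      using i eig[of i] by simp
  qed (simp add: A'_def A_def)
  moreover have "vec n v \<noteq> 0\<^sub>v n"
    using assms(2,3) by (metis index_vec index_zero_vec(1))
  ultimately have "eigenvalue A' z"
    using A' unfolding eigenvalue_def eigenvector_def by (intro exI[of _ "vec n v"]) auto
  \<comment> \<open>The characteristic polynomial of an integer matrix is monic with integer
    coefficients.\<close>
  then have "poly (char_poly A') z = 0"
    using A' eigenvalue_root_char_poly by blast
  then have "poly (map_poly of_int (char_poly A)) z = 0"
    unfolding A'_def of_int_hom.char_poly_hom[OF A] .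
  moreover have "lead_coeff (char_poly A) = 1"
    using degree_monic_char_poly[OF A] by simp
  ultimately show ?thesis
    unfolding algebraic_int_altdef_ipoly by blast
qed

interpretation int_span: Modules.module "\<lambda>c (v::'a::field_char_0). of_int c * v"
  by unfold_locales (auto simp: algebra_simps)

text \<open>Expressing \<open>z * w\<close> through the generators, for each generator
  \<open>w\<close>, gives an integer matrix that has the list of generators as an eigenvector with
  eigenvalue \<open>z\<close>. The generator \<open>w0\<close> ensures that this vector is
  non-zero.\<close>

lemma algebraic_int_stable_span:
  fixes z :: "'a::field_char_0"
  assumes fin: "finite W" and w0: "w0 \<in> W" "w0 \<noteq> 0"
    and stable: "\<And>w. w \<in> W \<Longrightarrow> z * w \<in> int_span.span W"
  shows "algebraic_int z"
proof -
  obtain v where v: "bij_betw v {..<card W} W"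
    using ex_bij_betw_nat_finite[OF fin] by (auto simp: atLeast0LessThan)
  have vW: "v i \<in> W" if "i < card W" for i
    using v that by (auto simp: bij_betw_def)
  have "\<exists>b. z * v i = (\<Sum>w\<in>W. of_int (b w) * w)" if "i < card W" for i
    using stable[OF vW[OF that]] by (auto simp: int_span.span_finite[OF fin])
  then obtain b where b: "\<And>i. i < card W \<Longrightarrow> z * v i = (\<Sum>w\<in>W. of_int (b i w) * w)"
    by metis
  have "z * v i = (\<Sum>j<card W. of_int (b i (v j)) * v j)" if "i < card W" for i
    using b[OF that] sum.reindex_bij_betw[OF v, of "\<lambda>w. of_int (b i w) * w"] by simp
  moreover obtain k where "k < card W" "v k = w0"
    using v w0(1) unfolding bij_betw_def by (metis imageE lessThan_iff)
  ultimately show ?thesis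
    using w0(2) algebraic_int_eigenvalue[of "card W" z v "\<lambda>i j. b i (v j)" k] by blast
qed

lemma algebraic_int_power_reduce:
  fixes x :: "'a::field_char_0"
  assumes "algebraic_int x"
  obtains n c where "n > 0" "x ^ n = (\<Sum>i<n. of_int (c i) * x ^ i)"
proof -
  obtain p where p: "poly (map_poly of_int p) x = 0" "lead_coeff p = (1::int)"
    using assms unfolding algebraic_int_altdef_ipoly by blast
  let ?n = "degree p"
  have "degree (map_poly (of_int :: int \<Rightarrow> 'a) p) = ?n"
    by (simp add: degree_map_poly)
  then have "(\<Sum>i\<le>?n. of_int (coeff p i) * x ^ i) = 0"
    using p(1) by (simp add: poly_altdef coeff_map_poly)
  moreover have "(\<Sum>i\<le>?n. of_int (coeff p i) * x ^ i) = (\<Sum>i<?n. of_int (coeff p i) * x ^ i) + x ^ ?n"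
    using p(2) by (simp flip: lessThan_Suc_atMost)
  ultimately have red: "x ^ ?n = (\<Sum>i<?n. of_int (- coeff p i) * x ^ i)"
    by (simp add: sum_negf eq_neg_iff_add_eq_0 add.commute)
  \<comment> \<open>In degree 0 the monic relation would read 1 = 0.\<close>
  have "?n \<noteq> 0"
  proof
    assume "?n = 0"
    with red show False by (simp only: \<open>?n = 0\<close>) simp
  qed
  then show thesis using that[of ?n "\<lambda>i. - coeff p i"] red by blast
qed

text \<open>The monomials \<open>x ^ i * y ^ j\<close> below the degrees of two monic relations span
  a group that is stable under \<open>x\<close> and \<open>y\<close>, since a monomial leaving the
  range is rewritten by a relation. Hence the group is stable under the sum and the product.\<close>

lemma
  fixes x y :: "'a::field_char_0"
  assumes x: "algebraic_int x" and y: "algebraic_int y"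
  shows algebraic_int_add: "algebraic_int (x + y)"
    and algebraic_int_mult: "algebraic_int (x * y)"
proof -
  obtain m c where m: "m > 0" "x ^ m = (\<Sum>i<m. of_int (c i) * x ^ i)"
    using algebraic_int_power_reduce[OF x] .
  obtain n d where n: "n > 0" "y ^ n = (\<Sum>i<n. of_int (d i) * y ^ i)"
    using algebraic_int_power_reduce[OF y] .
  define W where "W = (\<lambda>(i, j). x ^ i * y ^ j) ` ({..<m} \<times> {..<n})"
  have W: "x ^ i * y ^ j \<in> W" if "i < m" "j < n" for i j
    using that by (force simp: W_def)
  have fin: "finite W" by (simp add: W_def)
  have one: "1 \<in> W" using W[of 0 0] m n by simp
  have xW: "x * w \<in> int_span.span W" if "w \<in> W" for w
  proof -
    obtain i j where ij: "w = x ^ i * y ^ j" "i < m" "j < n" using \<open>w \<in> W\<close> by (auto simp: W_def)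
    show ?thesis
    proof (cases "Suc i < m")
      case True
      then have "x * w \<in> W" using W[of "Suc i" j] ij by (simp add: mult.assoc)
      then show ?thesis by (rule int_span.span_base)
    next
      case False
      then have "m = Suc i" using ij by simp
      then have "x * w = x ^ m * y ^ j" using ij by (simp add: mult.assoc)
      also have "\<dots> = (\<Sum>i<m. of_int (c i) * (x ^ i * y ^ j))"
        unfolding m(2) by (simp add: sum_distrib_right mult.assoc)
      also have "\<dots> \<in> int_span.span W"
        using W ij by (intro int_span.span_sum int_span.span_scale int_span.span_base) auto
      finally show ?thesis .
    qed
  qed
  have yW: "y * w \<in> int_span.span W" if "w \<in> W" for w
  proof -
    obtain i j where ij: "w = x ^ i * y ^ j" "i < m" "j < n" using \<open>w \<in> W\<close> by (auto simp: W_def)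
    show ?thesis
    proof (cases "Suc j < n")
      case True
      then have "y * w \<in> W" using W[of i "Suc j"] ij by (simp add: mult_ac)
      then show ?thesis by (rule int_span.span_base)
    next
      case False
      then have "n = Suc j" using ij by simp
      then have "y * w = x ^ i * y ^ n" using ij by (simp add: mult_ac)
      also have "\<dots> = (\<Sum>j<n. of_int (d j) * (x ^ i * y ^ j))"
        unfolding n(2) by (simp add: sum_distrib_left mult_ac)
      also have "\<dots> \<in> int_span.span W"
        using W ij by (intro int_span.span_sum int_span.span_scale int_span.span_base) auto
      finally show ?thesis .
    qed
  qed
  \<comment> \<open>For a generator \<open>w\<close>, the element \<open>y * w\<close> lies only in
    the span, so stability under \<open>x\<close> is needed on the whole span to treat the
    product.\<close>
  have xspan: "x * u \<in> int_span.span W" if "u \<in> int_span.span W" for u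
    using that
  proof (induction rule: int_span.span_induct_alt)
    case (step c w u)
    then show ?case
      using int_span.span_add[OF int_span.span_scale[OF xW, of w c]] by (simp add: algebra_simps)
  qed (simp add: int_span.span_zero)
  have "(x + y) * w \<in> int_span.span W" if "w \<in> W" for w
    using int_span.span_add[OF xW yW] that by (simp add: algebra_simps)
  then show "algebraic_int (x + y)"
    using algebraic_int_stable_span[OF fin one] by simp
  have "(x * y) * w \<in> int_span.span W" if "w \<in> W" for w
    using xspan[OF yW[OF that]] by (simp add: algebra_simps)
  then show "algebraic_int (x * y)"
    using algebraic_int_stable_span[OF fin one] by simp
qed

section \<open>Cosets in abelian groups\<close>

text \<open>Quotients are taken of bare subsets of a type-class group, so that ring elements are
  computed with directly. \<open>carrier_Quot_R\<close> and \<open>ideal_norm_R\<close> translate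
  back to quotient rings.\<close>

definition cosets :: "'a::ab_group_add set \<Rightarrow> 'a set \<Rightarrow> 'a set set" where
  "cosets A B = (\<lambda>x. (+) x ` B) ` A"

definition add_index :: "'a::ab_group_add set \<Rightarrow> 'a set \<Rightarrow> nat" where
  "add_index A B = card (cosets A B)"

definition add_subgroup :: "'a::ab_group_add set \<Rightarrow> bool" where
  "add_subgroup B \<longleftrightarrow> 0 \<in> B \<and> (\<forall>x\<in>B. \<forall>y\<in>B. x - y \<in> B)"

lemma add_subgroupD:
  assumes "add_subgroup B"
  shows add_subgroup_zero: "0 \<in> B"
    and add_subgroup_diff: "\<And>x y. x \<in> B \<Longrightarrow> y \<in> B \<Longrightarrow> x - y \<in> B"
    and add_subgroup_uminus: "\<And>x. x \<in> B \<Longrightarrow> - x \<in> B"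
    and add_subgroup_add: "\<And>x y. x \<in> B \<Longrightarrow> y \<in> B \<Longrightarrow> x + y \<in> B"
proof -
  show 0: "0 \<in> B" and d: "\<And>x y. x \<in> B \<Longrightarrow> y \<in> B \<Longrightarrow> x - y \<in> B"
    using assms by (auto simp: add_subgroup_def)
  show u: "- x \<in> B" if "x \<in> B" for x using d[OF 0 that] by simp
  show "x + y \<in> B" if "x \<in> B" "y \<in> B" for x y using d[OF that(1) u[OF that(2)]] by simp
qed

lemma coset_eq_iff:
  assumes "add_subgroup B"
  shows "(+) x ` B = (+) y ` B \<longleftrightarrow> x - y \<in> B"
proof
  assume "(+) x ` B = (+) y ` B"
  then have "x + 0 \<in> (+) y ` B" using add_subgroup_zero[OF assms] by blast
  then show "x - y \<in> B" by auto
next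
  have sub: "(+) x ` B \<subseteq> (+) y ` B" if "x - y \<in> B" for x y
  proof
    fix z assume "z \<in> (+) x ` B"
    then obtain b where "b \<in> B" "z = x + b" by auto
    then have "z = y + ((x - y) + b)" "(x - y) + b \<in> B"
      using that add_subgroup_add[OF assms] by auto
    then show "z \<in> (+) y ` B" by blast
  qed
  assume "x - y \<in> B"
  moreover from this have "y - x \<in> B" using add_subgroup_uminus[OF assms] by force
  ultimately show "(+) x ` B = (+) y ` B" using sub by blast
qed

lemma cosets_self:
  assumes "add_subgroup A" shows "cosets A A = {A}"
proof -
  have "(+) x ` A = A" if "x \<in> A" for x using coset_eq_iff[OF assms, of x 0] that by simp
  then have "cosets A A = (\<lambda>x. A) ` A" unfolding cosets_def by (rule image_cong[OF refl])
  then show ?thesis using add_subgroup_zero[OF assms] by (auto simp: image_constant_conv)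
qed

lemma add_index_self: "add_subgroup A \<Longrightarrow> add_index A A = 1"
  by (simp add: add_index_def cosets_self)

text \<open>The equivalence \<open>iff\<close> makes the map induced by \<open>g\<close> on cosets
  both well defined and injective, and \<open>surj\<close> makes it surjective. The induced map is
  built from a chosen representative of each coset.\<close>

lemma bij_betw_cosets:
  assumes C: "add_subgroup C" and D: "add_subgroup D"
    and gB: "\<And>x. x \<in> A \<Longrightarrow> g x \<in> B"
    and iff: "\<And>x y. x \<in> A \<Longrightarrow> y \<in> A \<Longrightarrow> g x - g y \<in> D \<longleftrightarrow> x - y \<in> C"
    and surj: "\<And>b. b \<in> B \<Longrightarrow> \<exists>a\<in>A. b - g a \<in> D"
  obtains h where "bij_betw h (cosets A C) (cosets B D)"
proof -
  define h where "h S = (+) (g (SOME x. x \<in> A \<and> S = (+) x ` C)) ` D" for S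
  have h: "h ((+) x ` C) = (+) (g x) ` D" if "x \<in> A" for x
  proof -
    define y where "y = (SOME y. y \<in> A \<and> (+) x ` C = (+) y ` C)"
    have "y \<in> A \<and> (+) x ` C = (+) y ` C"
      unfolding y_def by (rule someI[of _ x]) (use that in simp)
    then have "y \<in> A" "g y - g x \<in> D"
      using iff[of y x] coset_eq_iff[OF C, of y x] that by auto
    then show ?thesis using coset_eq_iff[OF D] unfolding h_def y_def by blast
  qed
  have "inj_on h (cosets A C)"
    by (auto simp: inj_on_def cosets_def h coset_eq_iff[OF C] coset_eq_iff[OF D] iff)
  moreover have "h ` cosets A C = cosets B D"
  proof
    show "h ` cosets A C \<subseteq> cosets B D" by (auto simp: cosets_def h gB)
    show "cosets B D \<subseteq> h ` cosets A C"
    proof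
      fix S assume "S \<in> cosets B D"
      then obtain b where b: "b \<in> B" "S = (+) b ` D" by (auto simp: cosets_def)
      obtain a where a: "a \<in> A" "b - g a \<in> D" using surj[OF b(1)] by blast
      have "S = h ((+) a ` C)" using a b coset_eq_iff[OF D] h by metis
      then show "S \<in> h ` cosets A C" using a by (auto simp: cosets_def)
    qed
  qed
  ultimately show thesis using that by (auto simp: bij_betw_def)
qed

lemma
  assumes C: "add_subgroup C" and D: "add_subgroup D"
    and gB: "\<And>x. x \<in> A \<Longrightarrow> g x \<in> B"
    and iff: "\<And>x y. x \<in> A \<Longrightarrow> y \<in> A \<Longrightarrow> g x - g y \<in> D \<longleftrightarrow> x - y \<in> C"
    and surj: "\<And>b. b \<in> B \<Longrightarrow> \<exists>a\<in>A. b - g a \<in> D"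
  shows add_index_eqI: "add_index A C = add_index B D"
    and finite_cosets_iffI: "finite (cosets A C) \<longleftrightarrow> finite (cosets B D)"
proof -
  obtain h where h: "bij_betw h (cosets A C) (cosets B D)"
    using bij_betw_cosets[OF C D gB iff surj] by blast
  show "add_index A C = add_index B D"
    using bij_betw_same_card[OF h] by (simp add: add_index_def)
  show "finite (cosets A C) \<longleftrightarrow> finite (cosets B D)"
    using bij_betw_finite[OF h] .
qed

text \<open>Lagrange's theorem: with a representative \<open>r S\<close> chosen for every coset
  \<open>S\<close> of \<open>B\<close> in \<open>A\<close>, translation by \<open>r S\<close> turns
  the cosets of \<open>C\<close> in \<open>B\<close> into those contained in
  \<open>S\<close>.\<close>

lemma
  assumes A: "add_subgroup A" and B: "add_subgroup B" and C: "add_subgroup C"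
    and "C \<subseteq> B" "B \<subseteq> A"
    and fin: "finite (cosets A B)" "finite (cosets B C)"
  shows add_index_tower: "add_index A C = add_index A B * add_index B C"
    and finite_cosets_tower: "finite (cosets A C)"
proof -
  define r where "r S = (SOME x. x \<in> A \<and> S = (+) x ` B)" for S
  have r: "r S \<in> A \<and> S = (+) (r S) ` B" if "S \<in> cosets A B" for S
    unfolding r_def by (rule someI_ex) (use that in \<open>auto simp: cosets_def\<close>)
  define f where "f = (\<lambda>(S, T). (+) (r S) ` T)"
  have f: "f (S, (+) b ` C) = (+) (r S + b) ` C" for S b
    by (auto simp: f_def image_image add.assoc)
  have "inj_on f (cosets A B \<times> cosets B C)"
  proof (rule inj_onI, clarify)
    fix S T S' T' assume *: "f (S, T) = f (S', T')"
      and S: "S \<in> cosets A B" "S' \<in> cosets A B" and T: "T \<in> cosets B C" "T' \<in> cosets B C"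
    obtain b b' where b: "b \<in> B" "T = (+) b ` C" "b' \<in> B" "T' = (+) b' ` C"
      using T by (auto simp: cosets_def)
    have 1: "(r S + b) - (r S' + b') \<in> C"
      using * coset_eq_iff[OF C] unfolding b f by blast
    then have "((r S + b) - (r S' + b')) + (b' - b) \<in> B"
      using \<open>C \<subseteq> B\<close> add_subgroup_add[OF B] add_subgroup_diff[OF B] b by blast
    then have "r S - r S' \<in> B" by (simp add: algebra_simps)
    then have "S = S'" using r[OF S(1)] r[OF S(2)] coset_eq_iff[OF B] by metis
    moreover from this have "T = T'" using 1 coset_eq_iff[OF C] unfolding b by simp
    ultimately show "S = S' \<and> T = T'" by simp
  qed
  moreover have "f ` (cosets A B \<times> cosets B C) = cosets A C"
  proof
    show "f ` (cosets A B \<times> cosets B C) \<subseteq> cosets A C"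
    proof clarify
      fix S T assume "S \<in> cosets A B" "T \<in> cosets B C"
      then obtain b where b: "b \<in> B" "T = (+) b ` C" by (auto simp: cosets_def)
      have "r S + b \<in> A" using r[OF \<open>S \<in> cosets A B\<close>] b \<open>B \<subseteq> A\<close> add_subgroup_add[OF A] by blast
      then show "f (S, T) \<in> cosets A C" unfolding b f by (auto simp: cosets_def)
    qed
    show "cosets A C \<subseteq> f ` (cosets A B \<times> cosets B C)"
    proof
      fix U assume "U \<in> cosets A C"
      then obtain a where a: "a \<in> A" "U = (+) a ` C" by (auto simp: cosets_def)
      define S where "S = (+) a ` B"
      have S: "S \<in> cosets A B" using a by (auto simp: S_def cosets_def)
      have "a - r S \<in> B" using r[OF S] coset_eq_iff[OF B] unfolding S_def by blast
      moreover have "U = f (S, (+) (a - r S) ` C)" unfolding f a by simp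
      ultimately show "U \<in> f ` (cosets A B \<times> cosets B C)" using S by (auto simp: cosets_def)
    qed
  qed
  ultimately have "bij_betw f (cosets A B \<times> cosets B C) (cosets A C)"
    by (simp add: bij_betw_def)
  from bij_betw_same_card[OF this] bij_betw_finite[OF this] fin
  show "add_index A C = add_index A B * add_index B C" "finite (cosets A C)"
    by (simp_all add: add_index_def card_cartesian_product)
qed

text \<open>Adding \<open>B\<close> to a coset of \<open>C\<close> yields a coset of
  \<open>B\<close>, and every coset of \<open>B\<close> arises in this way.\<close>

lemma finite_cosets_mono:
  assumes B: "add_subgroup B" and C: "add_subgroup C" and "C \<subseteq> B"
    and fin: "finite (cosets A C)"
  shows "finite (cosets A B)"
proof -
  have "\<exists>h. h ` cosets A C = cosets A B"
  proof
    have "(\<Union>x\<in>(+) a ` C. (+) x ` B) = (+) a ` B" for a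
    proof -
      have eq: "(+) (a + c) ` B = (+) a ` B" if "c \<in> C" for c
        using coset_eq_iff[OF B, of "a + c" a] that \<open>C \<subseteq> B\<close> by auto
      have "(\<Union>c\<in>C. (+) (a + c) ` B) = (\<Union>c\<in>C. (+) a ` B)" by (rule SUP_cong[OF refl eq])
      also have "\<dots> = (+) a ` B" using add_subgroup_zero[OF C] by blast
      finally show ?thesis by simp
    qed
    then show "(\<lambda>S. \<Union>x\<in>S. (+) x ` B) ` cosets A C = cosets A B"
      unfolding cosets_def image_image by (intro image_cong) auto
  qed
  then show ?thesis using fin by (metis finite_imageI)
qed

lemma add_index_ge_2:
  assumes "add_subgroup A" "add_subgroup C" "C \<subset> A" "finite (cosets A C)"
  shows "2 \<le> add_index A C"
proof -
  obtain b where b: "b \<in> A" "b \<notin> C" using \<open>C \<subset> A\<close> by blast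
  have "(+) b ` C \<noteq> (+) 0 ` C" using coset_eq_iff[OF assms(2), of b 0] b by simp
  moreover have "{(+) b ` C, (+) 0 ` C} \<subseteq> cosets A C"
    using b add_subgroup_zero[OF assms(1)] unfolding cosets_def by blast
  ultimately show ?thesis
    unfolding add_index_def using card_mono[OF assms(4)] by (metis card_2_iff)
qed

text \<open>This makes the index a measure for choosing maximal ideals of a given kind: ideals of
  least index take the place of a chain condition.\<close>

lemma add_index_strict_mono:
  assumes A: "add_subgroup A" and B: "add_subgroup B" and C: "add_subgroup C"
    and "C \<subset> B" "B \<subseteq> A" and fin: "finite (cosets A C)"
  shows "add_index A B < add_index A C"
proof -
  have finB: "finite (cosets B C)"
    by (rule finite_subset[OF _ fin]) (use \<open>B \<subseteq> A\<close> in \<open>auto simp: cosets_def\<close>)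
  have finA: "finite (cosets A B)"
    by (rule finite_cosets_mono[OF B C _ fin]) (use \<open>C \<subset> B\<close> in blast)
  have "2 \<le> add_index B C" using add_index_ge_2[OF B C] finB \<open>C \<subset> B\<close> by blast
  moreover have "cosets A B \<noteq> {}"
    using add_subgroup_zero[OF A] by (auto simp: cosets_def)
  then have "add_index A B > 0" using finA by (simp add: add_index_def card_gt_0_iff)
  ultimately show ?thesis
    using add_index_tower[OF A B C _ \<open>B \<subseteq> A\<close> finA finB] \<open>C \<subset> B\<close> by auto
qed

lemma pigeonhole_cosets:
  assumes "finite (cosets A C)" "add_subgroup C" "\<And>k::nat. f k \<in> A"
  obtains i j where "i < j" "f j - f i \<in> C"
proof -
  have "\<not> inj (\<lambda>k. (+) (f k) ` C)"
  proof
    assume "inj (\<lambda>k. (+) (f k) ` C)"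
    then have "infinite (range (\<lambda>k. (+) (f k) ` C))" by (rule range_inj_infinite)
    moreover have "range (\<lambda>k. (+) (f k) ` C) \<subseteq> cosets A C" using assms(3) by (auto simp: cosets_def)
    ultimately show False using assms(1) finite_subset by blast
  qed
  then obtain i j where "i \<noteq> j" "(+) (f i) ` C = (+) (f j) ` C"
    unfolding inj_def by blast
  then have "f j - f i \<in> C" "f i - f j \<in> C"
    using coset_eq_iff[OF assms(2)] by blast+
  with \<open>i \<noteq> j\<close> show thesis using that[of i j] that[of j i] by (cases "i < j") auto
qed

section \<open>Dedekind domains with finite quotients\<close>

locale field_subring =
  fixes A :: "'a::field set"
  assumes zero_mem: "0 \<in> A" and one_mem: "1 \<in> A"
    and diff_mem: "x \<in> A \<Longrightarrow> y \<in> A \<Longrightarrow> x - y \<in> A"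
    and mult_mem: "x \<in> A \<Longrightarrow> y \<in> A \<Longrightarrow> x * y \<in> A"
begin

lemma add_subgroup_A: "add_subgroup A"
  by (simp add: add_subgroup_def zero_mem diff_mem)

lemmas add_mem = add_subgroup_add[OF add_subgroup_A]
  and uminus_mem = add_subgroup_uminus[OF add_subgroup_A]

lemma power_mem: "x \<in> A \<Longrightarrow> x ^ k \<in> A"
  by (induction k) (simp_all add: one_mem mult_mem)

lemma sum_mem: "(\<And>i. i \<in> S \<Longrightarrow> f i \<in> A) \<Longrightarrow> sum f S \<in> A"
  by (induction S rule: infinite_finite_induct) (simp_all add: zero_mem add_mem)

lemma prod_mem: "(\<And>i. i \<in> S \<Longrightarrow> f i \<in> A) \<Longrightarrow> prod f S \<in> A"
  by (induction S rule: infinite_finite_induct) (simp_all add: one_mem mult_mem)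

lemmas mem = zero_mem one_mem diff_mem add_mem uminus_mem mult_mem power_mem

definition idl :: "'a set \<Rightarrow> bool" where
  "idl I \<longleftrightarrow> I \<subseteq> A \<and> add_subgroup I \<and> (\<forall>a\<in>A. \<forall>x\<in>I. a * x \<in> I)"

lemma idlD:
  assumes "idl I"
  shows idl_sub: "\<And>x. x \<in> I \<Longrightarrow> x \<in> A" and idl_subgroup: "add_subgroup I"
    and idl_mult: "\<And>a x. a \<in> A \<Longrightarrow> x \<in> I \<Longrightarrow> a * x \<in> I"
    and idl_zero: "0 \<in> I" and idl_add: "\<And>x y. x \<in> I \<Longrightarrow> y \<in> I \<Longrightarrow> x + y \<in> I"
    and idl_diff: "\<And>x y. x \<in> I \<Longrightarrow> y \<in> I \<Longrightarrow> x - y \<in> I"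
  using assms add_subgroupD by (auto simp: idl_def)

lemma idl_mult2: "idl I \<Longrightarrow> x \<in> I \<Longrightarrow> a \<in> A \<Longrightarrow> x * a \<in> I"
  using idl_mult[of I a x] by (simp add: mult.commute)

lemma idl_one_iff: "idl I \<Longrightarrow> 1 \<in> I \<longleftrightarrow> I = A"
proof
  assume "idl I" "1 \<in> I"
  show "I = A"
  proof (intro equalityI subsetI)
    fix x assume "x \<in> A"
    from idl_mult[OF \<open>idl I\<close> this \<open>1 \<in> I\<close>] show "x \<in> I" by simp
  qed (rule idl_sub[OF \<open>idl I\<close>])
qed (simp add: one_mem)

lemma idl_principal: "a \<in> A \<Longrightarrow> idl ((*) a ` A)"
  unfolding idl_def add_subgroup_def
proof (intro conjI ballI)
  assume a: "a \<in> A"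
  show "(*) a ` A \<subseteq> A" using a mult_mem by auto
  show "0 \<in> (*) a ` A" using zero_mem by force
  show "x - y \<in> (*) a ` A" if "x \<in> (*) a ` A" "y \<in> (*) a ` A" for x y
    using that by (auto simp flip: right_diff_distrib intro!: imageI diff_mem)
  show "b * x \<in> (*) a ` A" if "b \<in> A" "x \<in> (*) a ` A" for b x
    using that by (auto simp: mult.left_commute intro!: imageI mult_mem)
qed

lemma principal_subset: "idl I \<Longrightarrow> a \<in> I \<Longrightarrow> (*) a ` A \<subseteq> I"
  using idl_mult2 by blast

lemma idl_nonzero:
  assumes "idl I" "I \<noteq> {0}" obtains a where "a \<in> I" "a \<noteq> 0" "a \<in> A"
  using assms idl_zero[OF assms(1)] idl_sub[OF assms(1)] that by blast

end

text \<open>The second axiom is complete integral closedness for a fraction whose powers have its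
  own denominator \<open>y\<close> as a common denominator. Finite quotients take the place of the
  Noetherian property and of dimension one.\<close>

locale dedekind_subring = field_subring A for A :: "'a::field set" +
  assumes finite_quotient: "a \<in> A \<Longrightarrow> a \<noteq> 0 \<Longrightarrow> finite (cosets A ((*) a ` A))"
    and completely_integrally_closed:
      "x \<in> A \<Longrightarrow> y \<in> A \<Longrightarrow> y \<noteq> 0 \<Longrightarrow> (\<And>k::nat. y * (x / y) ^ k \<in> A) \<Longrightarrow> x / y \<in> A"
begin

section \<open>Non-zero primes in a ring with finite quotients\<close>

lemma finite_cosets_idl:
  assumes "idl I" "I \<noteq> {0}" shows "finite (cosets A I)"
proof -
  obtain a where a: "a \<in> I" "a \<noteq> 0" "a \<in> A" using idl_nonzero[OF assms] .
  show ?thesis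
    using finite_cosets_mono[OF idl_subgroup[OF assms(1)] idl_subgroup[OF idl_principal[OF a(3)]]
      principal_subset[OF assms(1) a(1)] finite_quotient[OF a(3,2)]] .
qed

text \<open>These are the non-zero prime ideals; the name anticipates
  \<open>mp_maximal\<close>.\<close>

definition maxprime :: "'a set \<Rightarrow> bool" where
  "maxprime P \<longleftrightarrow> idl P \<and> P \<noteq> {0} \<and> 1 \<notin> P \<and> (\<forall>x\<in>A. \<forall>y\<in>A. x * y \<in> P \<longrightarrow> x \<in> P \<or> y \<in> P)"

lemma maxprimeD:
  assumes "maxprime P"
  shows mp_idl: "idl P" and mp_nz: "P \<noteq> {0}" and mp_one: "1 \<notin> P"
    and mp_prime: "\<And>x y. x \<in> A \<Longrightarrow> y \<in> A \<Longrightarrow> x * y \<in> P \<Longrightarrow> x \<in> P \<or> y \<in> P"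
  using assms by (auto simp: maxprime_def)

lemma mp_notin_mult: "maxprime P \<Longrightarrow> x \<in> A - P \<Longrightarrow> y \<in> A - P \<Longrightarrow> x * y \<in> A - P"
  using mp_prime mult_mem by blast

lemma mp_notin_power: "maxprime P \<Longrightarrow> x \<in> A - P \<Longrightarrow> x ^ k \<in> A - P"
  by (induction k) (auto simp: one_mem mp_one intro: mp_notin_mult[THEN DiffD1] dest: mp_notin_mult[THEN DiffD2])

lemma mp_notin_prod:
  assumes "maxprime P" "\<And>i. i \<in> S \<Longrightarrow> f i \<in> A - P" shows "prod f S \<in> A - P"
  using assms(2)
proof (induction S rule: infinite_finite_induct)
  case (insert i S)
  then show ?case using mp_notin_mult[OF assms(1), of "f i" "prod f S"] by simp
qed (use one_mem mp_one[OF assms(1)] in auto)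

lemma mp_power_mem: "maxprime P \<Longrightarrow> x \<in> A \<Longrightarrow> x ^ k \<in> P \<Longrightarrow> x \<in> P"
  using mp_notin_power[of P x k] by blast

text \<open>In the finite quotient by \<open>I\<close> the powers of \<open>x\<close> cannot all be
  different. The lemma is used to produce inverses modulo a prime and to bound valuations.\<close>

lemma power_cycle:
  assumes "idl I" "I \<noteq> {0}" "x \<in> A"
  obtains i r where "r > 0" "x ^ i * (1 - x ^ r) \<in> I"
proof -
  obtain i j where ij: "i < j" "x ^ j - x ^ i \<in> I"
    using pigeonhole_cosets[OF finite_cosets_idl[OF assms(1,2)] idl_subgroup[OF assms(1)], of "\<lambda>k. x ^ k"]
      power_mem[OF assms(3)] by blast
  have "x ^ i * (1 - x ^ (j - i)) = x ^ i - x ^ j"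
    using ij(1) by (simp add: right_diff_distrib flip: power_add)
  also have "\<dots> \<in> I"
    using add_subgroup_uminus[OF idl_subgroup[OF assms(1)] ij(2)] by simp
  finally show thesis using that[of "j - i" i] ij(1) by simp
qed

text \<open>Powers of \<open>s\<close> repeat modulo \<open>P\<close>, and the factor
  \<open>s ^ i\<close> can be cancelled because \<open>P\<close> is prime. Hence some
  \<open>s ^ r\<close> is congruent to 1 and \<open>s ^ (r - 1)\<close> is an inverse.\<close>

lemma mp_inverse:
  assumes P: "maxprime P" and s: "s \<in> A - P"
  obtains t where "t \<in> A" "1 - s * t \<in> P"
proof -
  obtain i r where ir: "r > 0" "s ^ i * (1 - s ^ r) \<in> P"
    using power_cycle[OF mp_idl[OF P] mp_nz[OF P]] s by blast
  have "s ^ i \<in> A - P" using mp_notin_power[OF P s] .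
  then have "1 - s ^ r \<in> P" using ir(2) mp_prime[OF P, of "s ^ i" "1 - s ^ r"] s by (auto simp: mem)
  moreover have "s ^ r = s * s ^ (r - 1)" using ir(1) by (cases r) auto
  ultimately show thesis using that[of "s ^ (r - 1)"] s by (simp add: mem)
qed

lemma mp_maximal:
  assumes P: "maxprime P" and "idl I" "P \<subseteq> I" "1 \<notin> I" shows "I = P"
proof (rule ccontr)
  assume "I \<noteq> P"
  then obtain s where s: "s \<in> I" "s \<notin> P" using \<open>P \<subseteq> I\<close> by blast
  then obtain t where "t \<in> A" "1 - s * t \<in> P" using mp_inverse[OF P] idl_sub[OF \<open>idl I\<close>] by blast
  then have "(1 - s * t) + s * t \<in> I"
    using s \<open>P \<subseteq> I\<close> \<open>idl I\<close> idl_add idl_mult2 by blast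
  then show False using \<open>1 \<notin> I\<close> by simp
qed

lemma idl_insert:
  assumes "idl I" "x \<in> A" shows "idl {y + a * x | y a. y \<in> I \<and> a \<in> A}"
  unfolding idl_def add_subgroup_def
proof (intro conjI ballI)
  let ?J = "{y + a * x | y a. y \<in> I \<and> a \<in> A}"
  show "?J \<subseteq> A" using assms idl_sub[OF assms(1)] by (auto intro!: mem)
  show "0 \<in> ?J" using idl_zero[OF assms(1)] zero_mem by force
  show "u - v \<in> ?J" if uv: "u \<in> ?J" "v \<in> ?J" for u v
  proof -
    obtain y a y' a' where "u = y + a * x" "v = y' + a' * x" "y \<in> I" "a \<in> A" "y' \<in> I" "a' \<in> A"
      using uv by blast
    then have "u - v = (y - y') + (a - a') * x" "y - y' \<in> I" "a - a' \<in> A"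
      using idl_diff[OF assms(1)] diff_mem by (auto simp: algebra_simps)
    then show ?thesis by blast
  qed
  show "b * u \<in> ?J" if bu: "b \<in> A" "u \<in> ?J" for b u
  proof -
    obtain y a where "u = y + a * x" "y \<in> I" "a \<in> A" using bu by blast
    then have "b * u = b * y + (b * a) * x" "b * y \<in> I" "b * a \<in> A"
      using idl_mult[OF assms(1)] mult_mem bu by (auto simp: algebra_simps)
    then show ?thesis by blast
  qed
qed

text \<open>A proper ideal of least index above \<open>I\<close> is prime: if it contained
  \<open>x * y\<close> but neither factor, adjoining \<open>x\<close> would give a larger ideal,
  still proper, of smaller index.\<close>

lemma exists_maxprime:
  assumes I: "idl I" "I \<noteq> {0}" "1 \<notin> I"
  obtains P where "maxprime P" "I \<subseteq> P"
proof -
  define ok where "ok J \<longleftrightarrow> idl J \<and> I \<subseteq> J \<and> 1 \<notin> J" for J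
  have nz: "J \<noteq> {0}" if "ok J" for J using that I idl_zero unfolding ok_def by blast
  have "ok I" using I by (simp add: ok_def)
  then obtain P where P: "ok P" "\<And>J. ok J \<Longrightarrow> add_index A P \<le> add_index A J"
    using ex_has_least_nat[of ok I "add_index A"] by blast
  have idlP: "idl P" using P by (simp add: ok_def)
  have "x \<in> P \<or> y \<in> P" if xy: "x \<in> A" "y \<in> A" "x * y \<in> P" for x y
  proof (rule ccontr)
    assume n: "\<not> (x \<in> P \<or> y \<in> P)"
    define J where "J = {y + a * x | y a. y \<in> P \<and> a \<in> A}"
    have J: "idl J" unfolding J_def by (rule idl_insert[OF idlP xy(1)])
    have PJ: "P \<subseteq> J" unfolding J_def using zero_mem by force
    have "x \<in> J" unfolding J_def using idl_zero[OF idlP] one_mem by force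
    then have "P \<subset> J" using PJ n by blast
    have "1 \<notin> J"
    proof
      assume "1 \<in> J"
      then obtain p a where "1 = p + a * x" "p \<in> P" "a \<in> A" unfolding J_def by blast
      then have "y = y * p + a * (x * y)" by (metis distrib_left mult.commute mult.left_commute mult.right_neutral)
      also have "\<dots> \<in> P" using idl_add[OF idlP idl_mult[OF idlP] idl_mult[OF idlP]] xy \<open>p \<in> P\<close> \<open>a \<in> A\<close> by blast
      finally show False using n by blast
    qed
    then have "ok J" using J PJ P(1) by (auto simp: ok_def)
    moreover have "add_index A J < add_index A P"
      using add_index_strict_mono[OF add_subgroup_A idl_subgroup[OF J] idl_subgroup[OF idlP] \<open>P \<subset> J\<close>]
        finite_cosets_idl[OF idlP nz[OF P(1)]] idl_sub[OF J] by blast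
    ultimately show False using P(2) by fastforce
  qed
  then have "maxprime P" using P(1) nz[OF P(1)] by (simp add: maxprime_def ok_def)
  then show thesis using that P(1) by (simp add: ok_def)
qed

text \<open>Among the \<open>b\<close> whose annihilator in \<open>A/(a)\<close> is contained in \<open>P\<close>, one with maximal
  annihilator is annihilated by \<open>P\<close>: for \<open>x \<in> P\<close> some \<open>x^i (1 - x^r)\<close> vanishes in \<open>A/(a)\<close>, and
  \<open>1 - x^r \<notin> P\<close>.\<close>

lemma prime_annihilator:
  assumes P: "maxprime P" and a: "a \<in> P" "a \<noteq> 0"
  obtains b where "b \<in> A" "b \<notin> (*) a ` A" "\<And>x. x \<in> P \<Longrightarrow> x * b \<in> (*) a ` A"
proof -
  have aA: "a \<in> A" using a idl_sub[OF mp_idl[OF P]] by blast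
  define I where "I = (*) a ` A"
  have I: "idl I" "I \<noteq> {0}" "I \<subseteq> P"
    using idl_principal[OF aA] one_mem a principal_subset[OF mp_idl[OF P] a(1)] by (force simp: I_def)+
  define Ann where "Ann b = {x \<in> A. x * b \<in> I}" for b
  have Ann: "idl (Ann b)" if "b \<in> A" for b
    unfolding idl_def add_subgroup_def Ann_def
    using idl_zero[OF I(1)] idl_diff[OF I(1)] idl_mult[OF I(1)] by (auto simp: left_diff_distrib mult.assoc mem)
  have AnnI: "I \<subseteq> Ann b" if "b \<in> A" for b
    using idl_mult2[OF I(1)] idl_sub[OF I(1)] that unfolding Ann_def by blast
  define ok where "ok b \<longleftrightarrow> b \<in> A \<and> Ann b \<subseteq> P" for b
  have "ok 1" using one_mem I by (auto simp: ok_def Ann_def)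
  then obtain b where b: "ok b" "\<And>c. ok c \<Longrightarrow> add_index A (Ann b) \<le> add_index A (Ann c)"
    using ex_has_least_nat[of ok 1 "\<lambda>b. add_index A (Ann b)"] by blast
  have bA: "b \<in> A" using b by (simp add: ok_def)
  have max: "Ann c = Ann b" if "ok c" "Ann b \<subseteq> Ann c" for c
  proof (rule ccontr)
    assume "Ann c \<noteq> Ann b"
    have cA: "c \<in> A" using that by (simp add: ok_def)
    have "Ann b \<noteq> {0}" using AnnI[OF bA] I idl_zero[OF I(1)] by blast
    then have "add_index A (Ann c) < add_index A (Ann b)"
      using add_index_strict_mono[OF add_subgroup_A idl_subgroup[OF Ann[OF cA]] idl_subgroup[OF Ann[OF bA]]]
        finite_cosets_idl[OF Ann[OF bA]] that \<open>Ann c \<noteq> Ann b\<close> idl_sub[OF Ann[OF cA]] by blast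
    then show False using b(2)[OF that(1)] by simp
  qed
  have Ann_mult: "Ann b \<subseteq> Ann (c * b)" if "c \<in> A" for c
  proof
    fix y assume "y \<in> Ann b"
    then have "y \<in> A" "c * (y * b) \<in> I" using idl_mult[OF I(1) that] by (auto simp: Ann_def)
    then show "y \<in> Ann (c * b)" by (simp add: Ann_def mult_ac)
  qed
  have "x * b \<in> I" if x: "x \<in> P" for x
  proof (rule ccontr)
    assume nx: "x * b \<notin> I"
    have xA: "x \<in> A" using x idl_sub[OF mp_idl[OF P]] by blast
    have nP: "1 - x ^ r \<notin> P" if "r > 0" for r
    proof
      assume "1 - x ^ r \<in> P"
      moreover have "x ^ r \<in> P" using \<open>r > 0\<close> x idl_mult2[OF mp_idl[OF P] x power_mem[OF xA]] by (cases r) auto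
      ultimately have "(1 - x ^ r) + x ^ r \<in> P" using idl_add[OF mp_idl[OF P]] by blast
      then show False using mp_one[OF P] by simp
    qed
    obtain i r where ir: "r > 0" "x ^ i * (1 - x ^ r) \<in> I" using power_cycle[OF I(1,2) xA] .
    \<comment> \<open>While \<open>x * b \<notin> I\<close>, multiplying by \<open>x\<close> cannot
      enlarge the annihilator. A \<open>y \<notin> P\<close> that kills \<open>x ^ Suc j * b\<close>
      also kills \<open>x * b\<close> by induction; then \<open>y * b\<close> is admissible with
      \<open>x\<close> in its annihilator, which equals \<open>Ann b\<close> by maximality.\<close>
    have stable: "Ann (x ^ j * b) = Ann b" for j
    proof (induction j)
      case (Suc j)
      have cA: "x ^ Suc j * b \<in> A" using xA bA by (intro mem)
      have sub: "Ann b \<subseteq> Ann (x ^ Suc j * b)" by (rule Ann_mult[OF power_mem[OF xA]])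
      have "ok (x ^ Suc j * b)"
      proof (rule ccontr)
        assume "\<not> ok (x ^ Suc j * b)"
        then obtain y where y: "y \<in> A" "y * (x ^ Suc j * b) \<in> I" "y \<notin> P"
          using cA by (auto simp: ok_def Ann_def)
        then have "y * x \<in> Ann (x ^ j * b)" using xA by (auto simp: Ann_def mem mult_ac)
        then have yx: "y * x * b \<in> I" using Suc.IH by (auto simp: Ann_def)
        have ybA: "y * b \<in> A" using y bA by (intro mem)
        have sub2: "Ann b \<subseteq> Ann (y * b)" by (rule Ann_mult[OF y(1)])
        have "ok (y * b)"
        proof -
          have "z \<in> P" if "z \<in> A" "z * (y * b) \<in> I" for z
          proof -
            have "z * y \<in> Ann b" using that y by (auto simp: Ann_def mem mult.assoc)
            then have "z * y \<in> P" using b(1) by (auto simp: ok_def)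
            then show ?thesis using mp_prime[OF P that(1) y(1)] y(3) by blast
          qed
          then show ?thesis using ybA by (auto simp: ok_def Ann_def)
        qed
        then have "Ann (y * b) = Ann b" using max sub2 by blast
        moreover have "x \<in> Ann (y * b)" using yx xA by (simp add: Ann_def mult_ac)
        ultimately show False using nx by (simp add: Ann_def)
      qed
      then show ?case using max sub by blast
    qed simp
    have "1 - x ^ r \<in> Ann (x ^ i * b)"
      using idl_mult2[OF I(1) ir(2) bA] xA by (simp add: Ann_def mem mult_ac)
    then have "1 - x ^ r \<in> Ann b" using stable by simp
    then show False using nP[OF ir(1)] b(1) by (auto simp: ok_def)
  qed
  moreover have "b \<notin> I"
  proof
    assume "b \<in> I"
    then have "1 \<in> Ann b" using one_mem by (simp add: Ann_def)
    then show False using b(1) mp_one[OF P] by (auto simp: ok_def)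
  qed
  ultimately show thesis using that bA by (simp add: I_def)
qed

text \<open>For \<open>b\<close> as in the previous lemma, \<open>b/a\<close> maps \<open>P\<close> into \<open>A\<close>, but not into \<open>P\<close>: otherwise
  \<open>b/a\<close> would be almost integral over \<open>A\<close>.\<close>

lemma mp_locally_principal:
  assumes P: "maxprime P"
  shows "\<exists>\<pi>\<in>P. \<exists>u\<in>A - P. \<forall>x\<in>P. \<exists>y\<in>A. u * x = \<pi> * y"
proof -
  obtain a where a: "a \<in> P" "a \<noteq> 0" "a \<in> A" using idl_nonzero[OF mp_idl[OF P] mp_nz[OF P]] .
  obtain b where b: "b \<in> A" "b \<notin> (*) a ` A" "\<And>x. x \<in> P \<Longrightarrow> x * b \<in> (*) a ` A"
    using prime_annihilator[OF P a(1,2)] by blast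
  have quot: "x * (b / a) \<in> A" if "x \<in> P" for x using b(3)[OF that] a(2) by auto
  have "\<exists>x\<in>P. x * (b / a) \<notin> P"
  proof (rule ccontr)
    assume "\<not> ?thesis"
    then have *: "x * (b / a) \<in> P" if "x \<in> P" for x using that by blast
    \<comment> \<open>Stability of \<open>P\<close> under \<open>b / a\<close> makes
      \<open>a\<close> a common denominator of all powers of \<open>b / a\<close>, as
      \<open>completely_integrally_closed\<close> demands.\<close>
    have "a * (b / a) ^ k \<in> P" for k
      by (induction k) (use * a(1) in \<open>simp_all add: mult.assoc [symmetric] power_Suc2 del: power_Suc times_divide_eq_right\<close>)
    then have "b / a \<in> A"
      using completely_integrally_closed[OF b(1) a(3,2)] idl_sub[OF mp_idl[OF P]] by blast
    then have "a * (b / a) \<in> (*) a ` A" by (rule imageI)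
    then show False using b(2) a(2) by simp
  qed
  then obtain p where p: "p \<in> P" "p * (b / a) \<notin> P" by blast
  \<comment> \<open>So \<open>p\<close> is the local generator and \<open>p * (b / a)\<close>, which
    lies in \<open>A\<close> but not in \<open>P\<close>, is the denominator
    \<open>u\<close>.\<close>
  have "\<exists>y\<in>A. p * (b / a) * x = p * y" if "x \<in> P" for x
    using quot[OF that] by (intro bexI[of _ "x * (b / a)"]) (auto simp: mult_ac)
  then show ?thesis using p quot[OF p(1)] by blast
qed

section \<open>Symbolic powers and valuations at one prime\<close>

definition unif :: "'a set \<Rightarrow> 'a" where
  "unif P = (SOME \<pi>. \<pi> \<in> P \<and> (\<exists>u\<in>A - P. \<forall>x\<in>P. \<exists>y\<in>A. u * x = \<pi> * y))"

text \<open>The symbolic power of \<open>P\<close>, that is, the preimage of the \<open>k\<close>-th power of the maximal ideal of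
  the localisation at \<open>P\<close>, which is generated by \<open>unif P\<close>.\<close>

definition sympow :: "'a set \<Rightarrow> nat \<Rightarrow> 'a set" where
  "sympow P k = {x \<in> A. \<exists>s\<in>A - P. \<exists>z\<in>A. s * x = unif P ^ k * z}"

lemma sympowI: "x \<in> A \<Longrightarrow> s \<in> A - P \<Longrightarrow> z \<in> A \<Longrightarrow> s * x = unif P ^ k * z \<Longrightarrow> x \<in> sympow P k"
  unfolding sympow_def by blast

lemma sympowE:
  assumes "x \<in> sympow P k"
  obtains s z where "x \<in> A" "s \<in> A - P" "z \<in> A" "s * x = unif P ^ k * z"
  using assms unfolding sympow_def by blast

lemma sympow_sub: "sympow P k \<subseteq> A"
  by (auto simp: sympow_def)

context
  fixes P assumes P: "maxprime P"
begin

lemma unif_aux: "unif P \<in> P \<and> (\<exists>u\<in>A - P. \<forall>x\<in>P. \<exists>y\<in>A. u * x = unif P * y)"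
  unfolding unif_def by (rule someI_ex) (use mp_locally_principal[OF P] in blast)

lemma unif_mem: "unif P \<in> P"
  using unif_aux by blast

lemma unif_mem_A: "unif P \<in> A"
  using unif_mem idl_sub[OF mp_idl[OF P]] by blast

lemma unif_dvd: obtains u where "u \<in> A - P" "\<And>x. x \<in> P \<Longrightarrow> \<exists>y\<in>A. u * x = unif P * y"
  using unif_aux by blast

lemma notin_nz: "s \<in> A - P \<Longrightarrow> s \<noteq> 0"
  using idl_zero[OF mp_idl[OF P]] by blast

lemma unif_nz: "unif P \<noteq> 0"
proof
  assume 0: "unif P = 0"
  obtain u where u: "u \<in> A - P" "\<And>x. x \<in> P \<Longrightarrow> \<exists>y\<in>A. u * x = unif P * y" using unif_dvd by blast
  obtain a where "a \<in> P" "a \<noteq> 0" using idl_nonzero[OF mp_idl[OF P] mp_nz[OF P]] by blast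
  then show False using u 0 notin_nz by fastforce
qed

lemma sympow_subgroup: "add_subgroup (sympow P k)"
  unfolding add_subgroup_def
proof (intro conjI ballI)
  show "0 \<in> sympow P k"
    by (rule sympowI[of _ 1 _ 0]) (use mp_one[OF P] in \<open>auto simp: mem\<close>)
  show "x - y \<in> sympow P k" if xy: "x \<in> sympow P k" "y \<in> sympow P k" for x y
  proof -
    obtain s z where x: "x \<in> A" "s \<in> A - P" "z \<in> A" "s * x = unif P ^ k * z"
      using xy(1) by (rule sympowE)
    obtain s' z' where y: "y \<in> A" "s' \<in> A - P" "z' \<in> A" "s' * y = unif P ^ k * z'"
      using xy(2) by (rule sympowE)
    have "(s * s') * (x - y) = s' * (s * x) - s * (s' * y)" by (simp add: algebra_simps)
    also have "\<dots> = unif P ^ k * (s' * z - s * z')" by (simp add: x y algebra_simps)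
    finally show ?thesis
      using x y by (intro sympowI[of "x - y" "s * s'" P "s' * z - s * z'"] mp_notin_mult[OF P]) (auto simp: mem)
  qed
qed

lemma sympow_mult: "a \<in> A \<Longrightarrow> x \<in> sympow P k \<Longrightarrow> a * x \<in> sympow P k"
proof (elim sympowE)
  fix s z assume "a \<in> A" "x \<in> A" "s \<in> A - P" "z \<in> A" "s * x = unif P ^ k * z"
  then show ?thesis by (intro sympowI[of _ s _ "a * z"]) (auto simp: mem mult.left_commute)
qed

lemma sympow_idl: "idl (sympow P k)"
  using sympow_subgroup sympow_mult sympow_sub by (simp add: idl_def)

lemma sympow_0 [simp]: "sympow P 0 = A"
  using one_mem mp_one[OF P] by (auto simp: sympow_def intro!: bexI[of _ 1])

lemma sympow_antimono: "j \<le> k \<Longrightarrow> sympow P k \<subseteq> sympow P j"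
proof (intro subsetI, elim sympowE)
  fix x s z assume "j \<le> k" "x \<in> A" "s \<in> A - P" "z \<in> A" "s * x = unif P ^ k * z"
  moreover from \<open>j \<le> k\<close> have "unif P ^ k = unif P ^ j * unif P ^ (k - j)" by (simp flip: power_add)
  ultimately show "x \<in> sympow P j"
    using unif_mem_A by (intro sympowI[of _ s _ "unif P ^ (k - j) * z"]) (auto simp: mem mult.assoc)
qed

lemma unif_power_mem_sympow: "unif P ^ k \<in> sympow P k"
  by (rule sympowI[of _ 1 _ 1]) (use mp_one[OF P] unif_mem_A in \<open>auto simp: mem\<close>)

lemma sympow_cancel:
  assumes "t \<in> A - P" "x \<in> A" "t * x \<in> sympow P k" shows "x \<in> sympow P k"
proof -
  obtain s z where "s \<in> A - P" "z \<in> A" "s * (t * x) = unif P ^ k * z"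
    using assms(3) by (rule sympowE)
  then show ?thesis
    using assms by (intro sympowI[of _ "s * t" _ z] mp_notin_mult[OF P]) (auto simp: mult.assoc)
qed

lemma sympow_1: "sympow P 1 = P"
proof (intro equalityI subsetI)
  fix x assume "x \<in> sympow P 1"
  then obtain s z where x: "x \<in> A" "s \<in> A - P" "z \<in> A" "s * x = unif P * z"
    by (elim sympowE) auto
  then have "s * x \<in> P" using idl_mult2[OF mp_idl[OF P] unif_mem] by simp
  then show "x \<in> P" using mp_prime[OF P] x by blast
next
  fix x assume x: "x \<in> P"
  obtain u where "u \<in> A - P" "\<And>x. x \<in> P \<Longrightarrow> \<exists>y\<in>A. u * x = unif P * y" using unif_dvd by blast
  then show "x \<in> sympow P 1" using x idl_sub[OF mp_idl[OF P]] by (fastforce simp: sympow_def)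
qed

lemma power_mem_sympow:
  assumes "x \<in> P" shows "x ^ k \<in> sympow P k"
proof -
  have xA: "x \<in> A" using assms idl_sub[OF mp_idl[OF P]] by blast
  obtain u y where uy: "u \<in> A - P" "y \<in> A" "u * x = unif P * y"
    using unif_dvd assms by metis
  then have "u ^ k * x ^ k = unif P ^ k * y ^ k" by (metis power_mult_distrib)
  then show ?thesis using sympowI[OF power_mem[OF xA] mp_notin_power[OF P uy(1)] power_mem[OF uy(2)]] by blast
qed

lemma mp_sub_of_sympow_sub:
  assumes "maxprime Q" "sympow P k \<subseteq> Q" shows "P = Q"
proof -
  have "P \<subseteq> Q"
    using power_mem_sympow assms(2) mp_power_mem[OF assms(1)] idl_sub[OF mp_idl[OF P]] by blast
  then show ?thesis using mp_maximal[OF P mp_idl[OF assms(1)] _ mp_one[OF assms(1)]] by blast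
qed

lemma sympow_nz: "sympow P k \<noteq> {0}"
  by (metis power_not_zero singletonD unif_nz unif_power_mem_sympow)

text \<open>In the localisation at \<open>P\<close>, \<open>x\<close> is \<open>unif P ^ k\<close>
  times the unit \<open>w / s\<close>; so its valuation is exactly \<open>k\<close>.\<close>

definition has_val :: "'a \<Rightarrow> nat \<Rightarrow> bool" where
  "has_val x k \<longleftrightarrow> x \<in> A \<and> (\<exists>s\<in>A - P. \<exists>w\<in>A - P. s * x = unif P ^ k * w)"

text \<open>Valuations add, because \<open>unif P ^ k\<close> cancels in a field and denominators
  outside \<open>P\<close> multiply. With \<open>k + j\<close> equal to the exponent of a quotient,
  this describes annihilators there.\<close>

lemma has_val_mult_iff:
  assumes "has_val x k" "y \<in> A"
  shows "x * y \<in> sympow P (k + j) \<longleftrightarrow> y \<in> sympow P j"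
proof
  obtain s w where x: "x \<in> A" "s \<in> A - P" "w \<in> A - P" "s * x = unif P ^ k * w"
    using assms(1) by (auto simp: has_val_def)
  {
    assume "x * y \<in> sympow P (k + j)"
    then obtain s' z where z: "s' \<in> A - P" "z \<in> A" "s' * (x * y) = unif P ^ (k + j) * z"
      by (rule sympowE)
    have "unif P ^ k * ((s' * w) * y) = s' * y * (s * x)" by (simp add: x mult_ac)
    also have "\<dots> = s * (s' * (x * y))" by (simp add: mult_ac)
    also have "\<dots> = unif P ^ k * (unif P ^ j * (s * z))" by (simp add: z power_add mult_ac)
    finally have "(s' * w) * y = unif P ^ j * (s * z)" using unif_nz by simp
    then show "y \<in> sympow P j"
      using x z assms(2) by (intro sympowI[of _ "s' * w" _ "s * z"] mp_notin_mult[OF P]) (auto simp: mem)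
  }
  assume "y \<in> sympow P j"
  then obtain s' z where z: "s' \<in> A - P" "z \<in> A" "s' * y = unif P ^ j * z" by (rule sympowE)
  have "(s * s') * (x * y) = (s * x) * (s' * y)" by (simp add: mult_ac)
  also have "\<dots> = unif P ^ (k + j) * (w * z)" by (simp add: x z power_add mult_ac)
  finally show "x * y \<in> sympow P (k + j)"
    using x z assms(2) by (intro sympowI[of _ "s * s'" _ "w * z"] mp_notin_mult[OF P]) (auto simp: mem)
qed

lemma has_val_sympow_iff:
  assumes "has_val x k" shows "x \<in> sympow P l \<longleftrightarrow> l \<le> k"
proof
  assume x: "x \<in> sympow P l"
  show "l \<le> k"
  proof (rule ccontr)
    assume "\<not> l \<le> k"
    then have "x * 1 \<in> sympow P (k + 1)" using x sympow_antimono[of "k + 1" l] by auto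
    then have "1 \<in> sympow P 1" using has_val_mult_iff[OF assms one_mem] by blast
    then show False using sympow_1 mp_one[OF P] by simp
  qed
next
  assume "l \<le> k"
  have "x * 1 \<in> sympow P (k + 0)" using has_val_mult_iff[OF assms one_mem, of 0] one_mem by simp
  then show "x \<in> sympow P l" using sympow_antimono[OF \<open>l \<le> k\<close>] by auto
qed

lemma has_val_unif_power: "has_val (unif P ^ k) k"
  unfolding has_val_def using mp_one[OF P] unif_mem_A by (auto simp: mem intro!: bexI[of _ 1])

lemma has_valI:
  assumes "x \<in> sympow P k" "x \<notin> sympow P (Suc k)" shows "has_val x k"
proof -
  obtain s z where x: "x \<in> A" "s \<in> A - P" "z \<in> A" "s * x = unif P ^ k * z"
    using assms(1) by (rule sympowE)
  \<comment> \<open>If \<open>z\<close> were in \<open>P\<close>, one more factor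
    \<open>unif P\<close> could be extracted from it at the cost of a denominator \<open>u\<close>
    outside \<open>P\<close>.\<close>
  have "z \<notin> P"
  proof
    assume "z \<in> P"
    obtain u y where uy: "u \<in> A - P" "y \<in> A" "u * z = unif P * y"
      using unif_dvd \<open>z \<in> P\<close> by metis
    have "(u * s) * x = u * (s * x)" by (simp add: mult_ac)
    also have "\<dots> = unif P ^ k * (u * z)" unfolding x(4) by (simp add: mult_ac)
    also have "\<dots> = unif P ^ Suc k * y" unfolding uy(3) by simp
    finally have "x \<in> sympow P (Suc k)"
      using x uy by (intro sympowI[of _ "u * s" _ y] mp_notin_mult[OF P]) auto
    then show False using assms(2) by blast
  qed
  then show ?thesis using x unfolding has_val_def by blast
qed

text \<open>Modulo \<open>x\<close> the powers of the uniformiser repeat, so \<open>x\<close>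
  divides \<open>unif P ^ i * (1 - unif P ^ r)\<close>. The second factor is outside
  \<open>P\<close>, hence the valuation of \<open>x\<close> is at most \<open>i\<close>.\<close>

lemma not_in_all_sympow:
  assumes "x \<in> A" "x \<noteq> 0" shows "\<exists>k. x \<notin> sympow P k"
proof -
  define I where "I = (*) x ` A"
  have "x * 1 \<in> I" unfolding I_def by (rule imageI[OF one_mem])
  then have "I \<noteq> {0}" using assms(2) by auto
  then have I: "idl I" "I \<noteq> {0}" using idl_principal[OF assms(1)] by (auto simp: I_def)
  obtain i r where ir: "r > 0" "unif P ^ i * (1 - unif P ^ r) \<in> I"
    using power_cycle[OF I unif_mem_A] by blast
  then obtain y where y: "y \<in> A" "unif P ^ i * (1 - unif P ^ r) = x * y" by (auto simp: I_def)
  have t: "1 - unif P ^ r \<in> A - P"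
  proof -
    have "unif P ^ r \<in> P"
      using ir(1) idl_mult2[OF mp_idl[OF P] unif_mem power_mem[OF unif_mem_A]] by (cases r) auto
    then have "1 - unif P ^ r \<notin> P"
      using idl_add[OF mp_idl[OF P], of "1 - unif P ^ r" "unif P ^ r"] mp_one[OF P] by auto
    then show ?thesis using unif_mem_A by (auto simp: mem)
  qed
  have "x \<notin> sympow P (Suc i)"
  proof
    assume "x \<in> sympow P (Suc i)"
    then have "y * x \<in> sympow P (Suc i)" using sympow_mult y(1) by blast
    then have "(1 - unif P ^ r) * unif P ^ i \<in> sympow P (Suc i)" using y(2) by (simp add: mult.commute)
    then have "unif P ^ i \<in> sympow P (Suc i)" using sympow_cancel[OF t] power_mem[OF unif_mem_A] by blast
    then show False using has_val_sympow_iff[OF has_val_unif_power] by simp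
  qed
  then show ?thesis by blast
qed

lemma ex_ord:
  assumes "idl I" "I \<noteq> {0}"
  shows "\<exists>k. \<forall>l. I \<subseteq> sympow P l \<longleftrightarrow> l \<le> k"
proof -
  obtain a where a: "a \<in> I" "a \<noteq> 0" "a \<in> A" using idl_nonzero[OF assms] .
  obtain b where b: "a \<notin> sympow P b" using not_in_all_sympow[OF a(3,2)] by blast
  define k where "k = (GREATEST k. I \<subseteq> sympow P k)"
  have bound: "l \<le> b" if "I \<subseteq> sympow P l" for l
    using sympow_antimono[of b l] a(1) b that by (meson in_mono linear)
  have "I \<subseteq> sympow P 0" using idl_sub[OF assms(1)] by auto
  then have "I \<subseteq> sympow P k" unfolding k_def using GreatestI_nat[of "\<lambda>k. I \<subseteq> sympow P k"] bound by blast
  moreover have "l \<le> k" if "I \<subseteq> sympow P l" for l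
    unfolding k_def using Greatest_le_nat[of "\<lambda>k. I \<subseteq> sympow P k"] bound that by blast
  ultimately show ?thesis using sympow_antimono by blast
qed

text \<open>An inverse \<open>t0\<close> modulo \<open>P\<close> is lifted by the finite geometric
  series in \<open>p = 1 - t * t0\<close>, since \<open>p ^ k\<close> lies in the symbolic power of
  exponent \<open>k\<close>.\<close>

lemma inverse_mod_sympow:
  assumes t: "t \<in> A - P"
  obtains t' where "t' \<in> A" "1 - t * t' \<in> sympow P k"
proof -
  obtain t0 where t0: "t0 \<in> A" "1 - t * t0 \<in> P" using mp_inverse[OF P t] .
  define p where "p = 1 - t * t0"
  have "1 - p ^ k = (1 - p) * (\<Sum>i<k. p ^ i)" by (rule one_diff_power_eq)
  then have "1 - t * (t0 * (\<Sum>i<k. p ^ i)) = p ^ k" by (simp add: p_def algebra_simps)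
  moreover have "p ^ k \<in> sympow P k" using power_mem_sympow t0(2) by (simp add: p_def)
  moreover have "p \<in> A" using t0 t by (simp add: p_def mem)
  ultimately show thesis using that[of "t0 * (\<Sum>i<k. p ^ i)"] t0 by (simp add: mem sum_mem)
qed

text \<open>Locally the quotient of \<open>y\<close> by \<open>x\<close> is
  \<open>z * s / (t * w)\<close>. Its denominator lies outside \<open>P\<close>, so it may be
  replaced by an inverse modulo the symbolic power.\<close>

lemma has_val_dvd_mod:
  assumes "has_val x i" "y \<in> sympow P i"
  obtains r where "r \<in> A" "y - r * x \<in> sympow P k"
proof -
  obtain s w where x: "x \<in> A" "s \<in> A - P" "w \<in> A - P" "s * x = unif P ^ i * w"
    using assms(1) by (auto simp: has_val_def)
  obtain t z where y: "y \<in> A" "t \<in> A - P" "z \<in> A" "t * y = unif P ^ i * z"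
    using assms(2) by (rule sympowE)
  have tw: "t * w \<in> A - P" using mp_notin_mult[OF P y(2) x(3)] .
  obtain v where v: "v \<in> A" "1 - (t * w) * v \<in> sympow P k" using inverse_mod_sympow[OF tw] .
  have "y - (v * z * s) * x = y - v * z * (unif P ^ i * w)" using x(4) by (simp add: mult.assoc)
  also have "\<dots> = y - v * w * (t * y)" unfolding y(4) by (simp add: mult_ac)
  also have "\<dots> = y * (1 - (t * w) * v)" by (simp add: algebra_simps)
  also have "\<dots> \<in> sympow P k" using sympow_mult[OF y(1) v(2)] .
  finally show thesis using that[of "v * z * s"] v x y by (simp add: mem)
qed

lemma finite_cosets_mp: "finite (cosets A P)"
  by (rule finite_cosets_idl[OF mp_idl[OF P] mp_nz[OF P]])

lemma finite_cosets_sympow: "finite (cosets A (sympow P k))"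
  by (rule finite_cosets_idl[OF sympow_idl sympow_nz])

text \<open>Multiplication by \<open>unif P ^ i\<close> induces an isomorphism from the residue
  field onto the quotient of two consecutive symbolic powers.\<close>

lemma add_index_sympow_Suc: "add_index (sympow P i) (sympow P (Suc i)) = add_index A P"
proof (rule add_index_eqI[OF idl_subgroup[OF mp_idl[OF P]] sympow_subgroup, symmetric])
  fix x y assume "x \<in> A" "y \<in> A"
  then have "unif P ^ i * x - unif P ^ i * y \<in> sympow P (Suc i) \<longleftrightarrow> x - y \<in> sympow P 1"
    using has_val_mult_iff[OF has_val_unif_power, of "x - y" i 1] by (simp add: mem right_diff_distrib)
  then show "unif P ^ i * x - unif P ^ i * y \<in> sympow P (Suc i) \<longleftrightarrow> x - y \<in> P"
    by (simp only: sympow_1)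
next
  fix x assume "x \<in> A"
  then show "unif P ^ i * x \<in> sympow P i"
    using sympow_mult[OF _ unif_power_mem_sympow] by (simp add: mult.commute)
next
  fix b assume "b \<in> sympow P i"
  then show "\<exists>a\<in>A. b - unif P ^ i * a \<in> sympow P (Suc i)"
    using has_val_dvd_mod[OF has_val_unif_power] by (metis mult.commute)
qed

lemma add_index_sympow:
  "j \<le> k \<Longrightarrow> add_index (sympow P j) (sympow P k) = add_index A P ^ (k - j)"
proof (induction k rule: dec_induct)
  case base
  then show ?case by (simp add: add_index_self[OF sympow_subgroup])
next
  case (step k)
  have fin: "finite (cosets (sympow P i) (sympow P l))" for i l
    by (rule finite_subset[OF _ finite_cosets_sympow[of l]]) (use sympow_sub in \<open>auto simp: cosets_def\<close>)
  have "add_index (sympow P j) (sympow P (Suc k)) = add_index (sympow P j) (sympow P k) * add_index A P"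
    using add_index_tower[OF sympow_subgroup sympow_subgroup sympow_subgroup sympow_antimono sympow_antimono fin fin,
        of k "Suc k" j] step.hyps by (simp add: add_index_sympow_Suc)
  then show ?case using step by (simp add: Suc_diff_le)
qed

lemma add_index_A_sympow: "add_index A (sympow P k) = add_index A P ^ k"
  using add_index_sympow[of 0 k] by simp

lemma add_index_mp_ge_2: "add_index A P \<ge> 2"
  using add_index_ge_2[OF add_subgroup_A idl_subgroup[OF mp_idl[OF P]]] finite_cosets_mp
    mp_one[OF P] one_mem idl_sub[OF mp_idl[OF P]] by blast

lemma comaximal_sympow:
  assumes "idl I" "\<not> I \<subseteq> P"
  obtains x where "x \<in> I" "1 - x \<in> sympow P k"
proof -
  obtain t where t: "t \<in> I" "t \<notin> P" "t \<in> A" using assms idl_sub by blast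
  then obtain t' where "t' \<in> A" "1 - t * t' \<in> sympow P k" using inverse_mod_sympow[of t k] by blast
  then show thesis using that idl_mult2[OF assms(1) t(1)] by blast
qed

end

section \<open>Ideals as intersections of symbolic powers\<close>

definition iord :: "'a set \<Rightarrow> 'a set \<Rightarrow> nat" where
  "iord P I = (SOME k. \<forall>l. I \<subseteq> sympow P l \<longleftrightarrow> l \<le> k)"

lemma subset_sympow_iff:
  "maxprime P \<Longrightarrow> idl I \<Longrightarrow> I \<noteq> {0} \<Longrightarrow> I \<subseteq> sympow P l \<longleftrightarrow> l \<le> iord P I"
  unfolding iord_def by (rule someI_ex[OF ex_ord, THEN spec])

lemma iord_eqI:
  assumes "maxprime P" "idl I" "I \<noteq> {0}" "\<And>l. I \<subseteq> sympow P l \<longleftrightarrow> l \<le> k"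
  shows "iord P I = k"
proof (rule antisym)
  show "iord P I \<le> k" using assms(4)[of "iord P I"] subset_sympow_iff[OF assms(1-3), of "iord P I"] by simp
  show "k \<le> iord P I" using assms(4)[of k] subset_sympow_iff[OF assms(1-3), of k] by simp
qed

lemma iord_eq_0_iff:
  assumes "maxprime P" "idl I" "I \<noteq> {0}"
  shows "iord P I = 0 \<longleftrightarrow> \<not> I \<subseteq> P"
  using subset_sympow_iff[OF assms, of 1] sympow_1[OF assms(1)] by auto

text \<open>If \<open>x\<close> satisfies all local conditions but is not in \<open>I\<close>, the
  multipliers taking \<open>x\<close> into \<open>I\<close> form a proper ideal \<open>J\<close>
  containing \<open>I\<close>. It lies in some prime \<open>P\<close>, while the local condition at
  \<open>P\<close> produces a multiplier outside \<open>P\<close>.\<close>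

lemma idl_eq_local:
  assumes I: "idl I" "I \<noteq> {0}"
  shows "I = {x \<in> A. \<forall>P. maxprime P \<longrightarrow> x \<in> sympow P (iord P I)}"
proof (intro equalityI subsetI)
  fix x assume "x \<in> I"
  then show "x \<in> {x \<in> A. \<forall>P. maxprime P \<longrightarrow> x \<in> sympow P (iord P I)}"
    using subset_sympow_iff[OF _ I] idl_sub[OF I(1)] by blast
next
  fix x assume "x \<in> {x \<in> A. \<forall>P. maxprime P \<longrightarrow> x \<in> sympow P (iord P I)}"
  then have x: "x \<in> A" "\<And>P. maxprime P \<Longrightarrow> x \<in> sympow P (iord P I)" by auto
  show "x \<in> I"
  proof (rule ccontr)
    assume nx: "x \<notin> I"
    define J where "J = {s \<in> A. s * x \<in> I}"
    have J: "idl J"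
      unfolding idl_def add_subgroup_def J_def
      using idl_zero[OF I(1)] idl_diff[OF I(1)] idl_mult[OF I(1)] by (auto simp: left_diff_distrib mult.assoc mem)
    have IJ: "I \<subseteq> J" using idl_mult2[OF I(1)] idl_sub[OF I(1)] x(1) by (auto simp: J_def)
    have "1 \<notin> J" using nx by (simp add: J_def)
    moreover have "J \<noteq> {0}" using IJ I idl_zero[OF I(1)] by blast
    ultimately obtain P where P: "maxprime P" "J \<subseteq> P" using exists_maxprime[OF J] by blast
    define k where "k = iord P I"
    have "I \<subseteq> sympow P k" "\<not> I \<subseteq> sympow P (Suc k)"
      using subset_sympow_iff[OF P(1) I] by (simp_all add: k_def)
    \<comment> \<open>An element of \<open>I\<close> that attains the order of \<open>I\<close> at
      \<open>P\<close> divides \<open>x\<close> up to denominators outside \<open>P\<close>.\<close>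
    then obtain y where y: "y \<in> I" "has_val P y k"
      using has_valI[OF P(1)] by blast
    obtain t w where tw: "y \<in> A" "t \<in> A - P" "w \<in> A - P" "t * y = unif P ^ k * w"
      using y(2) unfolding has_val_def[OF P(1)] by blast
    have "x \<in> sympow P k" using x(2)[OF P(1)] by (simp add: k_def)
    then obtain s z where sz: "s \<in> A - P" "z \<in> A" "s * x = unif P ^ k * z" by (rule sympowE)
    have "(w * s) * x = w * (s * x)" by (simp add: mult_ac)
    also have "\<dots> = z * (t * y)" unfolding sz(3) tw(4) by (simp add: mult_ac)
    also have "\<dots> = z * t * y" by (simp add: mult_ac)
    also have "\<dots> \<in> I" using idl_mult[OF I(1) _ y(1)] sz tw by (simp add: mem)
    finally have "w * s \<in> J" using sz tw by (auto simp: J_def mem)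
    then show False using P(2) mp_notin_mult[OF P(1) tw(3) sz(1)] by blast
  qed
qed

lemma prime_in_other_sympow:
  assumes "maxprime P" "maxprime Q" "P \<noteq> Q"
  obtains t where "t \<in> sympow P k" "t \<in> A - Q"
  using mp_sub_of_sympow_sub[OF assms(1,2)] assms(3) sympow_sub by blast

text \<open>For finitely many primes containing \<open>a\<close>, prime avoidance gives for each an
  element outside it that lies in all the others. These elements are incongruent modulo
  \<open>a\<close>, so there are no more primes than residue classes. The bound later counts the
  primes above a positive integer.\<close>

lemma
  assumes a: "a \<in> A" "a \<noteq> 0"
  shows finite_primes_containing: "finite {P. maxprime P \<and> a \<in> P}"
    and card_primes_containing: "card {P. maxprime P \<and> a \<in> P} \<le> add_index A ((*) a ` A)"
proof -
  have "finite F \<and> card F \<le> add_index A ((*) a ` A)"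
    if F: "F \<subseteq> {P. maxprime P \<and> a \<in> P}" "finite F" for F
  proof
    have "\<exists>e. e \<in> A - P \<and> (\<forall>Q\<in>F - {P}. e \<in> Q)" if "P \<in> F" for P
    proof -
      have P: "maxprime P" using F \<open>P \<in> F\<close> by blast
      have "\<exists>t. t \<in> Q \<and> t \<in> A - P" if "Q \<in> F - {P}" for Q
        using prime_in_other_sympow[of Q P 1] sympow_1 P F that by (metis DiffD1 DiffD2 insertI1 mem_Collect_eq subsetD)
      then obtain t where t: "\<And>Q. Q \<in> F - {P} \<Longrightarrow> t Q \<in> Q \<and> t Q \<in> A - P" by metis
      have "prod t (F - {P}) \<in> A - P" by (rule mp_notin_prod[OF P]) (use t in blast)
      moreover have "prod t (F - {P}) \<in> Q" if Q: "Q \<in> F - {P}" for Q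
      proof -
        have "prod t (F - {P}) = t Q * prod t (F - {P} - {Q})"
          by (rule prod.remove) (use F Q in auto)
        moreover have "prod t (F - {P} - {Q}) \<in> A" by (rule prod_mem) (use t in blast)
        moreover have "idl Q" using mp_idl F Q by blast
        ultimately show ?thesis using idl_mult2 t[OF Q] by metis
      qed
      ultimately show ?thesis by blast
    qed
    then obtain e where e: "\<And>P. P \<in> F \<Longrightarrow> e P \<in> A - P" "\<And>P Q. P \<in> F \<Longrightarrow> Q \<in> F - {P} \<Longrightarrow> e P \<in> Q"
      by metis
    have sg: "add_subgroup ((*) a ` A)" using idl_subgroup[OF idl_principal[OF a(1)]] .
    have "inj_on (\<lambda>P. (+) (e P) ` ((*) a ` A)) F"
    proof (rule inj_onI, rule ccontr)
      fix P Q assume PQ: "P \<in> F" "Q \<in> F" "(+) (e P) ` (*) a ` A = (+) (e Q) ` (*) a ` A" "P \<noteq> Q"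
      have P: "idl P" "a \<in> P" using F PQ mp_idl by auto
      have "e P - e Q \<in> (*) a ` A" using coset_eq_iff[OF sg] PQ(3) by blast
      then have "e P - e Q \<in> P" using principal_subset[OF P] by blast
      moreover have "e Q \<in> P" using e(2)[of Q P] PQ by blast
      ultimately have "(e P - e Q) + e Q \<in> P" using idl_add[OF P(1)] by blast
      then show False using e(1)[OF PQ(1)] by simp
    qed
    moreover have "(\<lambda>P. (+) (e P) ` ((*) a ` A)) ` F \<subseteq> cosets A ((*) a ` A)"
      using e by (auto simp: cosets_def)
    ultimately show "card F \<le> add_index A ((*) a ` A)"
      unfolding add_index_def using finite_quotient[OF a] card_inj_on_le by blast
  qed (rule F(2))
  from finite_if_finite_subsets_card_bdd[of "{P. maxprime P \<and> a \<in> P}", rule_format] this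
  show "finite {P. maxprime P \<and> a \<in> P}" "card {P. maxprime P \<and> a \<in> P} \<le> add_index A ((*) a ` A)"
    by blast+
qed

lemma finite_primes_over:
  assumes "idl I" "I \<noteq> {0}" shows "finite {P. maxprime P \<and> I \<subseteq> P}"
proof -
  obtain a where a: "a \<in> I" "a \<noteq> 0" "a \<in> A" using idl_nonzero[OF assms] .
  show ?thesis by (rule finite_subset[OF _ finite_primes_containing[OF a(3,2)]]) (use a in blast)
qed

text \<open>For finite \<open>S\<close> these ideals index a finite partial Euler product; for the
  set of all primes they are all non-zero ideals.\<close>

definition idls_over :: "'a set set \<Rightarrow> 'a set set" where
  "idls_over S = {I. idl I \<and> I \<noteq> {0} \<and> (\<forall>P. maxprime P \<and> I \<subseteq> P \<longrightarrow> P \<in> S)}"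

lemma idl_Int: "idl I \<Longrightarrow> idl J \<Longrightarrow> idl (I \<inter> J)"
  by (auto simp: idl_def add_subgroup_def)

text \<open>Since \<open>I\<close> is prime to \<open>Q\<close>, the intersection plays the part of
  the product of \<open>I\<close> with a power of \<open>Q\<close>. Locally at \<open>Q\<close> an
  element of \<open>I\<close> outside \<open>Q\<close> is a unit, and at another \<open>P\<close> so
  is an element of \<open>sympow Q k\<close> outside \<open>P\<close>; hence only the order at
  \<open>Q\<close> changes.\<close>

lemma
  assumes I: "idl I" "I \<noteq> {0}" and Q: "maxprime Q" "\<not> I \<subseteq> Q"
  shows Int_sympow_nz: "I \<inter> sympow Q k \<noteq> {0}"
    and iord_Int_sympow: "\<And>P. maxprime P \<Longrightarrow> iord P (I \<inter> sympow Q k) = (if P = Q then k else iord P I)"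
proof -
  obtain t where t: "t \<in> I" "t \<notin> Q" "t \<in> A" using Q(2) idl_sub[OF I(1)] by blast
  have t\<pi>: "t * unif Q ^ k \<in> I \<inter> sympow Q k"
    using idl_mult2[OF I(1) t(1)] sympow_mult[OF Q(1) t(3) unif_power_mem_sympow[OF Q(1)]]
      power_mem[OF unif_mem_A[OF Q(1)]] by blast
  have "t * unif Q ^ k \<noteq> 0"
    using notin_nz[OF Q(1)] unif_nz[OF Q(1)] t by auto
  then show nz: "I \<inter> sympow Q k \<noteq> {0}" using t\<pi> by blast
  have IQ: "idl (I \<inter> sympow Q k)" by (rule idl_Int[OF I(1) sympow_idl[OF Q(1)]])
  show "iord P (I \<inter> sympow Q k) = (if P = Q then k else iord P I)" if P: "maxprime P" for P
  proof (rule iord_eqI[OF P IQ nz])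
    fix l
    show "I \<inter> sympow Q k \<subseteq> sympow P l \<longleftrightarrow> l \<le> (if P = Q then k else iord P I)"
    proof (cases "P = Q")
      case True
      have "l \<le> k" if "I \<inter> sympow Q k \<subseteq> sympow Q l"
      proof -
        have "unif Q ^ k \<in> sympow Q l"
          using sympow_cancel[OF Q(1), of t] t t\<pi> that power_mem[OF unif_mem_A[OF Q(1)]] by blast
        then show ?thesis using has_val_sympow_iff[OF Q(1) has_val_unif_power[OF Q(1)]] by simp
      qed
      then show ?thesis using True sympow_antimono[OF Q(1), of l k] by auto
    next
      case False
      obtain r where r: "r \<in> sympow Q k" "r \<in> A - P"
        using prime_in_other_sympow[OF Q(1) P] False by blast
      have "I \<subseteq> sympow P l" if sub: "I \<inter> sympow Q k \<subseteq> sympow P l"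
      proof
        fix x assume x: "x \<in> I"
        then have "x * r \<in> I \<inter> sympow Q k"
          using idl_mult2[OF I(1)] sympow_mult[OF Q(1) _ r(1)] r idl_sub[OF I(1)] by blast
        then show "x \<in> sympow P l"
          using sympow_cancel[OF P r(2), of x l] sub x idl_sub[OF I(1)] by (auto simp: mult.commute)
      qed
      then show ?thesis using subset_sympow_iff[OF P I, of l] False by auto
    qed
  qed
qed

lemma idl_eqI_iord:
  assumes "idl I" "I \<noteq> {0}" "idl J" "J \<noteq> {0}" "\<And>P. maxprime P \<Longrightarrow> iord P I = iord P J"
  shows "I = J"
  using idl_eq_local[OF assms(1,2)] idl_eq_local[OF assms(3,4)] assms(5) by auto

lemma idls_over_empty: "idls_over {} = {A}"
proof (intro equalityI subsetI)
  fix I assume "I \<in> idls_over {}"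
  then have I: "idl I" "I \<noteq> {0}" "\<And>P. maxprime P \<Longrightarrow> \<not> I \<subseteq> P" by (auto simp: idls_over_def)
  then have "1 \<in> I" using exists_maxprime[OF I(1,2)] by blast
  then show "I \<in> {A}" using idl_one_iff[OF I(1)] by simp
next
  fix I assume "I \<in> {A}"
  moreover have "idl A" using add_subgroup_A mult_mem by (auto simp: idl_def)
  moreover have "A \<noteq> {0}" using one_mem by force
  ultimately show "I \<in> idls_over {}" using mp_one one_mem by (auto simp: idls_over_def)
qed

text \<open>The cofactor is obtained by dropping the condition at \<open>Q\<close> from the local
  description of \<open>J\<close>. It is not contained in \<open>Q\<close>: only finitely many
  conditions are left, and a product of elements outside \<open>Q\<close> meets them all.\<close>

lemma exists_cofactor:
  assumes J: "idl J" "J \<noteq> {0}" and Q: "maxprime Q"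
  obtains I where "idl I" "J \<subseteq> I" "\<not> I \<subseteq> Q" "J = I \<inter> sympow Q (iord Q J)"
proof -
  define I where "I = {x \<in> A. \<forall>P. maxprime P \<longrightarrow> P \<noteq> Q \<longrightarrow> x \<in> sympow P (iord P J)}"
  have I: "idl I"
    unfolding idl_def add_subgroup_def I_def
    using add_subgroup_zero[OF sympow_subgroup] add_subgroup_diff[OF sympow_subgroup] sympow_mult
    by (auto simp: mem)
  have JI: "J = I \<inter> sympow Q (iord Q J)"
    using Q sympow_sub by (subst idl_eq_local[OF J]) (auto simp: I_def)
  define F where "F = {P. maxprime P \<and> J \<subseteq> P} - {Q}"
  have F: "finite F" unfolding F_def using finite_primes_over[OF J] by simp
  have "\<exists>t. t \<in> sympow P (iord P J) \<and> t \<in> A - Q" if "P \<in> F" for P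
    using prime_in_other_sympow[of P Q] that Q unfolding F_def by blast
  then obtain t where t: "\<And>P. P \<in> F \<Longrightarrow> t P \<in> sympow P (iord P J) \<and> t P \<in> A - Q" by metis
  have e: "prod t F \<in> A - Q" by (rule mp_notin_prod[OF Q]) (use t in blast)
  have "prod t F \<in> sympow P (iord P J)" if P: "maxprime P" "P \<noteq> Q" for P
  proof (cases "P \<in> F")
    case True
    have "prod t F = t P * prod t (F - {P})" by (rule prod.remove[OF F True])
    moreover have "prod t (F - {P}) \<in> A" by (rule prod_mem) (use t in blast)
    ultimately show ?thesis using t[OF True] sympow_mult[OF P(1)] by (metis mult.commute)
  next
    case False
    then have "iord P J = 0" using P iord_eq_0_iff[OF P(1) J] by (auto simp: F_def)
    then show ?thesis using e P by simp
  qed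
  then have "prod t F \<in> I" using e by (auto simp: I_def)
  then have "\<not> I \<subseteq> Q" using e by blast
  then show thesis using that[OF I _ _ JI] JI by blast
qed

text \<open>This is unique factorisation, one prime at a time. Injectivity compares orders at every
  prime, and surjectivity splits off the order at \<open>Q\<close> by
  \<open>exists_cofactor\<close>.\<close>

lemma bij_betw_idls_over:
  assumes Q: "maxprime Q" "Q \<notin> S"
  shows "bij_betw (\<lambda>(I, k). I \<inter> sympow Q k) (idls_over S \<times> UNIV) (idls_over (insert Q S))"
  unfolding bij_betw_def
proof
  have D: "idl I" "I \<noteq> {0}" "\<not> I \<subseteq> Q" if "I \<in> idls_over S" for I
    using that Q by (auto simp: idls_over_def)
  show "inj_on (\<lambda>(I, k). I \<inter> sympow Q k) (idls_over S \<times> UNIV)"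
  proof (rule inj_onI, clarify)
    fix I J k l assume I: "I \<in> idls_over S" and J: "J \<in> idls_over S"
      and eq: "I \<inter> sympow Q k = J \<inter> sympow Q l"
    note iI = iord_Int_sympow[OF D(1,2)[OF I] Q(1) D(3)[OF I]]
    note iJ = iord_Int_sympow[OF D(1,2)[OF J] Q(1) D(3)[OF J]]
    have "k = l" using iI[OF Q(1), of k] iJ[OF Q(1), of l] eq by simp
    moreover have "iord P I = iord P J" if P: "maxprime P" for P
    proof (cases "P = Q")
      case True
      then show ?thesis using iord_eq_0_iff[OF Q(1) D(1,2)[OF I]] iord_eq_0_iff[OF Q(1) D(1,2)[OF J]] D(3)[OF I] D(3)[OF J] by simp
    next
      case False
      then show ?thesis using iI[OF P, of k] iJ[OF P, of l] eq by simp
    qed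
    ultimately show "I = J \<and> k = l" using idl_eqI_iord[OF D(1,2)[OF I] D(1,2)[OF J]] by blast
  qed
  show "(\<lambda>(I, k). I \<inter> sympow Q k) ` (idls_over S \<times> UNIV) = idls_over (insert Q S)"
  proof
    show "(\<lambda>(I, k). I \<inter> sympow Q k) ` (idls_over S \<times> UNIV) \<subseteq> idls_over (insert Q S)"
    proof clarify
      fix I k assume I: "I \<in> idls_over S"
      have IQ: "idl (I \<inter> sympow Q k)" by (rule idl_Int[OF D(1)[OF I] sympow_idl[OF Q(1)]])
      have nz: "I \<inter> sympow Q k \<noteq> {0}" using Int_sympow_nz[OF D(1,2)[OF I] Q(1) D(3)[OF I]] .
      have "P \<in> insert Q S" if P: "maxprime P" "I \<inter> sympow Q k \<subseteq> P" for P
      proof (rule ccontr)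
        assume n: "P \<notin> insert Q S"
        have "iord P I \<noteq> 0"
          using iord_eq_0_iff[OF P(1) IQ nz] iord_Int_sympow[OF D(1,2)[OF I] Q(1) D(3)[OF I] P(1), of k] P(2) n by auto
        then show False using iord_eq_0_iff[OF P(1) D(1,2)[OF I]] I P(1) n by (auto simp: idls_over_def)
      qed
      then show "I \<inter> sympow Q k \<in> idls_over (insert Q S)" using IQ nz by (auto simp: idls_over_def)
    qed
    show "idls_over (insert Q S) \<subseteq> (\<lambda>(I, k). I \<inter> sympow Q k) ` (idls_over S \<times> UNIV)"
    proof
      fix J assume "J \<in> idls_over (insert Q S)"
      then have J: "idl J" "J \<noteq> {0}" "\<And>P. maxprime P \<Longrightarrow> J \<subseteq> P \<Longrightarrow> P \<in> insert Q S"
        by (auto simp: idls_over_def)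
      obtain I where I: "idl I" "J \<subseteq> I" "\<not> I \<subseteq> Q" "J = I \<inter> sympow Q (iord Q J)"
        using exists_cofactor[OF J(1,2) Q(1)] .
      have "I \<noteq> {0}" using I(2) J(2) idl_zero[OF J(1)] by blast
      then have "I \<in> idls_over S" using I(1-3) J(3) unfolding idls_over_def by blast
      then show "J \<in> (\<lambda>(I, k). I \<inter> sympow Q k) ` (idls_over S \<times> UNIV)"
        using I(4) by (intro image_eqI[of _ _ "(I, iord Q J)"]) auto
    qed
  qed
qed

lemma idls_over_mono: "S \<subseteq> T \<Longrightarrow> idls_over S \<subseteq> idls_over T"
  by (auto simp: idls_over_def)

end

section \<open>Generating functions of local counts\<close>

text \<open>The number of vectors in \<open>R^n\<close> of valuation exactly \<open>i\<close>, where \<open>R\<close> is a finite chain ring of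
  length \<open>k\<close> with residue field of cardinality \<open>q\<close>; the zero vector has valuation \<open>k\<close>.\<close>

definition num_val :: "nat \<Rightarrow> nat \<Rightarrow> nat \<Rightarrow> nat \<Rightarrow> nat" where
  "num_val k q n i = (if i = k then 1 else q ^ (n * (k - i)) - q ^ (n * (k - Suc i)))"

text \<open>The indices are the valuations of \<open>a\<close> and \<open>b\<close>, and the power
  of \<open>q\<close> is the number of \<open>(a', b')\<close> belonging to them. The second branch
  is the first with \<open>(m, i)\<close> and \<open>(n, j)\<close> exchanged.\<close>

definition local_count :: "nat \<Rightarrow> nat \<Rightarrow> nat \<Rightarrow> nat \<Rightarrow> nat" where
  "local_count m n q k = (\<Sum>i\<le>k. \<Sum>j\<le>k. num_val k q m i * num_val k q n j *
    q ^ (if i \<le> j then k + i * n + j * (m - 1) else k + j * m + i * (n - 1)))"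

text \<open>Such sums run along the two borders of \<open>local_count\<close>, where one valuation
  is 0; there \<open>r\<close> is \<open>m - 1\<close> or \<open>n - 1\<close>.\<close>

definition weighted_count :: "nat \<Rightarrow> nat \<Rightarrow> nat \<Rightarrow> nat \<Rightarrow> nat" where
  "weighted_count n r q k = (\<Sum>j\<le>k. num_val k q n j * q ^ (j * r))"

lemma num_val_Suc_Suc: "num_val (Suc k) q n (Suc i) = num_val k q n i"
  by (simp add: num_val_def)

lemma num_val_Suc_0: "num_val (Suc k) q n 0 = q ^ (n * Suc k) - q ^ (n * k)"
  by (simp add: num_val_def)

lemma weighted_count_0: "weighted_count n r q 0 = 1"
  by (simp add: weighted_count_def num_val_def)

lemma weighted_count_Suc:
  "weighted_count n r q (Suc k) = num_val (Suc k) q n 0 + q ^ r * weighted_count n r q k"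
  unfolding weighted_count_def
  by (subst sum.atMost_Suc_shift) (simp add: num_val_Suc_Suc sum_distrib_left power_add mult_ac)

lemma local_count_0: "local_count m n q 0 = 1"
  by (simp add: local_count_def num_val_def)

text \<open>The terms with both valuations positive form the count for \<open>k\<close> after a
  shift by one, with every exponent raised by \<open>m + n\<close>. The corner with both valuations
  0 is included in the first border sum; hence the arguments \<open>Suc k\<close> there and
  \<open>k\<close> in the second.\<close>

lemma local_count_Suc:
  assumes "m \<ge> 1" "n \<ge> 1"
  shows "local_count m n q (Suc k) = q ^ (m + n) * local_count m n q k +
    q ^ Suc k * (num_val (Suc k) q m 0 * weighted_count n (m - 1) q (Suc k) +
      num_val (Suc k) q n 0 * (q ^ (n - 1) * weighted_count m (n - 1) q k))"
proof -
  define e where "e k i j = (if i \<le> j then k + i * n + j * (m - 1) else k + j * m + i * (n - 1))" for k i j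
  define f where "f i j = num_val (Suc k) q m i * num_val (Suc k) q n j * q ^ e (Suc k) i j" for i j
  obtain m' n' where mn: "m = Suc m'" "n = Suc n'" using assms by (metis One_nat_def Suc_le_D)
  have "local_count m n q (Suc k) = (\<Sum>i\<le>Suc k. \<Sum>j\<le>Suc k. f i j)"
    by (simp add: local_count_def f_def e_def)
  also have "\<dots> = (\<Sum>j\<le>Suc k. f 0 j) + (\<Sum>i\<le>k. \<Sum>j\<le>Suc k. f (Suc i) j)"
    by (rule sum.atMost_Suc_shift)
  also have "(\<Sum>i\<le>k. \<Sum>j\<le>Suc k. f (Suc i) j) = (\<Sum>i\<le>k. f (Suc i) 0) + (\<Sum>i\<le>k. \<Sum>j\<le>k. f (Suc i) (Suc j))"
    by (simp add: sum.atMost_Suc_shift sum.distrib del: sum.atMost_Suc)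
  also have "(\<Sum>i\<le>k. \<Sum>j\<le>k. f (Suc i) (Suc j)) = q ^ (m + n) * local_count m n q k"
  proof -
    have "e (Suc k) (Suc i) (Suc j) = m + n + e k i j" for i j by (simp add: e_def mn)
    then have "f (Suc i) (Suc j) = q ^ (m + n) * (num_val k q m i * num_val k q n j * q ^ e k i j)" for i j
      by (simp add: f_def num_val_Suc_Suc power_add mult_ac)
    then show ?thesis by (simp add: local_count_def e_def sum_distrib_left)
  qed
  also have "(\<Sum>j\<le>Suc k. f 0 j) = q ^ Suc k * (num_val (Suc k) q m 0 * weighted_count n (m - 1) q (Suc k))"
    unfolding weighted_count_def sum_distrib_left
    by (rule sum.cong) (simp_all add: f_def e_def power_add mult_ac)
  also have "(\<Sum>i\<le>k. f (Suc i) 0) = q ^ Suc k * (num_val (Suc k) q n 0 * (q ^ (n - 1) * weighted_count m (n - 1) q k))"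
    unfolding weighted_count_def sum_distrib_left
    by (rule sum.cong) (simp_all add: f_def e_def num_val_Suc_Suc power_add mult_ac)
  finally show ?thesis by (simp add: algebra_simps)
qed

text \<open>The generating function \<open>S\<close> satisfies
  \<open>S = a 0 + c * T * S + T * D\<close>. Absolute summability has to be established first, from
  a bound on partial sums.\<close>

lemma linear_recurrence_sums:
  fixes a d :: "nat \<Rightarrow> complex"
  assumes rec: "\<And>k. a (Suc k) = c * a k + d k" and c: "norm (c * T) < 1"
    and d: "summable (\<lambda>k. norm (d k * T ^ k))" and D: "(\<lambda>k. d k * T ^ k) sums D"
  shows "summable (\<lambda>k. norm (a k * T ^ k))"
    and "(\<lambda>k. a k * T ^ k) sums ((a 0 + T * D) / (1 - c * T))"
proof -
  let ?u = "\<lambda>k. norm (a k * T ^ k)"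
  have step: "a (Suc k) * T ^ Suc k = c * T * (a k * T ^ k) + T * (d k * T ^ k)" for k
    by (simp add: rec algebra_simps)
  define D' where "D' = (\<Sum>k. norm (d k * T ^ k))"
  define C where "C = (norm (a 0) + norm T * D') / (1 - norm (c * T))"
  show abs: "summable ?u"
  proof (rule summableI_nonneg_bounded)
    fix K
    have "(\<Sum>k<Suc K. ?u k) = ?u 0 + (\<Sum>k<K. ?u (Suc k))"
      by (rule sum.lessThan_Suc_shift)
    also have "(\<Sum>k<K. ?u (Suc k)) \<le> (\<Sum>k<K. norm (c * T) * ?u k + norm T * norm (d k * T ^ k))"
      unfolding step by (intro sum_mono order_trans[OF norm_triangle_ineq]) (simp only: norm_mult order_refl)
    also have "\<dots> = norm (c * T) * (\<Sum>k<K. ?u k) + norm T * (\<Sum>k<K. norm (d k * T ^ k))"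
      by (simp add: sum.distrib sum_distrib_left)
    also have "\<dots> \<le> norm (c * T) * (\<Sum>k<K. ?u k) + norm T * D'"
      unfolding D'_def by (intro add_left_mono mult_left_mono sum_le_suminf d) auto
    finally have "(\<Sum>k<Suc K. ?u k) \<le> norm (a 0) + (norm (c * T) * (\<Sum>k<K. ?u k) + norm T * D')" by simp
    moreover have "(\<Sum>k<K. ?u k) \<le> (\<Sum>k<Suc K. ?u k)" by simp
    \<comment> \<open>The same partial sum occurs on both sides with a coefficient below 1 on the
      right, so solving for it gives a bound uniform in \<open>K\<close>.\<close>
    ultimately have "(\<Sum>k<K. ?u k) * (1 - norm (c * T)) \<le> norm (a 0) + norm T * D'"
      by (simp only: right_diff_distrib mult_1_right mult.commute[of "norm (c * T)"])
    then show "(\<Sum>k<K. ?u k) \<le> C"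
      unfolding C_def using c by (simp add: pos_le_divide_eq)
  qed simp
  then have sm: "summable (\<lambda>k. a k * T ^ k)" by (rule summable_norm_cancel)
  define S where "S = (\<Sum>k. a k * T ^ k)"
  have S: "(\<lambda>k. a k * T ^ k) sums S" using sm by (simp add: S_def summable_sums)
  have "(\<lambda>k. a (Suc k) * T ^ Suc k) sums (c * T * S + T * D)"
    unfolding step by (intro sums_add sums_mult S D)
  moreover have "(\<lambda>k. a (Suc k) * T ^ Suc k) sums (S - a 0)"
    using S sums_Suc_iff[of "\<lambda>k. a k * T ^ k" "S - a 0"] by simp
  ultimately have "c * T * S + T * D = S - a 0" by (rule sums_unique2)
  then have "S * (1 - c * T) = a 0 + T * D" by (simp add: algebra_simps)
  moreover have "1 - c * T \<noteq> 0" using c by auto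
  ultimately have "S = (a 0 + T * D) / (1 - c * T)" by (simp add: eq_divide_eq)
  then show "(\<lambda>k. a k * T ^ k) sums ((a 0 + T * D) / (1 - c * T))" using S by simp
qed

lemma geometric_abs_sums:
  fixes c g T :: complex
  assumes "norm (g * T) < 1"
  shows "summable (\<lambda>k. norm (c * g ^ k * T ^ k))" "(\<lambda>k. c * g ^ k * T ^ k) sums (c / (1 - g * T))"
proof -
  have eq: "c * g ^ k * T ^ k = c * (g * T) ^ k" for k by (simp add: power_mult_distrib)
  show "(\<lambda>k. c * g ^ k * T ^ k) sums (c / (1 - g * T))"
    unfolding eq using sums_mult[OF geometric_sums[OF assms], of c] by simp
  have "summable (\<lambda>k. norm (g * T) ^ k)" using assms by (intro summable_geometric) simp
  then show "summable (\<lambda>k. norm (c * g ^ k * T ^ k))"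
    unfolding eq norm_mult[of c] norm_power by (rule summable_mult)
qed

text \<open>Subtraction of naturals is truncated; \<open>q \<ge> 1\<close> makes it agree with
  subtraction of complex numbers.\<close>

lemma of_nat_num_val_Suc_0:
  assumes "q \<ge> 1"
  shows "(of_nat (num_val (Suc k) q n 0) :: complex) = (of_nat q ^ n - 1) * (of_nat q ^ n) ^ k"
proof -
  have "q ^ (n * k) \<le> q ^ (n * Suc k)" using assms by (intro power_increasing) auto
  then show ?thesis
    unfolding num_val_Suc_0 by (simp add: of_nat_diff algebra_simps power_add flip: power_mult)
qed

lemma weighted_count_sums:
  fixes T :: complex
  assumes q: "q \<ge> 1" and T: "norm (of_nat q ^ n * T) < 1" "norm (of_nat q ^ r * T) < 1"
  shows "summable (\<lambda>k. norm (of_nat (weighted_count n r q k) * T ^ k))"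
    and "(\<lambda>k. of_nat (weighted_count n r q k) * T ^ k) sums
      ((1 + T * ((of_nat q ^ n - 1) / (1 - of_nat q ^ n * T))) / (1 - of_nat q ^ r * T))"
proof -
  have rec: "of_nat (weighted_count n r q (Suc k)) =
      of_nat q ^ r * of_nat (weighted_count n r q k) + ((of_nat q ^ n - 1) * (of_nat q ^ n) ^ k :: complex)" for k
    by (simp add: weighted_count_Suc of_nat_num_val_Suc_0[OF q])
  from linear_recurrence_sums[OF rec T(2) geometric_abs_sums[OF T(1)]]
  show "summable (\<lambda>k. norm (of_nat (weighted_count n r q k) * T ^ k))"
    "(\<lambda>k. of_nat (weighted_count n r q k) * T ^ k) sums
      ((1 + T * ((of_nat q ^ n - 1) / (1 - of_nat q ^ n * T))) / (1 - of_nat q ^ r * T))"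
    by (simp_all add: weighted_count_0)
qed

lemma common_denominator:
  fixes A :: complex
  assumes "A \<noteq> 0" "B \<noteq> 0" "C \<noteq> 0"
  shows "1 + T * (p / A + u * ((1 + v * (w / A)) / B) + u' * ((1 + v' * (w' / A)) / C)) =
    (A * B * C + T * (p * B * C + u * (A + v * w) * C + u' * (A + v' * w') * B)) / (B * C * A)"
  using assms by (simp add: field_simps)

text \<open>Here \<open>x\<close> and \<open>y\<close> stand for \<open>q ^ m\<close> and
  \<open>q ^ n\<close>. The left side is what the recurrences produce; over the common denominator
  its numerator is divisible by \<open>1 - x * y * T\<close>, which cancels the denominator
  contributed by the recurrence for \<open>local_count\<close>.\<close>

lemma rational_identity:
  fixes q x y T :: complex
  assumes "1 - q * x * y * T \<noteq> 0" "1 - x * x * T \<noteq> 0" "1 - y * y * T \<noteq> 0" "1 - x * y * T \<noteq> 0"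
  shows "(1 + T * (q * (x - 1) * (y - 1) / (1 - q * x * y * T) +
      x * (x - 1) * ((1 + (q * x * T) * ((y - 1) / (1 - q * x * y * T))) / (1 - x * x * T)) +
      y * (y - 1) * ((1 + (q * y * T) * ((x - 1) / (1 - q * x * y * T))) / (1 - y * y * T)))) / (1 - x * y * T) =
    (q * x * y * T\<^sup>2 - ((q + 1) * x - (x - q - 1) * y - q) * T + 1) /
      ((1 - x * x * T) * (1 - y * y * T) * (1 - q * x * y * T))"
proof -
  define A B C E where "A = 1 - q * x * y * T" and "B = 1 - x * x * T" and "C = 1 - y * y * T" and "E = 1 - x * y * T"
  have nz: "A \<noteq> 0" "B \<noteq> 0" "C \<noteq> 0" "E \<noteq> 0" using assms by (simp_all add: A_def B_def C_def E_def)
  have "(A * B * C + T * (q * (x - 1) * (y - 1) * B * C + x * (x - 1) * (A + (q * x * T) * (y - 1)) * C +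
      y * (y - 1) * (A + (q * y * T) * (x - 1)) * B)) =
    (q * x * y * T\<^sup>2 - ((q + 1) * x - (x - q - 1) * y - q) * T + 1) * E"
    unfolding A_def B_def C_def E_def by (simp add: algebra_simps power2_eq_square)
  note eq = this
  show ?thesis
    unfolding A_def[symmetric] B_def[symmetric] C_def[symmetric] E_def[symmetric]
      common_denominator[OF nz(1-3)] eq
      divide_divide_eq_left
    by (rule mult_divide_mult_cancel_right[OF nz(4)])
qed

text \<open>Since \<open>q\<close>, \<open>x\<close> and \<open>y\<close> have norm at least 1, the
  single smallness condition on \<open>T\<close> controls the four ratios
  \<open>q * x * y * T\<close>, \<open>x * x * T\<close>, \<open>y * y * T\<close> and
  \<open>x * y * T\<close>.\<close>

lemma local_count_sums:
  fixes T :: complex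
  assumes m: "m \<ge> 1" and n: "n \<ge> 1" and q: "q \<ge> 1"
    and T: "norm (of_nat q * (of_nat q ^ m * of_nat q ^ n)\<^sup>2 * T) < 1"
  defines "x \<equiv> (of_nat q ^ m :: complex)" and "y \<equiv> (of_nat q ^ n :: complex)"
  shows "summable (\<lambda>k. norm (of_nat (local_count m n q k) * T ^ k))"
    and "(\<lambda>k. of_nat (local_count m n q k) * T ^ k) sums
      ((of_nat q * x * y * T\<^sup>2 - ((of_nat q + 1) * x - (x - of_nat q - 1) * y - of_nat q) * T + 1) /
        ((1 - x * x * T) * (1 - y * y * T) * (1 - of_nat q * x * y * T)))"
proof -
  let ?q = "of_nat q :: complex"
  have ge1: "norm ?q \<ge> 1" "norm x \<ge> 1" "norm y \<ge> 1" using q by (simp_all add: x_def y_def norm_power)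
  have small: "norm (u * T) < 1" if "norm u \<le> norm (?q * (x * y)\<^sup>2)" for u
  proof -
    have "norm (u * T) \<le> norm (?q * (x * y)\<^sup>2) * norm T"
      using that by (simp only: norm_mult) (rule mult_right_mono, auto simp: norm_mult)
    also have "\<dots> < 1" using T by (simp add: norm_mult x_def y_def)
    finally show ?thesis .
  qed
  have mono: "norm ?q ^ i * norm x ^ j * norm y ^ k \<le> norm (?q * (x * y)\<^sup>2)" if "i \<le> 1" "j \<le> 2" "k \<le> 2" for i j k
  proof -
    have "norm ?q ^ i * norm x ^ j * norm y ^ k \<le> norm ?q ^ 1 * norm x ^ 2 * norm y ^ 2"
      using ge1 that by (intro mult_mono power_increasing) (auto intro!: mult_nonneg_nonneg)
    then show ?thesis by (simp add: norm_mult norm_power power_mult_distrib mult.assoc)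
  qed
  have s1: "norm (?q * x * y * T) < 1" using small[of "?q * x * y"] mono[of 1 1 1] by (simp add: norm_mult)
  have s2: "norm (x * x * T) < 1" using small[of "x * x"] mono[of 0 2 0] by (simp add: norm_mult power2_eq_square)
  have s3: "norm (y * y * T) < 1" using small[of "y * y"] mono[of 0 0 2] by (simp add: norm_mult power2_eq_square)
  have s4: "norm (x * y * T) < 1" using small[of "x * y"] mono[of 0 1 1] by (simp add: norm_mult)
  have qx: "?q ^ (m - 1) * ?q = x" and qy: "?q ^ (n - 1) * ?q = y"
    using m n by (cases m; cases n; simp add: x_def y_def mult.commute)+
  have e1: "y * (?q * x * T) = ?q * x * y * T" "?q ^ (m - 1) * (?q * x * T) = x * x * T"
    by (simp_all add: mult_ac flip: qx)
  have e2: "x * (?q * y * T) = ?q * x * y * T" "?q ^ (n - 1) * (?q * y * T) = y * y * T"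
    by (simp_all add: mult_ac flip: qy)
  \<comment> \<open>A border term carries the extra powers \<open>q ^ Suc k * x ^ k\<close> or
    \<open>q ^ Suc k * y ^ k\<close>, so the weighted series are evaluated at
    \<open>?q * x * T\<close> and \<open>?q * y * T\<close>.\<close>
  note W1 = weighted_count_sums[OF q, of n "?q * x * T" "m - 1", folded y_def, unfolded e1, OF s1 s2]
  note W2 = weighted_count_sums[OF q, of m "?q * y * T" "n - 1", folded x_def, unfolded e2, OF s1 s3]
  \<comment> \<open>The summands are the corner with both valuations 0 and the rest of each border.
    The coefficients \<open>x\<close> and \<open>y\<close> in front come from
    \<open>?q ^ (m - 1) * ?q\<close> and \<open>?q ^ (n - 1) * ?q\<close>.\<close>
  define d where "d k = ?q * (x - 1) * (y - 1) * (?q * x * y) ^ k +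
    x * (x - 1) * (of_nat (weighted_count n (m - 1) q k) * (?q * x) ^ k) +
    y * (y - 1) * (of_nat (weighted_count m (n - 1) q k) * (?q * y) ^ k)" for k
  have rec: "of_nat (local_count m n q (Suc k)) = x * y * of_nat (local_count m n q k) + d k" for k
  proof -
    have "of_nat (local_count m n q (Suc k)) = x * y * of_nat (local_count m n q k) +
      ?q ^ Suc k * ((x - 1) * x ^ k * ((y - 1) * y ^ k + ?q ^ (m - 1) * of_nat (weighted_count n (m - 1) q k)) +
        (y - 1) * y ^ k * (?q ^ (n - 1) * of_nat (weighted_count m (n - 1) q k)))"
      by (simp add: local_count_Suc[OF m n] weighted_count_Suc of_nat_num_val_Suc_0[OF q] x_def y_def power_add)
    also have "\<dots> = x * y * of_nat (local_count m n q k) + (?q * (x - 1) * (y - 1) * (?q * x * y) ^ k +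
      (?q ^ (m - 1) * ?q) * (x - 1) * (of_nat (weighted_count n (m - 1) q k) * (?q * x) ^ k) +
      (?q ^ (n - 1) * ?q) * (y - 1) * (of_nat (weighted_count m (n - 1) q k) * (?q * y) ^ k))"
      by (simp add: power_mult_distrib algebra_simps)
    finally show ?thesis unfolding qx qy d_def .
  qed
  have dT: "d k * T ^ k = ?q * (x - 1) * (y - 1) * (?q * x * y) ^ k * T ^ k +
    x * (x - 1) * (of_nat (weighted_count n (m - 1) q k) * (?q * x * T) ^ k) +
    y * (y - 1) * (of_nat (weighted_count m (n - 1) q k) * (?q * y * T) ^ k)" for k
    by (simp add: d_def power_mult_distrib algebra_simps)
  note G = geometric_abs_sums[OF s1, of "?q * (x - 1) * (y - 1)"]
  have d_sums: "(\<lambda>k. d k * T ^ k) sums (?q * (x - 1) * (y - 1) / (1 - ?q * x * y * T) +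
      x * (x - 1) * ((1 + (?q * x * T) * ((y - 1) / (1 - ?q * x * y * T))) / (1 - x * x * T)) +
      y * (y - 1) * ((1 + (?q * y * T) * ((x - 1) / (1 - ?q * x * y * T))) / (1 - y * y * T)))"
    unfolding dT by (intro sums_add sums_mult G(2) W1(2) W2(2))
  have d_abs: "summable (\<lambda>k. norm (d k * T ^ k))"
  proof (rule summable_comparison_test')
    show "summable (\<lambda>k. norm (?q * (x - 1) * (y - 1) * (?q * x * y) ^ k * T ^ k) +
      norm (x * (x - 1)) * norm (of_nat (weighted_count n (m - 1) q k) * (?q * x * T) ^ k) +
      norm (y * (y - 1)) * norm (of_nat (weighted_count m (n - 1) q k) * (?q * y * T) ^ k))"
      by (intro summable_add summable_mult G(1) W1(1) W2(1))
    show "norm (norm (d k * T ^ k)) \<le> norm (?q * (x - 1) * (y - 1) * (?q * x * y) ^ k * T ^ k) +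
      norm (x * (x - 1)) * norm (of_nat (weighted_count n (m - 1) q k) * (?q * x * T) ^ k) +
      norm (y * (y - 1)) * norm (of_nat (weighted_count m (n - 1) q k) * (?q * y * T) ^ k)" for k
      unfolding dT real_norm_def abs_norm_cancel
      by (intro order_trans[OF norm_triangle_ineq] add_mono order_refl) (simp_all only: norm_mult order_refl)
  qed
  have "1 - u \<noteq> 0" if "norm u < 1" for u :: complex using that by auto
  then have nz: "1 - ?q * x * y * T \<noteq> 0" "1 - x * x * T \<noteq> 0" "1 - y * y * T \<noteq> 0" "1 - x * y * T \<noteq> 0"
    using s1 s2 s3 s4 by blast+
  from linear_recurrence_sums[OF rec s4 d_abs d_sums] rational_identity[OF nz]
  show "summable (\<lambda>k. norm (of_nat (local_count m n q k) * T ^ k))"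
    "(\<lambda>k. of_nat (local_count m n q k) * T ^ k) sums
      ((?q * x * y * T\<^sup>2 - ((?q + 1) * x - (x - ?q - 1) * y - ?q) * T + 1) /
        ((1 - x * x * T) * (1 - y * y * T) * (1 - ?q * x * y * T)))"
    by (simp_all add: local_count_0)
qed

section \<open>Commuting pairs over finite chain rings\<close>

text \<open>The equations express that group elements over \<open>(a, b)\<close> and
  \<open>(a', b')\<close> commute; the third coordinates cancel, see
  \<open>commute_unipotent_group_iff\<close>.\<close>

definition parallel_pairs ::
  "nat \<Rightarrow> nat \<Rightarrow> ('a, 'b) ring_scheme \<Rightarrow> (nat \<Rightarrow> 'a) \<Rightarrow> (nat \<Rightarrow> 'a) \<Rightarrow> ((nat \<Rightarrow> 'a) \<times> (nat \<Rightarrow> 'a)) set" where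
  "parallel_pairs m n R a b =
     {(a', b'). a' \<in> {1..m} \<rightarrow>\<^sub>E carrier R \<and> b' \<in> {1..n} \<rightarrow>\<^sub>E carrier R \<and>
        (\<forall>i\<in>{1..m}. \<forall>j\<in>{1..n}. a i \<otimes>\<^bsub>R\<^esub> b' j = a' i \<otimes>\<^bsub>R\<^esub> b j)}"

definition num_parallel :: "nat \<Rightarrow> nat \<Rightarrow> ('a, 'b) ring_scheme \<Rightarrow> nat" where
  "num_parallel m n R =
     (\<Sum>a\<in>{1..m} \<rightarrow>\<^sub>E carrier R. \<Sum>b\<in>{1..n} \<rightarrow>\<^sub>E carrier R. card (parallel_pairs m n R a b))"

lemma (in ring) r_minus_distr:
  "x \<in> carrier R \<Longrightarrow> y \<in> carrier R \<Longrightarrow> z \<in> carrier R \<Longrightarrow> x \<otimes> (y \<ominus> z) = x \<otimes> y \<ominus> x \<otimes> z"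
  by (simp add: a_minus_def r_distr r_minus)

text \<open>Transposing the matrix equation exchanges the two vectors. This reduces valuations
  \<open>i > j\<close> to the case in which the first vector contains an entry of least
  valuation.\<close>

lemma (in cring) parallel_pairs_swap:
  assumes a: "a \<in> {1..m} \<rightarrow>\<^sub>E carrier R" and b: "b \<in> {1..n} \<rightarrow>\<^sub>E carrier R"
  shows "card (parallel_pairs m n R a b) = card (parallel_pairs n m R b a)"
proof (rule bij_betw_same_card[of prod.swap])
  have *: "a i \<otimes> b' j = a' i \<otimes> b j \<longleftrightarrow> b j \<otimes> a' i = b' j \<otimes> a i"
    if "i \<in> {1..m}" "j \<in> {1..n}" "a' \<in> {1..m} \<rightarrow>\<^sub>E carrier R" "b' \<in> {1..n} \<rightarrow>\<^sub>E carrier R" for i j a' b'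
  proof -
    have "a i \<in> carrier R" "a' i \<in> carrier R" "b j \<in> carrier R" "b' j \<in> carrier R"
      using that a b by auto
    then show ?thesis by (auto simp: m_comm)
  qed
  show "bij_betw prod.swap (parallel_pairs m n R a b) (parallel_pairs n m R b a)"
    by (rule bij_betw_byWitness[of _ prod.swap]) (use * in \<open>auto simp: parallel_pairs_def\<close>)
qed

text \<open>A ring like \<open>O/P^k\<close>, with \<open>F i\<close> in the role of \<open>P^i/P^k\<close>.\<close>

locale chain_ring = cring R for R (structure) +
  fixes F :: "nat \<Rightarrow> 'a set" and k q :: nat
  assumes F_0: "F 0 = carrier R" and F_antimono: "i \<le> j \<Longrightarrow> F j \<subseteq> F i"
    and F_k: "F k = {\<zero>}"
    and finite_carrier: "finite (carrier R)" and card_F: "i \<le> k \<Longrightarrow> card (F i) = q ^ (k - i)"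
    and chain: "i < k \<Longrightarrow> x \<in> F i \<Longrightarrow> x \<notin> F (Suc i) \<Longrightarrow> y \<in> F i \<Longrightarrow> \<exists>r\<in>carrier R. y = r \<otimes> x"
    and ann: "i < k \<Longrightarrow> x \<in> F i \<Longrightarrow> x \<notin> F (Suc i) \<Longrightarrow> y \<in> carrier R \<Longrightarrow>
      x \<otimes> y = \<zero> \<longleftrightarrow> y \<in> F (k - i)"
begin

lemma F_carrier: "x \<in> F i \<Longrightarrow> x \<in> carrier R"
  using F_antimono[of 0 i] F_0 by blast

lemma finite_F: "finite (F i)"
  using finite_subset[OF _ finite_carrier] F_carrier by blast

text \<open>A generator of the ideal \<open>F i\<close>. At \<open>i = k\<close> the exclusion is
  dropped, so that zero generates the zero ideal \<open>F k\<close>.\<close>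

definition gen :: "nat \<Rightarrow> 'a \<Rightarrow> bool" where
  "gen i x \<longleftrightarrow> x \<in> F i \<and> (i < k \<longrightarrow> x \<notin> F (Suc i))"

lemma gen_chain:
  assumes "i \<le> k" "gen i x" "y \<in> F i" shows "\<exists>r\<in>carrier R. y = r \<otimes> x"
proof (cases "i = k")
  case True
  then have "x = \<zero>" "y = \<zero>" using assms F_k by (auto simp: gen_def)
  then show ?thesis by (intro bexI[of _ \<zero>]) auto
next
  case False
  then show ?thesis using assms chain[of i x y] by (auto simp: gen_def)
qed

lemma gen_ann:
  assumes "i \<le> k" "gen i x" "y \<in> carrier R" shows "x \<otimes> y = \<zero> \<longleftrightarrow> y \<in> F (k - i)"
proof (cases "i = k")
  case True
  then have "x = \<zero>" using assms F_k by (auto simp: gen_def)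
  then show ?thesis using True assms F_0 by simp
next
  case False
  then show ?thesis using assms ann[of i x y] by (auto simp: gen_def)
qed

text \<open>The valuation of a vector is the least valuation of its entries, capped at
  \<open>k\<close>.\<close>

definition vec_val :: "nat \<Rightarrow> nat \<Rightarrow> (nat \<Rightarrow> 'a) set" where
  "vec_val n i = {a \<in> {1..n} \<rightarrow>\<^sub>E F i. \<exists>l\<in>{1..n}. gen i (a l)}"

text \<open>For \<open>i < k\<close> a vector over \<open>F i\<close> fails to have valuation
  \<open>i\<close> exactly if all entries lie in \<open>F (Suc i)\<close>, whence a difference of
  two powers. At \<open>i = k\<close> only the zero vector is left.\<close>

lemma card_vec_val:
  assumes "n \<ge> 1" "i \<le> k" shows "card (vec_val n i) = num_val k q n i"
proof (cases "i = k")
  case True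
  have "vec_val n k = {1..n} \<rightarrow>\<^sub>E F k"
    using assms unfolding vec_val_def gen_def by (fastforce dest: PiE_mem)
  then have "card (vec_val n k) = (\<Prod>l\<in>{1..n}. card (F k))" by (simp only: card_PiE finite_atLeastAtMost)
  then show ?thesis unfolding True F_k num_val_def by simp
next
  case False
  then have "i < k" using assms by simp
  have "a \<in> vec_val n i \<longleftrightarrow> a \<in> ({1..n} \<rightarrow>\<^sub>E F i) - ({1..n} \<rightarrow>\<^sub>E F (Suc i))" for a
  proof (cases "a \<in> {1..n} \<rightarrow>\<^sub>E F i")
    case True
    then have "a \<in> {1..n} \<rightarrow>\<^sub>E F (Suc i) \<longleftrightarrow> (\<forall>l\<in>{1..n}. a l \<in> F (Suc i))"
      by (simp only: PiE_iff simp_thms)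
    then show ?thesis
      using True \<open>i < k\<close> PiE_mem[OF True] unfolding vec_val_def gen_def by blast
  qed (simp add: vec_val_def)
  then have "vec_val n i = ({1..n} \<rightarrow>\<^sub>E F i) - ({1..n} \<rightarrow>\<^sub>E F (Suc i))" by blast
  moreover have "({1..n} \<rightarrow>\<^sub>E F (Suc i)) \<subseteq> ({1..n} \<rightarrow>\<^sub>E F i)"
    by (rule PiE_mono) (use F_antimono[of i "Suc i"] in auto)
  ultimately have "card (vec_val n i) = card ({1..n} \<rightarrow>\<^sub>E F i) - card ({1..n} \<rightarrow>\<^sub>E F (Suc i))"
    by (simp add: card_Diff_subset finite_PiE finite_F)
  then show ?thesis
    using False assms by (simp add: num_val_def card_PiE card_F mult.commute flip: power_mult)
qed

lemma gen_unique: "i \<le> k \<Longrightarrow> j \<le> k \<Longrightarrow> gen i x \<Longrightarrow> x \<in> F j \<Longrightarrow> j \<le> i"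
  using F_antimono[of "Suc i" j] by (cases "i < j") (auto simp: gen_def)

lemma UN_vec_val:
  assumes "n \<ge> 1" shows "({1..n} \<rightarrow>\<^sub>E carrier R) = (\<Union>i\<le>k. vec_val n i)"
proof (intro equalityI subsetI)
  fix a assume a: "a \<in> {1..n} \<rightarrow>\<^sub>E carrier R"
  define V where "V i \<longleftrightarrow> i \<le> k \<and> a \<in> {1..n} \<rightarrow>\<^sub>E F i" for i
  have "V 0" using a F_0 by (simp add: V_def)
  define i where "i = (GREATEST i. V i)"
  have i: "V i" unfolding i_def by (rule GreatestI_nat[of V 0 k]) (use \<open>V 0\<close> in \<open>auto simp: V_def\<close>)
  have max: "j \<le> i" if "V j" for j
    unfolding i_def by (rule Greatest_le_nat[of V _ k]) (use that in \<open>auto simp: V_def\<close>)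
  have "\<exists>l\<in>{1..n}. gen i (a l)"
  proof (rule ccontr)
    assume no: "\<not> ?thesis"
    have "i < k"
    proof (rule ccontr)
      assume "\<not> i < k"
      then have "gen i (a 1)" using i assms by (auto simp: V_def gen_def)
      then show False using no assms by auto
    qed
    have "a l \<in> F (Suc i)" if "l \<in> {1..n}" for l
      using no i that \<open>i < k\<close> unfolding V_def gen_def by (metis PiE_mem)
    then have "V (Suc i)" using a \<open>i < k\<close> unfolding V_def PiE_iff by simp
    then show False using max by fastforce
  qed
  then show "a \<in> (\<Union>i\<le>k. vec_val n i)" using i by (auto simp: V_def vec_val_def)
next
  fix a assume "a \<in> (\<Union>i\<le>k. vec_val n i)"
  then show "a \<in> {1..n} \<rightarrow>\<^sub>E carrier R" using F_carrier by (auto simp: vec_val_def PiE_iff)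
qed

lemma disjoint_vec_val:
  assumes "i \<le> k" "j \<le> k" "i \<noteq> j" shows "vec_val n i \<inter> vec_val n j = {}"
proof (rule ccontr)
  assume "vec_val n i \<inter> vec_val n j \<noteq> {}"
  then obtain a l l' where a: "a \<in> {1..n} \<rightarrow>\<^sub>E F i" "a \<in> {1..n} \<rightarrow>\<^sub>E F j"
    "l \<in> {1..n}" "gen i (a l)" "l' \<in> {1..n}" "gen j (a l')"
    unfolding vec_val_def by blast
  have "j \<le> i" using gen_unique[OF assms(1,2) a(4)] a(2,3) by (auto simp: PiE_iff)
  moreover have "i \<le> j" using gen_unique[OF assms(2,1) a(6)] a(1,5) by (auto simp: PiE_iff)
  ultimately show False using assms(3) by simp
qed

lemma sum_vec_val:
  assumes "n \<ge> 1"
  shows "(\<Sum>a\<in>{1..n} \<rightarrow>\<^sub>E carrier R. f a) = (\<Sum>i\<le>k. \<Sum>a\<in>vec_val n i. f a)"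
proof -
  have "finite (vec_val n i)" for i
    by (rule finite_subset[of _ "{1..n} \<rightarrow>\<^sub>E F i"]) (auto simp: vec_val_def finite_PiE finite_F)
  then show ?thesis
    unfolding UN_vec_val[OF assms] by (intro sum.UNION_disjoint) (use disjoint_vec_val in auto)
qed

lemma card_translate:
  assumes "c \<in> carrier R" shows "card {x \<in> carrier R. x \<ominus> c \<in> F i} = card (F i)"
proof (rule bij_betw_same_card[of "\<lambda>x. x \<ominus> c"])
  show "bij_betw (\<lambda>x. x \<ominus> c) {x \<in> carrier R. x \<ominus> c \<in> F i} (F i)"
  proof (rule bij_betw_byWitness[of _ "\<lambda>y. y \<oplus> c"])
    show "\<forall>x\<in>{x \<in> carrier R. x \<ominus> c \<in> F i}. x \<ominus> c \<oplus> c = x"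
      using assms by (auto simp: a_minus_def a_assoc l_neg)
    show "\<forall>y\<in>F i. y \<oplus> c \<ominus> c = y"
      using assms F_carrier by (auto simp: a_minus_def a_assoc r_neg)
    then show "(\<lambda>y. y \<oplus> c) ` F i \<subseteq> {x \<in> carrier R. x \<ominus> c \<in> F i}"
      using assms F_carrier by auto
  qed auto
qed

text \<open>The entry \<open>a p0\<close> of least valuation divides all entries of both vectors,
  because \<open>i \<le> j\<close>. Row \<open>p0\<close> of the equations fixes each
  \<open>b' l\<close> up to the annihilator of \<open>a p0\<close>. Granted this row, row
  \<open>p\<close> says that \<open>b l \<otimes> (a' p \<ominus> r p \<otimes> a' p0)\<close>
  vanishes for all \<open>l\<close>, and \<open>b l0\<close> imposes the strongest of these
  conditions.\<close>

lemma parallel_pairs_iff: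
  assumes ij: "i \<le> k" "j \<le> k" "i \<le> j"
    and a: "a \<in> {1..m} \<rightarrow>\<^sub>E carrier R" and b: "b \<in> {1..n} \<rightarrow>\<^sub>E F j"
    and p0: "p0 \<in> {1..m}" "gen i (a p0)" and l0: "l0 \<in> {1..n}" "gen j (b l0)"
    and r: "\<And>p. p \<in> {1..m} \<Longrightarrow> r p \<in> carrier R \<and> a p = r p \<otimes> a p0"
    and s: "\<And>l. l \<in> {1..n} \<Longrightarrow> s l \<in> carrier R \<and> b l = s l \<otimes> a p0"
    and a': "a' \<in> {1..m} \<rightarrow>\<^sub>E carrier R" and b': "b' \<in> {1..n} \<rightarrow>\<^sub>E carrier R"
  shows "(\<forall>p\<in>{1..m}. \<forall>l\<in>{1..n}. a p \<otimes> b' l = a' p \<otimes> b l) \<longleftrightarrow>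
    (\<forall>l\<in>{1..n}. b' l \<ominus> a' p0 \<otimes> s l \<in> F (k - i)) \<and>
    (\<forall>p\<in>{1..m} - {p0}. a' p \<ominus> r p \<otimes> a' p0 \<in> F (k - j))"
proof -
  have bl: "b l \<in> carrier R" "b l \<in> F j" "b' l \<in> carrier R" "s l \<in> carrier R" "b l = s l \<otimes> a p0" if "l \<in> {1..n}" for l
    using PiE_mem[OF b that] PiE_mem[OF b' that] s[OF that] F_carrier by blast+
  have ap: "a p \<in> carrier R" "a' p \<in> carrier R" "r p \<in> carrier R" "a p = r p \<otimes> a p0" if "p \<in> {1..m}" for p
    using PiE_mem[OF a that] PiE_mem[OF a' that] r[OF that] by blast+
  note c0 = ap(1,2)[OF p0(1)]
  have first: "a p0 \<otimes> b' l = a' p0 \<otimes> b l \<longleftrightarrow> b' l \<ominus> a' p0 \<otimes> s l \<in> F (k - i)" if l: "l \<in> {1..n}" for l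
  proof -
    have "a' p0 \<otimes> b l = a p0 \<otimes> (a' p0 \<otimes> s l)"
      using bl[OF l] c0 by (simp add: m_ac)
    then have "a p0 \<otimes> b' l = a' p0 \<otimes> b l \<longleftrightarrow> a p0 \<otimes> (b' l \<ominus> a' p0 \<otimes> s l) = \<zero>"
      using bl[OF l] c0 by (simp add: r_minus_distr)
    also have "\<dots> \<longleftrightarrow> b' l \<ominus> a' p0 \<otimes> s l \<in> F (k - i)"
      using gen_ann[OF ij(1) p0(2)] bl[OF l] c0 by simp
    finally show ?thesis .
  qed
  have rest: "a p \<otimes> b' l = a' p \<otimes> b l \<longleftrightarrow> b l \<otimes> (a' p \<ominus> r p \<otimes> a' p0) = \<zero>"
    if p: "p \<in> {1..m}" and l: "l \<in> {1..n}" and eq: "a p0 \<otimes> b' l = a' p0 \<otimes> b l" for p l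
  proof -
    have "a p \<otimes> b' l = r p \<otimes> (a p0 \<otimes> b' l)" using ap[OF p] bl[OF l] c0 by (simp add: m_assoc)
    also have "\<dots> = b l \<otimes> (r p \<otimes> a' p0)" unfolding eq using ap[OF p] bl(1)[OF l] c0 by (simp add: m_ac)
    finally show ?thesis using ap(2,3)[OF p] bl(1)[OF l] c0 by (auto simp: r_minus_distr m_comm)
  qed
  show ?thesis (is "?L \<longleftrightarrow> ?R1 \<and> ?R2")
  proof
    assume L: ?L
    then have "?R1" using first p0(1) by blast
    moreover have "?R2"
    proof
      fix p assume p: "p \<in> {1..m} - {p0}"
      then have "b l0 \<otimes> (a' p \<ominus> r p \<otimes> a' p0) = \<zero>" using rest[of p l0] L p0(1) l0(1) by blast
      then show "a' p \<ominus> r p \<otimes> a' p0 \<in> F (k - j)" using gen_ann[OF ij(2) l0(2)] ap p c0 by auto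
    qed
    ultimately show "?R1 \<and> ?R2" ..
  next
    assume R: "?R1 \<and> ?R2"
    show ?L
    proof (intro ballI)
      fix p l assume p: "p \<in> {1..m}" and l: "l \<in> {1..n}"
      have eq: "a p0 \<otimes> b' l = a' p0 \<otimes> b l" using R first l by blast
      show "a p \<otimes> b' l = a' p \<otimes> b l"
      proof (cases "p = p0")
        case False
        define d where "d = a' p \<ominus> r p \<otimes> a' p0"
        have d: "d \<in> carrier R" "d \<in> F (k - j)" using R p False ap c0 by (auto simp: d_def)
        obtain t where t: "t \<in> carrier R" "b l = t \<otimes> b l0" using gen_chain[OF ij(2) l0(2) bl(2)[OF l]] by blast
        have "b l \<otimes> d = t \<otimes> (b l0 \<otimes> d)" using t d bl(1)[OF l0(1)] by (simp add: m_assoc)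
        also have "\<dots> = \<zero>" using gen_ann[OF ij(2) l0(2) d(1)] d t by simp
        finally show ?thesis using rest[OF p l eq] by (simp add: d_def)
      qed (use eq in simp)
    qed
  qed
qed

text \<open>The entry \<open>a' p0\<close> is free, giving \<open>q ^ k\<close>. Each of the
  \<open>n\<close> entries of \<open>b'\<close> then ranges over a translate of
  \<open>F (k - i)\<close>, with \<open>q ^ i\<close> elements, and each of the other
  \<open>m - 1\<close> entries of \<open>a'\<close> over a translate of \<open>F (k - j)\<close>,
  with \<open>q ^ j\<close> elements.\<close>

lemma card_parallel_pairs:
  assumes ij: "i \<le> k" "j \<le> k" "i \<le> j" and a: "a \<in> vec_val m i" and b: "b \<in> vec_val n j"
  shows "card (parallel_pairs m n R a b) = q ^ (k + i * n + j * (m - 1))"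
proof -
  have aF: "a \<in> {1..m} \<rightarrow>\<^sub>E F i" and bF: "b \<in> {1..n} \<rightarrow>\<^sub>E F j" using a b by (auto simp: vec_val_def)
  obtain p0 where p0: "p0 \<in> {1..m}" "gen i (a p0)" using a by (auto simp: vec_val_def)
  obtain l0 where l0: "l0 \<in> {1..n}" "gen j (b l0)" using b by (auto simp: vec_val_def)
  have "\<exists>r. r \<in> carrier R \<and> a p = r \<otimes> a p0" if "p \<in> {1..m}" for p
    using gen_chain[OF ij(1) p0(2), of "a p"] PiE_mem[OF aF that] by blast
  then obtain r where r: "\<And>p. p \<in> {1..m} \<Longrightarrow> r p \<in> carrier R \<and> a p = r p \<otimes> a p0" by metis
  have "\<exists>s. s \<in> carrier R \<and> b l = s \<otimes> a p0" if "l \<in> {1..n}" for l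
    using gen_chain[OF ij(1) p0(2), of "b l"] PiE_mem[OF bF that] F_antimono[OF ij(3)] by blast
  then obtain s where s: "\<And>l. l \<in> {1..n} \<Longrightarrow> s l \<in> carrier R \<and> b l = s l \<otimes> a p0" by metis
  have aC: "a \<in> {1..m} \<rightarrow>\<^sub>E carrier R" using aF F_carrier by (auto simp: PiE_iff)
  note iff = parallel_pairs_iff[OF ij aC bF p0 l0 r s]
  \<comment> \<open>\<open>Alpha t\<close> collects the \<open>a'\<close> with
    \<open>a' p0 = t\<close>, and \<open>Beta a'\<close> the \<open>b'\<close> compatible with
    \<open>a'\<close>; their sizes turn out to be independent of \<open>t\<close> and
    \<open>a'\<close>.\<close>
  define Alpha where "Alpha t = ({1..m} \<rightarrow>\<^sub>E carrier R) \<inter>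
    PiE {1..m} (\<lambda>p. if p = p0 then {t} else {x \<in> carrier R. x \<ominus> r p \<otimes> t \<in> F (k - j)})" for t
  define Beta where "Beta a' = PiE {1..n} (\<lambda>l. {x \<in> carrier R. x \<ominus> a' p0 \<otimes> s l \<in> F (k - i)})" for a'
  have Alpha_p0: "a' p0 = t" and Alpha_other: "p \<in> {1..m} - {p0} \<Longrightarrow> a' p \<ominus> r p \<otimes> t \<in> F (k - j)"
    if "a' \<in> Alpha t" for a' t p
  proof -
    have "a' \<in> PiE {1..m} (\<lambda>p. if p = p0 then {t} else {x \<in> carrier R. x \<ominus> r p \<otimes> t \<in> F (k - j)})"
      using that by (simp add: Alpha_def)
    note mem = PiE_mem[OF this]
    show "a' p0 = t" using mem[OF p0(1)] by simp
    show "a' p \<ominus> r p \<otimes> t \<in> F (k - j)" if "p \<in> {1..m} - {p0}"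
      using mem[of p] that by simp
  qed
  have Seq: "parallel_pairs m n R a b = (SIGMA a':(\<Union>t\<in>carrier R. Alpha t). Beta a')" (is "_ = ?S")
  proof (intro equalityI subsetI)
    fix x assume "x \<in> parallel_pairs m n R a b"
    then obtain a' b' where x: "x = (a', b')" "a' \<in> {1..m} \<rightarrow>\<^sub>E carrier R" "b' \<in> {1..n} \<rightarrow>\<^sub>E carrier R"
      "\<forall>i\<in>{1..m}. \<forall>j\<in>{1..n}. a i \<otimes> b' j = a' i \<otimes> b j" by (auto simp: parallel_pairs_def)
    have "a' \<in> Alpha (a' p0)" "b' \<in> Beta a'" "a' p0 \<in> carrier R"
      using x(2-4) iff[OF _ _ x(2,3)] p0(1) unfolding Alpha_def Beta_def by (auto simp: PiE_iff)
    then show "x \<in> ?S" using x(1) by blast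
  next
    fix x assume "x \<in> ?S"
    then obtain a' b' t where x: "x = (a', b')" "t \<in> carrier R" "a' \<in> Alpha t" "b' \<in> Beta a'" by blast
    have t: "a' p0 = t" using Alpha_p0[OF x(3)] .
    have a': "a' \<in> {1..m} \<rightarrow>\<^sub>E carrier R" and b': "b' \<in> {1..n} \<rightarrow>\<^sub>E carrier R"
      using x(3,4) by (auto simp: Alpha_def Beta_def PiE_iff)
    have "\<forall>l\<in>{1..n}. b' l \<ominus> a' p0 \<otimes> s l \<in> F (k - i)" using x(4) by (auto simp: Beta_def PiE_iff)
    moreover have "\<forall>p\<in>{1..m} - {p0}. a' p \<ominus> r p \<otimes> a' p0 \<in> F (k - j)"
      using Alpha_other[OF x(3)] unfolding t by blast
    ultimately show "x \<in> parallel_pairs m n R a b"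
      using iff[OF _ _ a' b'] a' b' x(1) by (auto simp: parallel_pairs_def)
  qed
  have card_Alpha: "card (Alpha t) = q ^ (j * (m - 1))" if t: "t \<in> carrier R" for t
  proof -
    let ?f = "\<lambda>p. if p = p0 then {t} else {x \<in> carrier R. x \<ominus> r p \<otimes> t \<in> F (k - j)}"
    have "Alpha t = PiE {1..m} ?f"
      unfolding Alpha_def by (intro Int_absorb1 PiE_mono) (use t in auto)
    then have "card (Alpha t) = (\<Prod>p\<in>{1..m}. card (?f p))" by (simp add: card_PiE)
    also have "\<dots> = card (?f p0) * (\<Prod>p\<in>{1..m} - {p0}. card (?f p))"
      using p0(1) by (simp add: prod.remove)
    also have "(\<Prod>p\<in>{1..m} - {p0}. card (?f p)) = (\<Prod>p\<in>{1..m} - {p0}. q ^ j)"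
      using r t ij by (intro prod.cong) (auto simp: card_translate card_F)
    finally show ?thesis using p0(1) by (simp add: power_mult)
  qed
  have card_Beta: "card (Beta a') = q ^ (i * n)" if "a' p0 \<in> carrier R" for a'
  proof -
    have "card (Beta a') = (\<Prod>l\<in>{1..n}. q ^ i)"
      unfolding Beta_def using that s ij by (simp add: card_PiE card_translate card_F)
    then show ?thesis by (simp add: power_mult)
  qed
  have fin: "finite (Alpha t)" for t
    by (rule finite_subset[of _ "{1..m} \<rightarrow>\<^sub>E carrier R"]) (auto simp: Alpha_def finite_PiE finite_carrier)
  have finB: "finite (Beta a')" for a'
    by (rule finite_subset[of _ "{1..n} \<rightarrow>\<^sub>E carrier R"]) (auto simp: Beta_def PiE_iff finite_PiE finite_carrier)
  have "card (parallel_pairs m n R a b) = (\<Sum>a'\<in>(\<Union>t\<in>carrier R. Alpha t). card (Beta a'))"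
    unfolding Seq by (rule card_SigmaI) (use finite_carrier fin finB in auto)
  also have "\<dots> = (\<Sum>a'\<in>(\<Union>t\<in>carrier R. Alpha t). q ^ (i * n))"
    by (rule sum.cong[OF refl], rule card_Beta) (use Alpha_p0 in blast)
  also have "\<dots> = card (\<Union>t\<in>carrier R. Alpha t) * q ^ (i * n)" by simp
  also have "card (\<Union>t\<in>carrier R. Alpha t) = (\<Sum>t\<in>carrier R. card (Alpha t))"
    by (rule card_UN_disjoint) (use finite_carrier fin Alpha_p0 in blast)+
  also have "\<dots> = q ^ k * q ^ (j * (m - 1))"
    using card_Alpha card_F[of 0] F_0 by simp
  finally show ?thesis by (simp add: power_add mult_ac)
qed

lemma num_parallel_eq:
  assumes "m \<ge> 1" "n \<ge> 1"
  shows "num_parallel m n R = local_count m n q k"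
proof -
  have card: "card (parallel_pairs m n R a b) =
      q ^ (if i \<le> j then k + i * n + j * (m - 1) else k + j * m + i * (n - 1))"
    if ij: "i \<le> k" "j \<le> k" and a: "a \<in> vec_val m i" and b: "b \<in> vec_val n j" for i j a b
  proof (cases "i \<le> j")
    case True
    then show ?thesis using card_parallel_pairs[OF ij True a b] by simp
  next
    case False
    have "a \<in> {1..m} \<rightarrow>\<^sub>E carrier R" "b \<in> {1..n} \<rightarrow>\<^sub>E carrier R"
      using UN_vec_val assms a b ij by blast+
    then show ?thesis using card_parallel_pairs[OF ij(2,1) _ b a] parallel_pairs_swap False by simp
  qed
  have "num_parallel m n R = (\<Sum>i\<le>k. \<Sum>a\<in>vec_val m i. \<Sum>j\<le>k. \<Sum>b\<in>vec_val n j. card (parallel_pairs m n R a b))"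
    unfolding num_parallel_def sum_vec_val[OF assms(1)] sum_vec_val[OF assms(2)] ..
  also have "\<dots> = (\<Sum>i\<le>k. \<Sum>a\<in>vec_val m i. \<Sum>j\<le>k. \<Sum>b\<in>vec_val n j.
      q ^ (if i \<le> j then k + i * n + j * (m - 1) else k + j * m + i * (n - 1)))"
    by (intro sum.cong refl card) auto
  also have "\<dots> = (\<Sum>i\<le>k. \<Sum>j\<le>k. num_val k q m i * num_val k q n j *
      q ^ (if i \<le> j then k + i * n + j * (m - 1) else k + j * m + i * (n - 1)))"
    using assms by (simp add: card_vec_val sum_distrib_left mult.assoc)
  finally show ?thesis by (simp only: local_count_def)
qed

end

section \<open>Conjugacy classes of the unipotent group\<close>

lemma restrict_eq_iff: "restrict f A = restrict g A \<longleftrightarrow> (\<forall>x\<in>A. f x = g x)"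
  by (auto simp: fun_eq_iff restrict_def)

lemma mem_parallel_pairs:
  "(a', b') \<in> parallel_pairs m n R a b \<longleftrightarrow>
     a' \<in> {1..m} \<rightarrow>\<^sub>E carrier R \<and> b' \<in> {1..n} \<rightarrow>\<^sub>E carrier R \<and>
     (\<forall>i\<in>{1..m}. \<forall>j\<in>{1..n}. a i \<otimes>\<^bsub>R\<^esub> b' j = a' i \<otimes>\<^bsub>R\<^esub> b j)"
  by (simp only: parallel_pairs_def mem_Collect_eq prod.case)

context cring
begin

lemma carrier_unipotent_group:
  "carrier (unipotent_group m n R) = ({1..m} \<rightarrow>\<^sub>E carrier R) \<times> ({1..n} \<rightarrow>\<^sub>E carrier R) \<times>
     ({1..m} \<times> {1..n} \<rightarrow>\<^sub>E carrier R)"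
  by (simp add: unipotent_group_def)

lemma mult_unipotent_group:
  "(a, b, c) \<otimes>\<^bsub>unipotent_group m n R\<^esub> (a', b', c') =
     (\<lambda>i\<in>{1..m}. a i \<oplus> a' i, \<lambda>j\<in>{1..n}. b j \<oplus> b' j,
      \<lambda>p\<in>{1..m} \<times> {1..n}. c p \<oplus> c' p \<oplus> a (fst p) \<otimes> b' (snd p))"
  by (simp add: unipotent_group_def case_prod_unfold)

lemma one_unipotent_group:
  "\<one>\<^bsub>unipotent_group m n R\<^esub> = (\<lambda>i\<in>{1..m}. \<zero>, \<lambda>j\<in>{1..n}. \<zero>, \<lambda>p\<in>{1..m} \<times> {1..n}. \<zero>)"
  by (simp add: unipotent_group_def case_prod_unfold)

lemma unipotent_group_is_group: "group (unipotent_group m n R)" (is "group ?G")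
proof (rule groupI)
  fix x y assume "x \<in> carrier ?G" "y \<in> carrier ?G"
  then show "x \<otimes>\<^bsub>?G\<^esub> y \<in> carrier ?G"
    by (cases x, cases y) (auto simp: carrier_unipotent_group mult_unipotent_group PiE_iff)
next
  show "\<one>\<^bsub>?G\<^esub> \<in> carrier ?G"
    by (auto simp: carrier_unipotent_group one_unipotent_group)
next
  fix x y z assume xyz: "x \<in> carrier ?G" "y \<in> carrier ?G" "z \<in> carrier ?G"
  obtain a b c a' b' c' a'' b'' c'' where eq: "x = (a, b, c)" "y = (a', b', c')" "z = (a'', b'', c'')"
    by (metis prod_cases3)
  have fun_mem: "a i \<in> carrier R" "a' i \<in> carrier R" "a'' i \<in> carrier R" if "i \<in> {1..m}" for i
    using xyz that by (auto simp: eq carrier_unipotent_group PiE_iff)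
  have fun_mem': "b i \<in> carrier R" "b' i \<in> carrier R" "b'' i \<in> carrier R" if "i \<in> {1..n}" for i
    using xyz that by (auto simp: eq carrier_unipotent_group PiE_iff)
  have fun_mem'': "c p \<in> carrier R" "c' p \<in> carrier R" "c'' p \<in> carrier R" if "p \<in> {1..m} \<times> {1..n}" for p
    using xyz that by (auto simp: eq carrier_unipotent_group PiE_iff)
  show "x \<otimes>\<^bsub>?G\<^esub> y \<otimes>\<^bsub>?G\<^esub> z = x \<otimes>\<^bsub>?G\<^esub> (y \<otimes>\<^bsub>?G\<^esub> z)"
    unfolding eq mult_unipotent_group prod.inject
    by (intro conjI restrict_ext) (auto simp: fun_mem fun_mem' fun_mem'' l_distr r_distr a_ac)
next
  fix x assume x: "x \<in> carrier ?G"
  obtain a b c where eq: "x = (a, b, c)" by (metis prod_cases3)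
  show "\<one>\<^bsub>?G\<^esub> \<otimes>\<^bsub>?G\<^esub> x = x"
    using x unfolding eq one_unipotent_group mult_unipotent_group
    by (auto simp: carrier_unipotent_group PiE_iff extensional_def restrict_def fun_eq_iff)
  \<comment> \<open>In the product of \<open>y\<close> and \<open>x\<close> the third coordinate
    must cancel \<open>c p\<close> as well as the product of \<open>\<ominus> a\<close> with
    \<open>b\<close>, whence the second summand.\<close>
  define y where "y = (\<lambda>i\<in>{1..m}. \<ominus> a i, \<lambda>j\<in>{1..n}. \<ominus> b j,
    \<lambda>p\<in>{1..m} \<times> {1..n}. \<ominus> c p \<oplus> a (fst p) \<otimes> b (snd p))"
  have "y \<in> carrier ?G" using x by (auto simp: eq y_def carrier_unipotent_group PiE_iff)
  moreover have "y \<otimes>\<^bsub>?G\<^esub> x = \<one>\<^bsub>?G\<^esub>"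
  proof -
    have fun_mem: "a i \<in> carrier R" if "i \<in> {1..m}" for i
      using x that by (auto simp: eq carrier_unipotent_group PiE_iff)
    have fun_mem': "b i \<in> carrier R" if "i \<in> {1..n}" for i
      using x that by (auto simp: eq carrier_unipotent_group PiE_iff)
    have fun_mem'': "c p \<in> carrier R" if "p \<in> {1..m} \<times> {1..n}" for p
      using x that by (auto simp: eq carrier_unipotent_group PiE_iff)
    have cancel: "\<ominus> u \<oplus> v \<oplus> u \<oplus> \<ominus> v = \<zero>" if "u \<in> carrier R" "v \<in> carrier R" for u v
    proof -
      have "\<ominus> u \<oplus> v \<oplus> u \<oplus> \<ominus> v = \<ominus> u \<oplus> (u \<oplus> (v \<oplus> \<ominus> v))"
        using that by (simp only: a_ac a_inv_closed a_closed)
      then show ?thesis using that by (simp add: r_neg l_neg)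
    qed
    show ?thesis
      unfolding eq y_def mult_unipotent_group one_unipotent_group prod.inject
      by (intro conjI restrict_ext) (auto simp: fun_mem fun_mem' fun_mem'' l_neg l_minus cancel)
  qed
  ultimately show "\<exists>y\<in>carrier ?G. y \<otimes>\<^bsub>?G\<^esub> x = \<one>\<^bsub>?G\<^esub>" by blast
qed

lemma commute_unipotent_group_iff:
  assumes "(a, b, c) \<in> carrier (unipotent_group m n R)" "(a', b', c') \<in> carrier (unipotent_group m n R)"
  shows "(a, b, c) \<otimes>\<^bsub>unipotent_group m n R\<^esub> (a', b', c') = (a', b', c') \<otimes>\<^bsub>unipotent_group m n R\<^esub> (a, b, c)
    \<longleftrightarrow> (\<forall>i\<in>{1..m}. \<forall>j\<in>{1..n}. a i \<otimes> b' j = a' i \<otimes> b j)"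
proof -
  have fun_mem: "a i \<in> carrier R" "a' i \<in> carrier R" if "i \<in> {1..m}" for i
    using assms that by (auto simp: carrier_unipotent_group PiE_iff)
  have fun_mem': "b i \<in> carrier R" "b' i \<in> carrier R" if "i \<in> {1..n}" for i
    using assms that by (auto simp: carrier_unipotent_group PiE_iff)
  have fun_mem'': "c p \<in> carrier R" "c' p \<in> carrier R" if "p \<in> {1..m} \<times> {1..n}" for p
    using assms that by (auto simp: carrier_unipotent_group PiE_iff)
  have 1: "(\<lambda>i\<in>{1..m}. a i \<oplus> a' i) = (\<lambda>i\<in>{1..m}. a' i \<oplus> a i)"
    by (rule restrict_ext) (simp add: fun_mem a_comm)
  have 2: "(\<lambda>i\<in>{1..n}. b i \<oplus> b' i) = (\<lambda>i\<in>{1..n}. b' i \<oplus> b i)"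
    by (rule restrict_ext) (simp add: fun_mem' a_comm)
  have 3: "c p \<oplus> c' p \<oplus> a (fst p) \<otimes> b' (snd p) = c' p \<oplus> c p \<oplus> a' (fst p) \<otimes> b (snd p) \<longleftrightarrow>
      a (fst p) \<otimes> b' (snd p) = a' (fst p) \<otimes> b (snd p)" if p: "p \<in> {1..m} \<times> {1..n}" for p
  proof -
    have fp: "fst p \<in> {1..m}" "snd p \<in> {1..n}" using p by auto
    show ?thesis
      unfolding a_comm[OF fun_mem''(2)[OF p] fun_mem''(1)[OF p]]
      using fun_mem[OF fp(1)] fun_mem'[OF fp(2)] fun_mem''[OF p] by (metis add.l_cancel a_closed m_closed)
  qed
  have "(\<lambda>p\<in>{1..m} \<times> {1..n}. c p \<oplus> c' p \<oplus> a (fst p) \<otimes> b' (snd p)) =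
      (\<lambda>p\<in>{1..m} \<times> {1..n}. c' p \<oplus> c p \<oplus> a' (fst p) \<otimes> b (snd p)) \<longleftrightarrow>
      (\<forall>p\<in>{1..m} \<times> {1..n}. c p \<oplus> c' p \<oplus> a (fst p) \<otimes> b' (snd p) = c' p \<oplus> c p \<oplus> a' (fst p) \<otimes> b (snd p))"
    by (rule restrict_eq_iff)
  also have "\<dots> \<longleftrightarrow> (\<forall>p\<in>{1..m} \<times> {1..n}. a (fst p) \<otimes> b' (snd p) = a' (fst p) \<otimes> b (snd p))"
    by (rule ball_cong[OF refl 3])
  finally show ?thesis unfolding mult_unipotent_group prod.inject 1 2 by simp
qed

text \<open>The class number times the group order counts commuting pairs. Both third coordinates
  are free and contribute a factor \<open>card (carrier R) ^ (m * n)\<close> each; one of these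
  cancels against the group order.\<close>

theorem num_conj_classes_unipotent_group:
  assumes fin: "finite (carrier R)"
  shows "num_conj_classes (unipotent_group m n R) * card (carrier R) ^ (m + n) =
    card (carrier R) ^ (m * n) * num_parallel m n R"
proof -
  let ?G = "unipotent_group m n R" and ?q = "card (carrier R)"
  interpret G: group ?G by (rule unipotent_group_is_group)
  let ?\<phi> = "\<lambda>g. \<lambda>h\<in>carrier ?G. g \<otimes>\<^bsub>?G\<^esub> h \<otimes>\<^bsub>?G\<^esub> inv\<^bsub>?G\<^esub> g"
  let ?A = "{1..m} \<rightarrow>\<^sub>E carrier R" and ?B = "{1..n} \<rightarrow>\<^sub>E carrier R"
    and ?C = "{1..m} \<times> {1..n} \<rightarrow>\<^sub>E carrier R"
  interpret act: group_action ?G "carrier ?G" ?\<phi> by (rule G.action_by_conjugation)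
  have finG: "finite (carrier ?G)"
    unfolding carrier_unipotent_group using fin by (intro finite_cartesian_product finite_PiE) auto
  have card_C: "card ?C = ?q ^ (m * n)" by (simp add: card_PiE)
  have order: "Coset.order ?G = ?q ^ (m + n) * ?q ^ (m * n)"
    unfolding Coset.order_def carrier_unipotent_group card_cartesian_product card_C
    by (simp add: card_PiE power_add)
  have inv: "card (invariants (carrier ?G) ?\<phi> (a, b, c)) = card (parallel_pairs m n R a b) * ?q ^ (m * n)"
    if g: "(a, b, c) \<in> carrier ?G" for a b c
  proof -
    have conj: "?\<phi> (a, b, c) h = h \<longleftrightarrow> (a, b, c) \<otimes>\<^bsub>?G\<^esub> h = h \<otimes>\<^bsub>?G\<^esub> (a, b, c)" if h: "h \<in> carrier ?G" for h
    proof -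
      have "(a, b, c) \<otimes>\<^bsub>?G\<^esub> h \<otimes>\<^bsub>?G\<^esub> inv\<^bsub>?G\<^esub> (a, b, c) = h \<longleftrightarrow> (a, b, c) \<otimes>\<^bsub>?G\<^esub> h = h \<otimes>\<^bsub>?G\<^esub> (a, b, c)"
        using g h by (metis G.inv_closed G.inv_solve_right G.m_closed)
      then show ?thesis using h by simp
    qed
    have "invariants (carrier ?G) ?\<phi> (a, b, c) = (\<lambda>((a', b'), c'). (a', b', c')) ` (parallel_pairs m n R a b \<times> ?C)"
    proof (intro equalityI subsetI)
      fix h assume h: "h \<in> invariants (carrier ?G) ?\<phi> (a, b, c)"
      obtain a' b' c' where eq: "h = (a', b', c')" by (metis prod_cases3)
      have hG: "(a', b', c') \<in> carrier ?G" using h by (simp add: invariants_def eq)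
      have "(a, b, c) \<otimes>\<^bsub>?G\<^esub> (a', b', c') = (a', b', c') \<otimes>\<^bsub>?G\<^esub> (a, b, c)"
        using conj[OF hG] h unfolding invariants_def eq by blast
      then have "\<forall>i\<in>{1..m}. \<forall>j\<in>{1..n}. a i \<otimes> b' j = a' i \<otimes> b j"
        using commute_unipotent_group_iff[OF g hG] by blast
      moreover have "a' \<in> ?A" "b' \<in> ?B" and C: "c' \<in> ?C"
        using hG unfolding carrier_unipotent_group mem_Sigma_iff by blast+
      ultimately have "(a', b') \<in> parallel_pairs m n R a b"
        unfolding mem_parallel_pairs by blast
      then show "h \<in> (\<lambda>((a', b'), c'). (a', b', c')) ` (parallel_pairs m n R a b \<times> ?C)"
        using C unfolding eq by (intro image_eqI[of _ _ "((a', b'), c')"]) simp_all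
    next
      fix h assume "h \<in> (\<lambda>((a', b'), c'). (a', b', c')) ` (parallel_pairs m n R a b \<times> ?C)"
      then obtain a' b' c' where eq: "h = (a', b', c')" and p: "(a', b') \<in> parallel_pairs m n R a b" "c' \<in> ?C"
        by (elim imageE SigmaE) (simp split: prod.splits)
      have hG: "(a', b', c') \<in> carrier ?G"
        using p unfolding mem_parallel_pairs carrier_unipotent_group mem_Sigma_iff by blast
      have "\<forall>i\<in>{1..m}. \<forall>j\<in>{1..n}. a i \<otimes> b' j = a' i \<otimes> b j"
        using p unfolding mem_parallel_pairs by blast
      then show "h \<in> invariants (carrier ?G) ?\<phi> (a, b, c)"
        using commute_unipotent_group_iff[OF g hG] conj[OF hG] hG unfolding invariants_def eq by blast
    qed
    moreover have "inj_on (\<lambda>((a', b'), c'). (a', b', c')) (parallel_pairs m n R a b \<times> ?C)"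
      by (auto simp: inj_on_def)
    ultimately show ?thesis by (simp only: card_image card_cartesian_product card_C)
  qed
  have "num_conj_classes ?G * Coset.order ?G = (\<Sum>g\<in>carrier ?G. card (invariants (carrier ?G) ?\<phi> g))"
    unfolding num_conj_classes_def by (rule act.burnside[OF finG finG])
  also have "\<dots> = (\<Sum>g\<in>?A \<times> ?B \<times> ?C. case g of (a, b, c) \<Rightarrow> card (parallel_pairs m n R a b) * ?q ^ (m * n))"
    unfolding carrier_unipotent_group[symmetric] by (rule sum.cong) (auto simp: inv)
  also have "\<dots> = (\<Sum>a\<in>?A. \<Sum>b\<in>?B. \<Sum>c\<in>?C. card (parallel_pairs m n R a b) * ?q ^ (m * n))"
    by (simp only: sum.cartesian_product)
  also have "\<dots> = (\<Sum>a\<in>?A. \<Sum>b\<in>?B. ?q ^ (m * n) * (card (parallel_pairs m n R a b) * ?q ^ (m * n)))"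
    by (simp only: sum_constant card_C of_nat_id)
  also have "\<dots> = ?q ^ (m * n) * num_parallel m n R * ?q ^ (m * n)"
    by (simp add: num_parallel_def sum_distrib_left sum_distrib_right mult.assoc)
  finally have "(num_conj_classes ?G * ?q ^ (m + n)) * ?q ^ (m * n) =
      (?q ^ (m * n) * num_parallel m n R) * ?q ^ (m * n)"
    unfolding order by (simp add: mult.assoc)
  moreover have "?q ^ (m * n) \<noteq> 0" using fin by (auto simp: card_eq_0_iff)
  ultimately show ?thesis by (metis mult_cancel2)
qed

end

definition parallel_quads ::
  "nat \<Rightarrow> nat \<Rightarrow> ('a, 'b) ring_scheme \<Rightarrow> ((nat \<Rightarrow> 'a) \<times> (nat \<Rightarrow> 'a) \<times> (nat \<Rightarrow> 'a) \<times> (nat \<Rightarrow> 'a)) set" where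
  "parallel_quads m n R = (SIGMA a:{1..m} \<rightarrow>\<^sub>E carrier R. SIGMA b:{1..n} \<rightarrow>\<^sub>E carrier R. parallel_pairs m n R a b)"

lemma num_parallel_eq_card:
  assumes fin: "finite (carrier R)" shows "num_parallel m n R = card (parallel_quads m n R)"
proof -
  have A: "finite ({1..m} \<rightarrow>\<^sub>E carrier R)" and B: "finite ({1..n} \<rightarrow>\<^sub>E carrier R)"
    using fin by (auto intro: finite_PiE)
  have P: "finite (parallel_pairs m n R a b)" for a b
    by (rule finite_subset[OF _ finite_cartesian_product[OF A B]]) (auto simp: parallel_pairs_def)
  show ?thesis
    unfolding num_parallel_def parallel_quads_def
    using A B P by (simp add: card_SigmaI)
qed

lemma parallel_quads_iff:
  "(a, b, a', b') \<in> parallel_quads m n R \<longleftrightarrow>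
     a \<in> {1..m} \<rightarrow>\<^sub>E carrier R \<and> b \<in> {1..n} \<rightarrow>\<^sub>E carrier R \<and> a' \<in> {1..m} \<rightarrow>\<^sub>E carrier R \<and> b' \<in> {1..n} \<rightarrow>\<^sub>E carrier R \<and>
     (\<forall>i\<in>{1..m}. \<forall>j\<in>{1..n}. a i \<otimes>\<^bsub>R\<^esub> b' j = a' i \<otimes>\<^bsub>R\<^esub> b j)"
  by (simp only: parallel_quads_def mem_Sigma_iff mem_parallel_pairs)

lemma parallel_quads_PiE:
  assumes "(a, b, a', b') \<in> parallel_quads m n R"
  shows "a \<in> {1..m} \<rightarrow>\<^sub>E carrier R" "b \<in> {1..n} \<rightarrow>\<^sub>E carrier R" "a' \<in> {1..m} \<rightarrow>\<^sub>E carrier R" "b' \<in> {1..n} \<rightarrow>\<^sub>E carrier R"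
    and parallel_quads_eq: "\<And>i j. i \<in> {1..m} \<Longrightarrow> j \<in> {1..n} \<Longrightarrow> a i \<otimes>\<^bsub>R\<^esub> b' j = a' i \<otimes>\<^bsub>R\<^esub> b j"
  using assms unfolding parallel_quads_iff by blast+

text \<open>The equations compare products only, so a multiplicative bijection applied entry by
  entry splits every quadruple of vectors into one over \<open>S\<close> and one over
  \<open>T\<close>.\<close>

lemma num_parallel_prod:
  assumes fin: "finite (carrier S)" "finite (carrier T)" and R: "cring R"
    and h: "bij_betw h (carrier R) (carrier S \<times> carrier T)"
    and hom: "\<And>x y. x \<in> carrier R \<Longrightarrow> y \<in> carrier R \<Longrightarrow>
      h (x \<otimes>\<^bsub>R\<^esub> y) = (fst (h x) \<otimes>\<^bsub>S\<^esub> fst (h y), snd (h x) \<otimes>\<^bsub>T\<^esub> snd (h y))"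
  shows "num_parallel m n R = num_parallel m n S * num_parallel m n T"
proof -
  interpret R: cring R by (rule R)
  define k where "k = inv_into (carrier R) h"
  have finR: "finite (carrier R)" using bij_betw_finite[OF h] fin by simp
  have kh: "k (h x) = x" if "x \<in> carrier R" for x
    using that h by (simp add: k_def bij_betw_def)
  have hk: "h (k y) = y" "k y \<in> carrier R" if "y \<in> carrier S \<times> carrier T" for y
    using that h by (auto simp: k_def bij_betw_def intro: f_inv_into_f inv_into_into)
  have hm: "fst (h x) \<in> carrier S" "snd (h x) \<in> carrier T" if "x \<in> carrier R" for x
  proof -
    have "h x \<in> carrier S \<times> carrier T" using bij_betwE[OF h] that by blast
    then show "fst (h x) \<in> carrier S" "snd (h x) \<in> carrier T" unfolding mem_Times_iff by blast+
  qed
  have h_eq: "x \<otimes>\<^bsub>R\<^esub> y = z \<otimes>\<^bsub>R\<^esub> w \<longleftrightarrow>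
      fst (h x) \<otimes>\<^bsub>S\<^esub> fst (h y) = fst (h z) \<otimes>\<^bsub>S\<^esub> fst (h w) \<and>
      snd (h x) \<otimes>\<^bsub>T\<^esub> snd (h y) = snd (h z) \<otimes>\<^bsub>T\<^esub> snd (h w)"
    if "x \<in> carrier R" "y \<in> carrier R" "z \<in> carrier R" "w \<in> carrier R" for x y z w
  proof -
    have "x \<otimes>\<^bsub>R\<^esub> y = z \<otimes>\<^bsub>R\<^esub> w \<longleftrightarrow> h (x \<otimes>\<^bsub>R\<^esub> y) = h (z \<otimes>\<^bsub>R\<^esub> w)"
      using kh[OF R.m_closed[OF that(1,2)]] kh[OF R.m_closed[OF that(3,4)]] by metis
    then show ?thesis unfolding hom[OF that(1,2)] hom[OF that(3,4)] prod.inject .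
  qed
  define f where "f = (\<lambda>(a, b, a', b').
    ((\<lambda>i\<in>{1..m}. fst (h (a i)), \<lambda>i\<in>{1..n}. fst (h (b i)), \<lambda>i\<in>{1..m}. fst (h (a' i)), \<lambda>i\<in>{1..n}. fst (h (b' i))),
     (\<lambda>i\<in>{1..m}. snd (h (a i)), \<lambda>i\<in>{1..n}. snd (h (b i)), \<lambda>i\<in>{1..m}. snd (h (a' i)), \<lambda>i\<in>{1..n}. snd (h (b' i)))))"
  define g where "g = (\<lambda>((a, b, a', b'), (c, d, c', d')).
    (\<lambda>i\<in>{1..m}. k (a i, c i), \<lambda>i\<in>{1..n}. k (b i, d i), \<lambda>i\<in>{1..m}. k (a' i, c' i), \<lambda>i\<in>{1..n}. k (b' i, d' i)))"
  have rest: "(\<lambda>i\<in>{1..l}. k (fst (h (a i)), snd (h (a i)))) = a" if "a \<in> {1..l} \<rightarrow>\<^sub>E carrier R" for l :: nat and a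
  proof -
    have "k (fst (h (a i)), snd (h (a i))) = a i" if "i \<in> {1..l}" for i
      using kh[OF PiE_mem[OF \<open>a \<in> _\<close> that]] by simp
    then show ?thesis using that by (auto simp: fun_eq_iff PiE_iff extensional_def restrict_def)
  qed
  have rest1: "(\<lambda>i\<in>{1..l}. fst (h (k (a i, c i)))) = a"
    and rest2: "(\<lambda>i\<in>{1..l}. snd (h (k (a i, c i)))) = c"
    if ac: "a \<in> {1..l} \<rightarrow>\<^sub>E carrier S" "c \<in> {1..l} \<rightarrow>\<^sub>E carrier T" for l :: nat and a c
  proof -
    have *: "h (k (a i, c i)) = (a i, c i)" if "i \<in> {1..l}" for i
      using that ac hk by (auto simp: PiE_iff)
    show "(\<lambda>i\<in>{1..l}. fst (h (k (a i, c i)))) = a" "(\<lambda>i\<in>{1..l}. snd (h (k (a i, c i)))) = c"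
      using ac * by (auto simp: fun_eq_iff PiE_iff extensional_def restrict_def)
  qed
  have "bij_betw f (parallel_quads m n R) (parallel_quads m n S \<times> parallel_quads m n T)"
  proof (rule bij_betw_byWitness[of _ g])
    show "\<forall>x\<in>parallel_quads m n R. g (f x) = x"
    proof
      fix x assume x: "x \<in> parallel_quads m n R"
      obtain a b a' b' where eq: "x = (a, b, a', b')" by (metis prod_cases4)
      note P = parallel_quads_PiE[OF x[unfolded eq]]
      show "g (f x) = x"
        unfolding eq f_def g_def using rest[OF P(1)] rest[OF P(2)] rest[OF P(3)] rest[OF P(4)]
        by (simp cong: restrict_cong)
    qed
    show "\<forall>y\<in>parallel_quads m n S \<times> parallel_quads m n T. f (g y) = y"
    proof
      fix y assume y: "y \<in> parallel_quads m n S \<times> parallel_quads m n T"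
      obtain a b a' b' c d c' d' where eq: "y = ((a, b, a', b'), (c, d, c', d'))" by (metis prod.exhaust)
      have y1: "(a, b, a', b') \<in> parallel_quads m n S" and y2: "(c, d, c', d') \<in> parallel_quads m n T"
        using y unfolding eq by blast+
      note P = parallel_quads_PiE[OF y1] and Q = parallel_quads_PiE[OF y2]
      show "f (g y) = y"
        unfolding eq f_def g_def
        using rest1[OF P(1) Q(1)] rest1[OF P(2) Q(2)] rest1[OF P(3) Q(3)] rest1[OF P(4) Q(4)]
          rest2[OF P(1) Q(1)] rest2[OF P(2) Q(2)] rest2[OF P(3) Q(3)] rest2[OF P(4) Q(4)]
        by (simp cong: restrict_cong)
    qed
    show "f ` parallel_quads m n R \<subseteq> parallel_quads m n S \<times> parallel_quads m n T"
    proof (rule image_subsetI)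
      fix x assume x: "x \<in> parallel_quads m n R"
      obtain a b a' b' where eq: "x = (a, b, a', b')" by (metis prod_cases4)
      note P = parallel_quads_PiE[OF x[unfolded eq]]
      have "fst (h (a i)) \<otimes>\<^bsub>S\<^esub> fst (h (b' j)) = fst (h (a' i)) \<otimes>\<^bsub>S\<^esub> fst (h (b j)) \<and>
        snd (h (a i)) \<otimes>\<^bsub>T\<^esub> snd (h (b' j)) = snd (h (a' i)) \<otimes>\<^bsub>T\<^esub> snd (h (b j))"
        if ij: "i \<in> {1..m}" "j \<in> {1..n}" for i j
        using h_eq[OF PiE_mem[OF P(1) ij(1)] PiE_mem[OF P(4) ij(2)] PiE_mem[OF P(3) ij(1)] PiE_mem[OF P(2) ij(2)]]
          parallel_quads_eq[OF x[unfolded eq] ij] by (rule iffD1)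
      moreover have "(\<lambda>i\<in>{1..l}. fst (h (u i))) \<in> {1..l} \<rightarrow>\<^sub>E carrier S"
        "(\<lambda>i\<in>{1..l}. snd (h (u i))) \<in> {1..l} \<rightarrow>\<^sub>E carrier T"
        if "u \<in> {1..l} \<rightarrow>\<^sub>E carrier R" for u and l :: nat
        using PiE_mem[OF that] hm by auto
      ultimately show "f x \<in> parallel_quads m n S \<times> parallel_quads m n T"
        unfolding eq f_def prod.case mem_Times_iff fst_conv snd_conv parallel_quads_iff using P by simp
    qed
    show "g ` (parallel_quads m n S \<times> parallel_quads m n T) \<subseteq> parallel_quads m n R"
    proof (rule image_subsetI)
      fix y assume y: "y \<in> parallel_quads m n S \<times> parallel_quads m n T"
      obtain a b a' b' c d c' d' where eq: "y = ((a, b, a', b'), (c, d, c', d'))" by (metis prod.exhaust)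
      have y1: "(a, b, a', b') \<in> parallel_quads m n S" and y2: "(c, d, c', d') \<in> parallel_quads m n T"
        using y unfolding eq by blast+
      note P = parallel_quads_PiE[OF y1] and Q = parallel_quads_PiE[OF y2]
      have ST: "(u i, v i) \<in> carrier S \<times> carrier T"
        if "u \<in> {1..l} \<rightarrow>\<^sub>E carrier S" "v \<in> {1..l} \<rightarrow>\<^sub>E carrier T" "i \<in> {1..l}" for u v i and l :: nat
        using PiE_mem[OF that(1,3)] PiE_mem[OF that(2,3)] by simp
      have "k (a i, c i) \<otimes>\<^bsub>R\<^esub> k (b' j, d' j) = k (a' i, c' i) \<otimes>\<^bsub>R\<^esub> k (b j, d j)"
        if ij: "i \<in> {1..m}" "j \<in> {1..n}" for i j
      proof -
        note A = ST[OF P(1) Q(1) ij(1)] and B = ST[OF P(2) Q(2) ij(2)]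
          and A' = ST[OF P(3) Q(3) ij(1)] and B' = ST[OF P(4) Q(4) ij(2)]
        show ?thesis
          unfolding h_eq[OF hk(2)[OF A] hk(2)[OF B'] hk(2)[OF A'] hk(2)[OF B]]
            hk(1)[OF A] hk(1)[OF A'] hk(1)[OF B] hk(1)[OF B'] fst_conv snd_conv
          using parallel_quads_eq[OF y1 ij] parallel_quads_eq[OF y2 ij] by blast
      qed
      moreover have "(\<lambda>i\<in>{1..l}. k (u i, v i)) \<in> {1..l} \<rightarrow>\<^sub>E carrier R"
        if "u \<in> {1..l} \<rightarrow>\<^sub>E carrier S" "v \<in> {1..l} \<rightarrow>\<^sub>E carrier T" for u v and l :: nat
        using hk(2)[OF ST[OF that]] by auto
      ultimately show "g y \<in> parallel_quads m n R"
        unfolding eq g_def prod.case parallel_quads_iff using P Q by simp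
    qed
  qed
  from bij_betw_same_card[OF this] show ?thesis
    using fin finR by (simp add: num_parallel_eq_card card_cartesian_product)
qed

section \<open>Rings of integers\<close>

interpretation rat_span: vector_space "\<lambda>q (v::'a::field_char_0). of_rat q * v"
  by unfold_locales (auto simp: algebra_simps of_rat_add of_rat_mult)

lemma a_inv_ring_of_type_algebra: "\<ominus>\<^bsub>ring_of_type_algebra\<^esub> x = - (x :: 'a::field)"
proof -
  interpret ring "ring_of_type_algebra :: 'a ring" by (rule ring_from_type_algebra)
  have "- x \<oplus>\<^bsub>ring_of_type_algebra\<^esub> x = \<zero>\<^bsub>ring_of_type_algebra\<^esub>"
    by (simp add: ring_of_type_algebra_def)
  then show ?thesis by (intro minus_equality) (simp_all add: ring_of_type_algebra_def)
qed

lemma m_inv_ring_of_type_algebra: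
  assumes "x \<noteq> (0 :: 'a::field)" shows "inv\<^bsub>ring_of_type_algebra\<^esub> x = inverse x"
proof -
  interpret cring "ring_of_type_algebra :: 'a ring" by (rule cring_from_type_algebra)
  show ?thesis
    by (rule comm_inv_char) (use assms in \<open>simp_all add: ring_of_type_algebra_def\<close>)
qed

lemma number_field_closed:
  assumes "number_field (K :: 'a::field_char_0 set)"
  shows "0 \<in> K" "1 \<in> K" "\<And>x y. x \<in> K \<Longrightarrow> y \<in> K \<Longrightarrow> x - y \<in> K"
    "\<And>x y. x \<in> K \<Longrightarrow> y \<in> K \<Longrightarrow> x * y \<in> K" "\<And>x y. x \<in> K \<Longrightarrow> y \<in> K \<Longrightarrow> x / y \<in> K"
proof -
  interpret field "ring_of_type_algebra :: 'a ring" by (rule field_from_type_algebra)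
  have K: "subfield K (ring_of_type_algebra :: 'a ring)" using assms by (simp add: number_field_def)
  have sr: "subring K (ring_of_type_algebra :: 'a ring)" using subfieldE(1)[OF K] subcring.axioms(1) by blast
  note simps = ring_of_type_algebra_def
  show z: "0 \<in> K" using subringE(2)[OF sr] by (simp add: simps)
  show "1 \<in> K" using subringE(3)[OF sr] by (simp add: simps)
  have um: "- x \<in> K" if "x \<in> K" for x using subringE(5)[OF sr that] by (simp add: a_inv_ring_of_type_algebra)
  have add: "x + y \<in> K" if "x \<in> K" "y \<in> K" for x y using subringE(7)[OF sr that] by (simp add: simps)
  show "x - y \<in> K" if "x \<in> K" "y \<in> K" for x y using add[OF that(1) um[OF that(2)]] by simp
  show mult: "x * y \<in> K" if "x \<in> K" "y \<in> K" for x y using subringE(6)[OF sr that] by (simp add: simps)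
  show "x / y \<in> K" if "x \<in> K" "y \<in> K" for x y
  proof (cases "y = 0")
    case False
    then have "inv\<^bsub>ring_of_type_algebra\<^esub> y \<in> K"
      using subfield_m_inv(1)[OF K, of y] that by (simp add: simps)
    then show ?thesis using mult[OF that(1)] False by (simp add: m_inv_ring_of_type_algebra divide_inverse)
  qed (simp add: z)
qed

text \<open>The inductive \<open>dimension\<close> adds one vector per line extension. The size of
  the spanning set becomes the exponent in all index bounds.\<close>

lemma number_field_finite_span:
  assumes "number_field (K :: 'a::field_char_0 set)"
  obtains B where "finite B" "K \<subseteq> rat_span.span B"
proof -
  interpret field "ring_of_type_algebra :: 'a ring" by (rule field_from_type_algebra)
  obtain n where "dimension n \<rat> K" using assms by (auto simp: number_field_def finite_dimension_def)
  then have "\<exists>B. finite B \<and> K \<subseteq> rat_span.span B"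
  proof (induction n "\<rat> :: 'a set" K rule: dimension.induct)
    case zero_dim
    then show ?case by (intro exI[of _ "{}"]) (simp add: ring_of_type_algebra_def)
  next
    case (Suc_dim v E n)
    then obtain B where B: "finite B" "E \<subseteq> rat_span.span B" by blast
    have "line_extension \<rat> v E \<subseteq> rat_span.span (insert v B)"
    proof
      fix x assume "x \<in> line_extension \<rat> v E"
      then obtain q e where "q \<in> \<rat>" "e \<in> E" "x = q * v + e"
        unfolding line_extension_mem_iff by (auto simp: ring_of_type_algebra_def)
      then obtain r where r: "x = of_rat r * v + e" by (auto elim: Rats_cases)
      have e: "e \<in> rat_span.span (insert v B)"
        using \<open>e \<in> E\<close> B(2) rat_span.span_mono[of B "insert v B"] by blast
      then show "x \<in> rat_span.span (insert v B)"
        unfolding r by (intro rat_span.span_add[OF _ e] rat_span.span_scale rat_span.span_base) simp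
    qed
    then show ?case using B(1) by (intro exI[of _ "insert v B"]) auto
  qed
  then show thesis using that by blast
qed

definition algints :: "'a::field_char_0 set \<Rightarrow> 'a set" where
  "algints K = {x \<in> K. algebraic_int x}"

text \<open>A rational relation cleared of denominators is an integer relation. Dividing it by
  \<open>p\<close> leaves a relation of the same kind, so its coefficients are divisible by all
  powers of \<open>p\<close> and must vanish.\<close>

lemma int_relation_trivial:
  fixes S :: "'a::field_char_0 set"
  assumes S: "finite S" and p: "p \<ge> 2"
    and indep: "\<And>c. (\<Sum>b\<in>S. of_int (c b) * b) = 0 \<Longrightarrow> \<forall>b\<in>S. int p dvd c b"
  shows "\<not> rat_span.dependent S"
proof
  assume "rat_span.dependent S"
  then obtain u v where u: "v \<in> S" "u v \<noteq> 0" "(\<Sum>b\<in>S. of_rat (u b) * b) = 0"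
    using rat_span.dependent_finite[OF S] by blast
  have "\<exists>D::int. D > 0 \<and> (\<forall>b\<in>S. of_int D * u b \<in> \<int>)"
    using S
  proof (induction S)
    case (insert x S)
    then obtain D where D: "D > 0" "\<forall>b\<in>S. of_int D * u b \<in> \<int>" by blast
    obtain a b where ab: "b > 0" "u x = of_int a / of_int b"
      by (metis Fract_of_int_quotient Rat_cases)
    have "of_int (D * b) * u y \<in> \<int>" if "y \<in> insert x S" for y
    proof (cases "y = x")
      case True
      then have "of_int (D * b) * u y = of_int (D * a)" using ab by simp
      then show ?thesis by (metis Ints_of_int)
    next
      case False
      then have "of_int D * u y \<in> \<int>" using D(2) that by blast
      moreover have "of_int (D * b) * u y = of_int b * (of_int D * u y)" by simp
      ultimately show ?thesis by (simp only: Ints_mult Ints_of_int)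
    qed
    then show ?case using D ab by (intro exI[of _ "D * b"]) auto
  qed (auto intro: exI[of _ 1])
  then obtain D :: int where D: "D > 0" "\<forall>b\<in>S. of_int D * u b \<in> \<int>" by blast
  then have "\<forall>b\<in>S. \<exists>c. of_int D * u b = of_int c" by (auto elim!: Ints_cases)
  then obtain c where c: "\<And>b. b \<in> S \<Longrightarrow> of_int D * u b = of_int (c b)" by metis
  have c': "of_int (c b) = of_int D * (of_rat (u b) :: 'a)" if "b \<in> S" for b
    using c[OF that] by (metis of_rat_mult of_rat_of_int_eq)
  have rel: "(\<Sum>b\<in>S. of_int (c b) * b) = 0"
  proof -
    have "(\<Sum>b\<in>S. of_int (c b) * b) = (\<Sum>b\<in>S. of_int D * (of_rat (u b) * b))"
      by (rule sum.cong) (simp_all add: c' mult.assoc)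
    then show ?thesis using u(3) by (simp flip: sum_distrib_left)
  qed
  have "c v \<noteq> 0" using c[OF u(1)] u(2) D(1) by auto
  have "\<forall>b\<in>S. int p ^ n dvd c b" if "(\<Sum>b\<in>S. of_int (c b) * b) = 0" for n c
    using that
  proof (induction n arbitrary: c)
    case (Suc n)
    define d where "d b = c b div int p" for b
    have d: "c b = int p * d b" if "b \<in> S" for b
      using indep[OF Suc.prems] that by (simp add: d_def)
    have "(\<Sum>b\<in>S. of_int (c b) * b) = of_nat p * (\<Sum>b\<in>S. of_int (d b) * b)"
      unfolding sum_distrib_left by (rule sum.cong) (simp_all add: d mult.assoc)
    then have "(\<Sum>b\<in>S. of_int (d b) * b) = 0" using Suc.prems p by simp
    then have "\<forall>b\<in>S. int p ^ n dvd d b" by (rule Suc.IH)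
    then show ?case using d by (simp add: mult_dvd_mono)
  qed simp
  then have dvd: "int p ^ n dvd c v" for n using rel u(1) by blast
  \<comment> \<open>Any exponent with \<open>p ^ n\<close> above the absolute value of
    \<open>c v\<close> contradicts divisibility; that absolute value itself will do, since
    \<open>n < 2 ^ n\<close>.\<close>
  define n where "n = nat \<bar>c v\<bar>"
  have "\<bar>c v\<bar> < int p ^ n"
  proof -
    have "n < p ^ n" by (rule less_le_trans[OF less_exp power_mono]) (use p in auto)
    then have "int n < int p ^ n" by (metis of_nat_less_iff of_nat_power)
    then show ?thesis by (simp add: n_def)
  qed
  then show False using dvd_imp_le_int[OF \<open>c v \<noteq> 0\<close> dvd[of n]] by simp
qed

lemma algebraic_int_diff:
  "algebraic_int x \<Longrightarrow> algebraic_int y \<Longrightarrow> algebraic_int (x - y)" for x y :: "'a::field_char_0"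
  using algebraic_int_add[of x "- y"] by simp

locale nfield =
  fixes K :: "'a::field_char_0 set"
  assumes K: "number_field K"
begin

abbreviation "AI \<equiv> algints K"

sublocale field_subring "algints K"
  using number_field_closed[OF K]
  by unfold_locales (auto simp: algints_def algebraic_int_diff algebraic_int_mult)

lemma O_of_nat: "of_nat k \<in> AI"
  by (induction k) (simp_all add: mem)

lemma O_of_int: "of_int k \<in> AI"
  by (cases k rule: int_cases2) (simp_all add: O_of_nat uminus_mem)

lemmas principal_subgroup = idl_subgroup[OF idl_principal]

text \<open>Elements independent modulo \<open>p\<close> are independent over the rationals by
  \<open>int_relation_trivial\<close>, so there are at most \<open>card B\<close> of them. A largest
  such set represents every class with coefficients below \<open>p\<close>.\<close>

lemma prime_quotient_bound:
  assumes B: "finite B" "K \<subseteq> rat_span.span B" and p: "prime p"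
  shows "finite (cosets AI ((*) (of_nat p) ` AI)) \<and> add_index AI ((*) (of_nat p) ` AI) \<le> p ^ card B"
proof -
  define pO where "pO = (*) (of_nat p) ` AI"
  have sg: "add_subgroup pO" unfolding pO_def by (rule principal_subgroup[OF O_of_nat])
  have p2: "p \<ge> 2" using p prime_ge_2_nat by blast
  have p_mult: "of_int c * x \<in> pO" if c: "int p dvd c" and x: "x \<in> AI" for c x
  proof -
    obtain d where "c = int p * d" using c by blast
    then have eq: "of_int c * x = of_nat p * (of_int d * x)" by (simp add: mult.assoc)
    show ?thesis unfolding pO_def using mult_mem[OF O_of_int x, of d] by (intro image_eqI[where x = "of_int d * x"]) (simp_all only: eq)
  qed
  \<comment> \<open>linear independence modulo \<open>p\<close>; a maximal independent set generates \<open>AI\<close> modulo \<open>p\<close>\<close>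
  define ind where "ind S \<longleftrightarrow> finite S \<and> S \<subseteq> AI \<and>
    (\<forall>c. (\<Sum>b\<in>S. of_int (c b) * b) \<in> pO \<longrightarrow> (\<forall>b\<in>S. int p dvd c b))" for S
  have bound: "card S \<le> card B" if "ind S" for S
  proof -
    have S: "finite S" "S \<subseteq> AI" using that by (auto simp: ind_def)
    have "\<not> rat_span.dependent S"
      by (rule int_relation_trivial[OF S(1) p2]) (use that add_subgroup_zero[OF sg] in \<open>auto simp: ind_def\<close>)
    moreover have "S \<subseteq> rat_span.span B" using S(2) B(2) by (auto simp: algints_def)
    ultimately show ?thesis using rat_span.independent_span_bound[OF B(1)] by blast
  qed
  have "ind {}" by (simp add: ind_def)
  then obtain S where S: "ind S" "\<And>T. ind T \<Longrightarrow> card T \<le> card S"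
    using ex_has_greatest_nat[of ind "{}" card "Suc (card B)"] bound by (auto simp: less_Suc_eq_le)
  have Sfin: "finite S" and SO: "S \<subseteq> AI" using S(1) by (auto simp: ind_def)
  have repr: "\<exists>r. x - (\<Sum>b\<in>S. of_int (r b) * b) \<in> pO" if x: "x \<in> AI" for x
  proof (cases "x \<in> S")
    case True
    have "(\<Sum>b\<in>S. of_int (if b = x then 1 else 0) * b) = (\<Sum>b\<in>S. if b = x then x else 0)"
      by (rule sum.cong) auto
    also have "\<dots> = x" using True Sfin by simp
    finally show ?thesis using add_subgroup_zero[OF sg] by (intro exI[of _ "\<lambda>b. if b = x then 1 else 0"]) simp
  next
    case False
    have "\<not> ind (insert x S)" using S(2)[of "insert x S"] False Sfin by auto
    then obtain c where c: "(\<Sum>b\<in>insert x S. of_int (c b) * b) \<in> pO" "\<not> (\<forall>b\<in>insert x S. int p dvd c b)"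
      using Sfin SO x by (auto simp: ind_def)
    have c1: "of_int (c x) * x + (\<Sum>b\<in>S. of_int (c b) * b) \<in> pO" using c(1) False Sfin by simp
    have "\<not> int p dvd c x"
    proof
      assume dvd: "int p dvd c x"
      have "(\<Sum>b\<in>S. of_int (c b) * b) \<in> pO"
        using add_subgroup_diff[OF sg c1 p_mult[OF dvd x]] by simp
      then have "\<forall>b\<in>S. int p dvd c b" using S(1) by (auto simp: ind_def)
      then show False using c(2) dvd by blast
    qed
    \<comment> \<open>The coefficient of \<open>x\<close> is invertible modulo \<open>p\<close>,
      with inverse \<open>e\<close>, so the relation can be solved for \<open>x\<close>.\<close>
    then have "coprime (int p) (c x)" using p by (simp add: prime_imp_coprime)
    then have "gcd (c x) (int p) = 1" by (simp add: coprime_iff_gcd_eq_1 gcd.commute)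
    then obtain e v where "e * c x + v * int p = 1" using bezout_int[of "c x" "int p"] by metis
    then have "1 - c x * e = int p * v" by (simp add: algebra_simps)
    then have e: "int p dvd 1 - c x * e" by simp
    have "x - (\<Sum>b\<in>S. of_int (- (e * c b)) * b) =
        of_int (1 - c x * e) * x + of_int e * (of_int (c x) * x + (\<Sum>b\<in>S. of_int (c b) * b))"
      by (simp add: algebra_simps sum_distrib_left sum_negf)
    also have "\<dots> \<in> pO"
      using p_mult[OF e x] idl_mult[OF idl_principal[OF O_of_nat] O_of_int] c1 add_subgroup_add[OF sg]
      unfolding pO_def by blast
    finally show ?thesis by (rule exI[of _ "\<lambda>b. - (e * c b)"])
  qed
  define V where "V r = (+) (\<Sum>b\<in>S. of_int (r b) * b) ` pO" for r
  have "cosets AI pO \<subseteq> V ` (S \<rightarrow>\<^sub>E {0..<int p})"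
  proof
    fix Z assume "Z \<in> cosets AI pO"
    then obtain x where x: "x \<in> AI" "Z = (+) x ` pO" by (auto simp: cosets_def)
    obtain r where r: "x - (\<Sum>b\<in>S. of_int (r b) * b) \<in> pO" using repr[OF x(1)] by blast
    define t where "t = (\<lambda>b\<in>S. r b mod int p)"
    have sum_mem: "(\<Sum>b\<in>S. of_int (r b - t b) * b) \<in> pO"
    proof -
      have "(\<Sum>b\<in>T. of_int (r b - t b) * b) \<in> pO" if "T \<subseteq> S" for T
        using finite_subset[OF that Sfin] that
      proof (induction T)
        case (insert b T)
        have "int p dvd r b - t b" using insert.prems by (simp add: t_def)
        then have "of_int (r b - t b) * b \<in> pO" using p_mult insert.prems SO by blast
        then show ?case using insert add_subgroup_add[OF sg] by simp
      qed (simp add: add_subgroup_zero[OF sg])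
      then show ?thesis by blast
    qed
    have "x - (\<Sum>b\<in>S. of_int (t b) * b) =
        (x - (\<Sum>b\<in>S. of_int (r b) * b)) + (\<Sum>b\<in>S. of_int (r b - t b) * b)"
      by (simp add: algebra_simps sum_subtractf)
    also have "\<dots> \<in> pO" by (rule add_subgroup_add[OF sg r sum_mem])
    finally have "Z = V t" unfolding x(2) V_def coset_eq_iff[OF sg] .
    moreover have "t \<in> S \<rightarrow>\<^sub>E {0..<int p}" using p2 by (auto simp: t_def)
    ultimately show "Z \<in> V ` (S \<rightarrow>\<^sub>E {0..<int p})" by blast
  qed
  note sub = this
  have fin: "finite (S \<rightarrow>\<^sub>E {0..<int p})" by (rule finite_PiE[OF Sfin]) simp
  have "finite (cosets AI pO)" by (rule finite_surj[OF fin sub])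
  moreover have "card (cosets AI pO) \<le> card (S \<rightarrow>\<^sub>E {0..<int p})" by (rule surj_card_le[OF fin sub])
  moreover have "card (S \<rightarrow>\<^sub>E {0..<int p}) = p ^ card S" using Sfin by (simp add: card_PiE)
  moreover have "p ^ card S \<le> p ^ card B" using bound[OF S(1)] p2 by (intro power_increasing) auto
  ultimately show ?thesis by (simp add: add_index_def pO_def)
qed

text \<open>Multiplication by \<open>a\<close> identifies the quotient of \<open>AI\<close> by
  \<open>b\<close> with the quotient of the ideal of \<open>a\<close> by the ideal of
  \<open>a * b\<close>; indices multiply along the tower.\<close>

lemma principal_tower:
  assumes "a \<in> AI" "b \<in> AI" "a \<noteq> 0" "finite (cosets AI ((*) a ` AI))" "finite (cosets AI ((*) b ` AI))"
  shows "finite (cosets AI ((*) (a * b) ` AI)) \<and>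
    add_index AI ((*) (a * b) ` AI) = add_index AI ((*) a ` AI) * add_index AI ((*) b ` AI)"
proof -
  have ab: "a * b \<in> AI" using mult_mem assms by blast
  have iff: "a * x - a * y \<in> (*) (a * b) ` AI \<longleftrightarrow> x - y \<in> (*) b ` AI" for x y
    using \<open>a \<noteq> 0\<close> by (auto simp: image_iff mult.assoc simp flip: right_diff_distrib)
  have surj: "\<exists>x\<in>AI. z - a * x \<in> (*) (a * b) ` AI" if "z \<in> (*) a ` AI" for z
    using that add_subgroup_zero[OF principal_subgroup[OF ab]] by force
  note transfer = principal_subgroup[OF assms(2)] principal_subgroup[OF ab] imageI[of _ AI "(*) a"] iff surj
  have fin: "finite (cosets ((*) a ` AI) ((*) (a * b) ` AI))"
    using finite_cosets_iffI[OF transfer] assms(5) by blast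
  have idx: "add_index AI ((*) b ` AI) = add_index ((*) a ` AI) ((*) (a * b) ` AI)"
    using add_index_eqI[OF transfer] by blast
  have sub: "(*) (a * b) ` AI \<subseteq> (*) a ` AI" "(*) a ` AI \<subseteq> AI"
    using mult_mem assms by (auto simp: mult.assoc)
  show ?thesis
    using add_index_tower[OF add_subgroup_A principal_subgroup[OF assms(1)] principal_subgroup[OF ab] sub assms(4) fin]
      finite_cosets_tower[OF add_subgroup_A principal_subgroup[OF assms(1)] principal_subgroup[OF ab] sub assms(4) fin] idx
    by simp
qed

text \<open>The bound is multiplicative in \<open>N\<close>, so prime factors can be split off one
  at a time with \<open>principal_tower\<close>.\<close>

lemma nat_quotient_bound:
  assumes B: "finite B" "K \<subseteq> rat_span.span B"
  shows "N > 0 \<Longrightarrow> finite (cosets AI ((*) (of_nat N) ` AI)) \<and> add_index AI ((*) (of_nat N) ` AI) \<le> N ^ card B"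
proof (induction N rule: less_induct)
  case (less N)
  show ?case
  proof (cases "N = 1")
    case True
    then show ?thesis by (simp add: add_index_self[OF add_subgroup_A] cosets_self[OF add_subgroup_A])
  next
    case False
    then obtain p where p: "prime p" "p dvd N" using prime_factor_nat by blast
    then obtain M where M: "N = p * M" by blast
    have "M < N" "M > 0" using less.prems p(1) prime_gt_1_nat by (auto simp: M)
    then have IH: "finite (cosets AI ((*) (of_nat M) ` AI))" "add_index AI ((*) (of_nat M) ` AI) \<le> M ^ card B"
      using less.IH by blast+
    note P = prime_quotient_bound[OF B p(1)]
    have "of_nat p \<noteq> (0 :: 'a)" using p(1) by auto
    from principal_tower[OF O_of_nat O_of_nat this conjunct1[OF P] IH(1)]
    show ?thesis using mult_le_mono[OF conjunct2[OF P] IH(2)] by (simp add: M power_mult_distrib)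
  qed
qed

text \<open>In a shortest monic integer relation for \<open>a\<close> the constant coefficient is
  non-zero, since otherwise \<open>a\<close> could be cancelled. That coefficient is a multiple of
  \<open>a\<close> and up to sign the required \<open>N\<close>.\<close>

lemma nat_multiple:
  assumes a: "a \<in> AI" "a \<noteq> 0"
  obtains N where "N > 0" "of_nat N \<in> (*) a ` AI"
proof -
  define rel where "rel n \<longleftrightarrow> (\<exists>c. a ^ n = (\<Sum>i<n. of_int (c i) * a ^ i))" for n
  have "\<exists>n. rel n" using algebraic_int_power_reduce[of a] a(1) unfolding rel_def algints_def by blast
  then obtain n where n: "rel n" "\<And>k. rel k \<Longrightarrow> n \<le> k" using exists_least_iff[of rel] by (metis not_less)
  obtain c where c: "a ^ n = (\<Sum>i<n. of_int (c i) * a ^ i)" using n(1) by (auto simp: rel_def)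
  have "n \<noteq> 0"
  proof
    assume "n = 0"
    with c show False by simp
  qed
  then obtain k where k: "n = Suc k" by (cases n) auto
  define r where "r = (\<Sum>i<k. of_int (c (Suc i)) * a ^ i)"
  have eq: "a * a ^ k = of_int (c 0) + a * r"
    using c unfolding k r_def by (subst (asm) sum.lessThan_Suc_shift) (simp add: sum_distrib_left mult_ac)
  have "c 0 \<noteq> 0"
  proof
    assume "c 0 = 0"
    then have "a ^ k = r" using eq a(2) by simp
    then have "rel k" unfolding rel_def r_def by (intro exI[of _ "\<lambda>i. c (Suc i)"])
    then show False using n(2)[of k] k by simp
  qed
  have "r \<in> AI" unfolding r_def by (intro sum_mem mult_mem O_of_int power_mem a(1))
  have *: "of_int (c 0) = a * (a ^ k - r)" using eq by (simp add: algebra_simps)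
  have "of_nat (nat \<bar>c 0\<bar>) \<in> (*) a ` AI"
  proof (cases "c 0 \<ge> 0")
    case True
    then have "of_nat (nat \<bar>c 0\<bar>) = a * (a ^ k - r)" using * by simp
    then show ?thesis using diff_mem[OF power_mem[OF a(1)] \<open>r \<in> AI\<close>] by blast
  next
    case False
    then have "of_nat (nat \<bar>c 0\<bar>) = a * (r - a ^ k)" using * by (simp add: algebra_simps)
    then show ?thesis using diff_mem[OF \<open>r \<in> AI\<close> power_mem[OF a(1)]] by blast
  qed
  then show thesis using that[of "nat \<bar>c 0\<bar>"] \<open>c 0 \<noteq> 0\<close> by simp
qed

lemma finite_principal_quotient:
  assumes a: "a \<in> AI" "a \<noteq> 0" shows "finite (cosets AI ((*) a ` AI))"
proof -
  obtain N where N: "N > 0" "of_nat N \<in> (*) a ` AI" using nat_multiple[OF a] .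
  obtain B where B: "finite B" "K \<subseteq> rat_span.span B" using number_field_finite_span[OF K] .
  have "(*) (of_nat N) ` AI \<subseteq> (*) a ` AI"
    by (rule principal_subset[OF idl_principal[OF a(1)] N(2)])
  from finite_cosets_mono[OF principal_subgroup[OF a(1)] principal_subgroup[OF O_of_nat] this]
  show ?thesis using nat_quotient_bound[OF B N(1)] by blast
qed

lemma completely_closed:
  assumes xy: "x \<in> AI" "y \<in> AI" "y \<noteq> 0" and pow: "\<And>k::nat. y * (x / y) ^ k \<in> AI"
  shows "x / y \<in> AI"
proof -
  \<comment> \<open>By the pigeonhole principle, \<open>z^j - z^i \<in> AI\<close> for some \<open>i < j\<close>, so \<open>z\<close> is integral over \<open>AI\<close>.\<close>
  define z where "z = x / y"
  have "z \<in> K" using number_field_closed(5)[OF K] xy by (auto simp: z_def algints_def)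
  have powz: "y * z ^ k \<in> AI" for k :: nat using pow[of k] by (simp add: z_def)
  obtain i j where ij: "i < j" "y * z ^ j - y * z ^ i \<in> (*) y ` AI"
    by (rule pigeonhole_cosets[OF finite_principal_quotient[OF xy(2,3)] principal_subgroup[OF xy(2)] powz])
  then obtain w where w: "w \<in> AI" "y * z ^ j - y * z ^ i = y * w" by blast
  then have "y * (z ^ j - z ^ i) = y * w" by (simp only: right_diff_distrib)
  then have zw: "z ^ j - z ^ i = w" using xy(3) by (simp only: mult_cancel_left simp_thms)
  let ?p = "monom 1 j - monom 1 i :: 'a poly"
  have deg: "degree ?p = j"
    using degree_add_eq_left[of "- monom 1 i" "monom 1 j :: 'a poly"] ij(1) by (simp add: degree_monom_eq)
  have "algebraic_int z"
  proof (rule algebraic_int_root)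
    show "algebraic_int w" using w(1) by (simp add: algints_def)
    show "poly ?p z = w" using zw by (simp add: poly_monom)
    show "\<forall>i. coeff ?p i \<in> \<int>" by auto
    show "lead_coeff ?p = 1" unfolding deg using ij(1) by simp
    show "degree ?p > 0" unfolding deg using ij(1) by simp
  qed
  then show ?thesis using \<open>z \<in> K\<close> by (simp add: algints_def z_def)
qed

sublocale dedekind_subring "algints K"
  by unfold_locales (use finite_principal_quotient completely_closed in auto)

end

section \<open>Euler products\<close>

text \<open>After reindexing along \<open>\<phi>\<close> the sum runs over a product set on which
  the term factors, and absolute summability permits iterated summation.\<close>

lemma
  fixes f :: "'i \<Rightarrow> complex" and g :: "nat \<Rightarrow> complex"
  assumes bij: "bij_betw \<phi> (A \<times> UNIV) B" and mult: "\<And>I k. I \<in> A \<Longrightarrow> f (\<phi> (I, k)) = f I * g k"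
    and f: "f abs_summable_on A" and g: "g abs_summable_on UNIV"
  shows abs_summable_on_mult_bij: "f abs_summable_on B"
    and infsum_mult_bij: "infsum f B = infsum f A * infsum g UNIV"
proof -
  let ?h = "\<lambda>p. f (fst p) * g (snd p)"
  have h: "?h abs_summable_on A \<times> UNIV"
    unfolding abs_summable_on_Sigma_iff
  proof
    show "\<forall>x\<in>A. (\<lambda>k. f (fst (x, k)) * g (snd (x, k))) abs_summable_on UNIV"
      using g by (auto simp: norm_mult intro: summable_on_cmult_right)
    have "(\<lambda>x. \<Sum>\<^sub>\<infinity>k. norm (f (fst (x, k)) * g (snd (x, k)))) = (\<lambda>x. norm (f x) * (\<Sum>\<^sub>\<infinity>k. norm (g k)))"
      by (simp add: norm_mult infsum_cmult_right')
    then show "(\<lambda>x. \<Sum>\<^sub>\<infinity>k. norm (f (fst (x, k)) * g (snd (x, k)))) abs_summable_on A"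
      using f by (simp add: norm_mult infsum_nonneg summable_on_cmult_left)
  qed
  have eq: "f (\<phi> p) = ?h p" if "p \<in> A \<times> UNIV" for p
    using that mult by (cases p) auto
  have "(\<lambda>p. norm (f (\<phi> p))) summable_on A \<times> UNIV"
    using h eq by (subst summable_on_cong[of _ _ "\<lambda>p. norm (?h p)"]) auto
  then show "f abs_summable_on B"
    using summable_on_reindex_bij_betw[OF bij, of "\<lambda>x. norm (f x)"] by simp
  have "infsum f B = infsum (\<lambda>p. f (\<phi> p)) (A \<times> UNIV)"
    using infsum_reindex_bij_betw[OF bij, of f] by simp
  also have "\<dots> = infsum ?h (A \<times> UNIV)" by (rule infsum_cong) (rule eq)
  also have "\<dots> = (\<Sum>\<^sub>\<infinity>x\<in>A. \<Sum>\<^sub>\<infinity>k. ?h (x, k))"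
    using infsum_Sigma_banach[OF abs_summable_summable[OF h]] by simp
  also have "\<dots> = infsum f A * infsum g UNIV"
    by (simp add: infsum_cmult_right' infsum_cmult_left')
  finally show "infsum f B = infsum f A * infsum g UNIV" .
qed

lemma infsum_complex_of_real:
  "f summable_on A \<Longrightarrow> (\<Sum>\<^sub>\<infinity>x\<in>A. complex_of_real (f x)) = complex_of_real (infsum f A)"
  by (intro infsumI) (simp add: has_sum_of_real_iff)

text \<open>\<open>D S\<close> stands for the ideals supported on the primes in \<open>S\<close>,
  \<open>\<phi> Q\<close> attaches a power of \<open>Q\<close> to an ideal prime to it, and
  \<open>e\<close> is the unit ideal. Factorisation enters the analysis only through these four
  axioms.\<close>

locale euler_system =
  fixes PR :: "'p set" and D :: "'p set \<Rightarrow> 'i set" and \<phi> :: "'p \<Rightarrow> 'i \<times> nat \<Rightarrow> 'i" and e :: 'i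
  assumes D_empty: "D {} = {e}"
    and D_insert: "S \<subseteq> PR \<Longrightarrow> Q \<in> PR \<Longrightarrow> Q \<notin> S \<Longrightarrow> bij_betw (\<phi> Q) (D S \<times> UNIV) (D (insert Q S))"
    and D_mono: "S \<subseteq> T \<Longrightarrow> D S \<subseteq> D T"
    and D_cover: "I \<in> D PR \<Longrightarrow> \<exists>S. finite S \<and> S \<subseteq> PR \<and> I \<in> D S"
begin

lemma finite_euler_product:
  fixes f :: "'i \<Rightarrow> complex" and g :: "'p \<Rightarrow> nat \<Rightarrow> complex"
  assumes fe: "f e = 1"
    and mult: "\<And>S Q I k. S \<subseteq> PR \<Longrightarrow> Q \<in> PR \<Longrightarrow> Q \<notin> S \<Longrightarrow> I \<in> D S \<Longrightarrow> f (\<phi> Q (I, k)) = f I * g Q k"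
    and g: "\<And>Q. Q \<in> PR \<Longrightarrow> g Q abs_summable_on UNIV"
    and S: "finite S" "S \<subseteq> PR"
  shows "f abs_summable_on D S \<and> infsum f (D S) = (\<Prod>Q\<in>S. infsum (g Q) UNIV)"
  using S
proof (induction S)
  case empty
  then show ?case by (simp add: D_empty fe)
next
  case (insert Q S)
  then have S: "S \<subseteq> PR" "Q \<in> PR" "Q \<notin> S" and IH: "f abs_summable_on D S"
    "infsum f (D S) = (\<Prod>Q\<in>S. infsum (g Q) UNIV)" by auto
  note bij = D_insert[OF S] and m = mult[OF S]
  show ?case
    using abs_summable_on_mult_bij[of "\<phi> Q" "D S" _ f "g Q", OF bij m IH(1) g[OF S(2)]]
      infsum_mult_bij[of "\<phi> Q" "D S" _ f "g Q", OF bij m IH(1) g[OF S(2)]] insert.hyps IH(2)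
    by (simp add: mult.commute)
qed

text \<open>The majorant \<open>c\<close> controls the tails of the local series in absolute value.
  It thereby bounds all finite products of absolute local sums at once, which yields absolute
  summability over \<open>D PR\<close>.\<close>

theorem euler_product:
  fixes f :: "'i \<Rightarrow> complex" and g :: "'p \<Rightarrow> nat \<Rightarrow> complex"
  assumes fe: "f e = 1"
    and mult: "\<And>S Q I k. S \<subseteq> PR \<Longrightarrow> Q \<in> PR \<Longrightarrow> Q \<notin> S \<Longrightarrow> I \<in> D S \<Longrightarrow> f (\<phi> Q (I, k)) = f I * g Q k"
    and g0: "\<And>Q. Q \<in> PR \<Longrightarrow> g Q 0 = 1" and g: "\<And>Q. Q \<in> PR \<Longrightarrow> g Q abs_summable_on UNIV"
    and c: "\<And>Q. Q \<in> PR \<Longrightarrow> (\<Sum>\<^sub>\<infinity>k. norm (g Q (Suc k))) \<le> c Q" and c_sum: "c summable_on PR"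
  shows "f abs_summable_on D PR" and "has_abs_prod (\<lambda>Q. \<Sum>\<^sub>\<infinity>k. g Q k) (infsum f (D PR)) PR"
proof -
  have fin: "f abs_summable_on D S" "infsum f (D S) = (\<Prod>Q\<in>S. infsum (g Q) UNIV)"
    if "finite S" "S \<subseteq> PR" for S
  proof -
    have "f abs_summable_on D S \<and> infsum f (D S) = (\<Prod>Q\<in>S. infsum (g Q) UNIV)"
      by (rule finite_euler_product[where f = f and g = g]) (use fe mult g that in blast)+
    then show "f abs_summable_on D S" "infsum f (D S) = (\<Prod>Q\<in>S. infsum (g Q) UNIV)" by blast+
  qed
  have c_nonneg: "c Q \<ge> 0" if "Q \<in> PR" for Q
    using order_trans[OF infsum_nonneg c[OF that]] by simp
  have split: "(\<lambda>k. h (Suc k)) summable_on UNIV" "infsum h UNIV = h 0 + (\<Sum>\<^sub>\<infinity>k. h (Suc k))"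
    if h: "h summable_on UNIV" for h :: "nat \<Rightarrow> 'b::banach"
  proof -
    have bij: "bij_betw Suc UNIV (UNIV - {0})"
      by (auto simp: bij_betw_def image_iff) (metis not0_implies_Suc)
    have s: "h summable_on UNIV - {0}" by (rule summable_on_subset_banach[OF h]) simp
    then show "(\<lambda>k. h (Suc k)) summable_on UNIV" using summable_on_reindex_bij_betw[OF bij, of h] by simp
    have "infsum h UNIV = infsum h {0} + infsum h (UNIV - {0})"
      using infsum_Un_disjoint[of h "{0}" "UNIV - {0}"] s by simp
    also have "infsum h (UNIV - {0}) = (\<Sum>\<^sub>\<infinity>k. h (Suc k))" using infsum_reindex_bij_betw[OF bij, of h] by simp
    finally show "infsum h UNIV = h 0 + (\<Sum>\<^sub>\<infinity>k. h (Suc k))" by simp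
  qed
  define G where "G Q = (\<Sum>\<^sub>\<infinity>k. g Q k)" for Q
  have G1: "norm (G Q - 1) \<le> c Q" if "Q \<in> PR" for Q
  proof -
    have "G Q - 1 = (\<Sum>\<^sub>\<infinity>k. g Q (Suc k))"
      using split(2)[OF abs_summable_summable[OF g[OF that]]] g0[OF that] by (simp add: G_def)
    then have "norm (G Q - 1) \<le> (\<Sum>\<^sub>\<infinity>k. norm (g Q (Suc k)))"
      using norm_infsum_bound[OF split(1)[OF g[OF that]]] by simp
    then show ?thesis using c[OF that] by simp
  qed
  define C where "C = infsum c PR"
  have norm_bound: "infsum (\<lambda>I. norm (f I)) (D S) \<le> exp C" if S: "finite S" "S \<subseteq> PR" for S
  proof -
    \<comment> \<open>The finite product formula is applied to the absolute values, embedded in the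
      complex numbers; the outcome is compared with an exponential by
      \<open>1 + c Q \<le> exp (c Q)\<close>.\<close>
    have gn: "(\<lambda>k. complex_of_real (norm (g Q k))) abs_summable_on UNIV" if "Q \<in> PR" for Q
      using g[OF that] by simp
    have fen: "complex_of_real (norm (f e)) = 1" by (simp add: fe)
    have multn: "complex_of_real (norm (f (\<phi> Q (I, k)))) = complex_of_real (norm (f I)) * complex_of_real (norm (g Q k))"
      if "T \<subseteq> PR" "Q \<in> PR" "Q \<notin> T" "I \<in> D T" for T Q I k
      using mult[OF that, of k] by (simp add: norm_mult)
    have "(\<lambda>I. complex_of_real (norm (f I))) abs_summable_on D S \<and>
        infsum (\<lambda>I. complex_of_real (norm (f I))) (D S) = (\<Prod>Q\<in>S. \<Sum>\<^sub>\<infinity>k. complex_of_real (norm (g Q k)))"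
      by (rule finite_euler_product[where f = "\<lambda>I. complex_of_real (norm (f I))"
            and g = "\<lambda>Q k. complex_of_real (norm (g Q k))"]) (use fen multn gn S in blast)+
    then have "infsum (\<lambda>I. complex_of_real (norm (f I))) (D S) = (\<Prod>Q\<in>S. \<Sum>\<^sub>\<infinity>k. complex_of_real (norm (g Q k)))"
      by blast
    then have "complex_of_real (infsum (\<lambda>I. norm (f I)) (D S)) = complex_of_real (\<Prod>Q\<in>S. \<Sum>\<^sub>\<infinity>k. norm (g Q k))"
      using S g by (simp add: infsum_complex_of_real fin(1)[OF S] subset_iff cong: prod.cong)
    then have "infsum (\<lambda>I. norm (f I)) (D S) = (\<Prod>Q\<in>S. \<Sum>\<^sub>\<infinity>k. norm (g Q k))"
      by (simp only: of_real_eq_iff)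
    also have "\<dots> \<le> (\<Prod>Q\<in>S. exp (c Q))"
    proof (rule prod_mono)
      fix Q assume "Q \<in> S"
      then have Q: "Q \<in> PR" using S by blast
      have "(\<Sum>\<^sub>\<infinity>k. norm (g Q k)) = 1 + (\<Sum>\<^sub>\<infinity>k. norm (g Q (Suc k)))"
        using split(2)[OF g[OF Q]] g0[OF Q] by simp
      also have "\<dots> \<le> 1 + c Q" using c[OF Q] by simp
      also have "\<dots> \<le> exp (c Q)" by (rule exp_ge_add_one_self)
      finally show "0 \<le> (\<Sum>\<^sub>\<infinity>k. norm (g Q k)) \<and> (\<Sum>\<^sub>\<infinity>k. norm (g Q k)) \<le> exp (c Q)"
        by (simp add: infsum_nonneg)
    qed
    also have "\<dots> = exp (sum c S)" using S(1) by (simp add: exp_sum)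
    also have "\<dots> \<le> exp C"
      unfolding C_def using finite_sum_le_infsum[OF c_sum S] c_nonneg by auto
    finally show ?thesis .
  qed
  have cover: "\<exists>S. finite S \<and> S \<subseteq> PR \<and> F \<subseteq> D S" if "finite F" "F \<subseteq> D PR" for F
    using that
  proof (induction F)
    case (insert I F)
    then obtain S where S: "finite S" "S \<subseteq> PR" "F \<subseteq> D S" by blast
    obtain T where T: "finite T" "T \<subseteq> PR" "I \<in> D T" using D_cover insert.prems by blast
    show ?case
      using S T D_mono[of S "S \<union> T"] D_mono[of T "S \<union> T"] by (intro exI[of _ "S \<union> T"]) auto
  qed (rule exI[of _ "{}"], simp)
  show abs: "f abs_summable_on D PR"
  proof (rule nonneg_bdd_above_summable_on)
    show "bdd_above (sum (\<lambda>x. norm (f x)) ` {F. F \<subseteq> D PR \<and> finite F})"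
    proof (rule bdd_aboveI2)
      fix F assume "F \<in> {F. F \<subseteq> D PR \<and> finite F}"
      then have F: "finite F" "F \<subseteq> D PR" by simp_all
      obtain S where S: "finite S" "S \<subseteq> PR" "F \<subseteq> D S" using cover[OF F] by blast
      have "sum (\<lambda>x. norm (f x)) F \<le> infsum (\<lambda>x. norm (f x)) (D S)"
        by (rule finite_sum_le_infsum[OF fin(1)[OF S(1,2)] F(1) S(3)]) simp
      then show "sum (\<lambda>x. norm (f x)) F \<le> exp C" using norm_bound[OF S(1,2)] by simp
    qed
  qed simp
  \<comment> \<open>A partial product is the sum over \<open>D S\<close>, so its error is at most
    the absolute sum over the remaining ideals. This is small once \<open>D S\<close> contains a
    finite set that almost exhausts the absolute sum.\<close>
  have "(prod G \<longlongrightarrow> infsum f (D PR)) (finite_subsets_at_top PR)"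
  proof (rule tendstoI)
    fix \<epsilon> :: real assume "\<epsilon> > 0"
    define L where "L = infsum (\<lambda>x. norm (f x)) (D PR)"
    have "(sum (\<lambda>x. norm (f x)) \<longlongrightarrow> L) (finite_subsets_at_top (D PR))"
      unfolding L_def using infsum_tendsto[OF abs] .
    then have "eventually (\<lambda>F. dist (sum (\<lambda>x. norm (f x)) F) L < \<epsilon>) (finite_subsets_at_top (D PR))"
      using \<open>\<epsilon> > 0\<close> by (rule tendstoD)
    then obtain F where F: "finite F" "F \<subseteq> D PR" "dist (sum (\<lambda>x. norm (f x)) F) L < \<epsilon>"
      unfolding eventually_finite_subsets_at_top by blast
    obtain S0 where S0: "finite S0" "S0 \<subseteq> PR" "F \<subseteq> D S0" using cover[OF F(1,2)] by blast
    have "dist (prod G S) (infsum f (D PR)) < \<epsilon>" if S: "finite S" "S0 \<subseteq> S" "S \<subseteq> PR" for S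
    proof -
      have sub: "D S \<subseteq> D PR" "F \<subseteq> D S" using D_mono[OF S(3)] D_mono[OF S(2)] S0(3) by blast+
      have absd: "f abs_summable_on (D PR - D S)" by (rule summable_on_subset_banach[OF abs]) simp
      have "infsum f (D PR) - prod G S = infsum f (D PR - D S)"
        using infsum_Diff[OF abs_summable_summable[OF abs] abs_summable_summable[OF fin(1)[OF S(1,3)]] sub(1)]
          fin(2)[OF S(1,3)] by (simp add: G_def)
      moreover have "dist (prod G S) (infsum f (D PR)) = norm (infsum f (D PR) - prod G S)"
        by (metis dist_commute dist_norm)
      ultimately have "dist (prod G S) (infsum f (D PR)) \<le> infsum (\<lambda>x. norm (f x)) (D PR - D S)"
        using norm_infsum_bound[OF absd] by simp
      also have "\<dots> = L - infsum (\<lambda>x. norm (f x)) (D S)"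
        unfolding L_def by (rule infsum_Diff[OF abs fin(1)[OF S(1,3)] sub(1)])
      also have "\<dots> \<le> L - sum (\<lambda>x. norm (f x)) F"
        using finite_sum_le_infsum[OF fin(1)[OF S(1,3)] F(1) sub(2)] by simp
      also have "\<dots> < \<epsilon>" using F(3) by (simp add: dist_real_def)
      finally show ?thesis .
    qed
    then show "eventually (\<lambda>S. dist (prod G S) (infsum f (D PR)) < \<epsilon>) (finite_subsets_at_top PR)"
      unfolding eventually_finite_subsets_at_top using S0(1,2) by blast
  qed
  moreover have "(\<lambda>Q. G Q - 1) abs_summable_on PR"
    by (rule summable_on_comparison_test[OF c_sum]) (use G1 in auto)
  ultimately show "has_abs_prod (\<lambda>Q. \<Sum>\<^sub>\<infinity>k. g Q k) (infsum f (D PR)) PR"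
    unfolding has_abs_prod_def G_def by blast
qed

end

section \<open>Quotients of the ring of integers\<close>

lemma ring_of_type_algebra_simps [simp]:
  "carrier ring_of_type_algebra = UNIV" "x \<otimes>\<^bsub>ring_of_type_algebra\<^esub> y = x * y"
  "x \<oplus>\<^bsub>ring_of_type_algebra\<^esub> y = x + y" "\<zero>\<^bsub>ring_of_type_algebra\<^esub> = 0" "\<one>\<^bsub>ring_of_type_algebra\<^esub> = 1"
  by (simp_all add: ring_of_type_algebra_def)

context dedekind_subring
begin

abbreviation R :: "'a ring" where
  "R \<equiv> ring_of_type_algebra \<lparr>carrier := A\<rparr>"

lemma cring_R: "cring R"
proof (rule cringI)
  show "abelian_group R"
  proof (rule abelian_groupI)
    show "\<exists>y\<in>carrier R. y \<oplus>\<^bsub>R\<^esub> x = \<zero>\<^bsub>R\<^esub>" if "x \<in> carrier R" for x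
      using that uminus_mem by (intro bexI[of _ "- x"]) auto
  qed (auto simp: mem algebra_simps)
  show "comm_monoid R" by (rule comm_monoidI) (auto simp: mem algebra_simps)
qed (auto simp: algebra_simps)

interpretation R: cring R by (rule cring_R)

lemma a_inv_R: "x \<in> A \<Longrightarrow> \<ominus>\<^bsub>R\<^esub> x = - x"
  by (rule R.minus_equality) (auto simp: mem)

lemma ideal_R_iff: "ideal I R \<longleftrightarrow> idl I"
proof
  assume "ideal I R"
  then interpret ideal I R .
  have sub: "x \<in> A" if "x \<in> I" for x using a_subset that by auto
  have "x - y \<in> I" if "x \<in> I" "y \<in> I" for x y
    using a_closed[OF that(1) a_inv_closed[OF that(2)]] a_inv_R[OF sub[OF that(2)]] by simp
  moreover have "0 \<in> I" using zero_closed by simp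
  moreover have "a * x \<in> I" if "a \<in> A" "x \<in> I" for a x using I_l_closed[OF that(2), of a] that by simp
  ultimately show "idl I" using sub by (auto simp: idl_def add_subgroup_def)
next
  assume I: "idl I"
  show "ideal I R"
  proof (rule idealI[OF R.ring_axioms])
    show "subgroup I (add_monoid R)"
    proof (rule subgroup.intro)
      show "I \<subseteq> carrier (add_monoid R)" using idl_sub[OF I] by auto
      show "x \<otimes>\<^bsub>add_monoid R\<^esub> y \<in> I" if "x \<in> I" "y \<in> I" for x y using idl_add[OF I that] by simp
      show "\<one>\<^bsub>add_monoid R\<^esub> \<in> I" using idl_zero[OF I] by simp
      show "inv\<^bsub>add_monoid R\<^esub> x \<in> I" if "x \<in> I" for x
        using add_subgroup_uminus[OF idl_subgroup[OF I] that] a_inv_R[OF idl_sub[OF I that]]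
        by (simp add: a_inv_def)
    qed
  qed (use idl_mult[OF I] idl_mult2[OF I] in auto)
qed

lemma nonzero_ideals_R: "nonzero_ideals R = idls_over {P. maxprime P}"
  by (auto simp: nonzero_ideals_def idls_over_def ideal_R_iff)

lemma nonzero_primes_R: "nonzero_primes R = {P. maxprime P}"
proof -
  have "primeideal P R \<and> P \<noteq> {0} \<longleftrightarrow> maxprime P" for P
  proof
    assume P: "primeideal P R \<and> P \<noteq> {0}"
    then interpret primeideal P R by simp
    have "idl P" using ideal_R_iff is_ideal by simp
    moreover have "1 \<notin> P" using I_notcarr idl_one_iff[OF \<open>idl P\<close>] by auto
    moreover have "x \<in> P \<or> y \<in> P" if "x \<in> A" "y \<in> A" "x * y \<in> P" for x y
      using I_prime[of x y] that by simp
    ultimately show "maxprime P" using P unfolding maxprime_def by blast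
  next
    assume P: "maxprime P"
    have "primeideal P R"
      by (rule primeidealI[OF _ cring_R])
        (use mp_idl[OF P] mp_one[OF P] one_mem mp_prime[OF P] in \<open>auto simp: ideal_R_iff\<close>)
    then show "primeideal P R \<and> P \<noteq> {0}" using mp_nz[OF P] by simp
  qed
  then show ?thesis by (simp add: nonzero_primes_def)
qed

lemma a_r_coset_R: "I +>\<^bsub>R\<^esub> x = (+) x ` I"
  by (auto simp: a_r_coset_def' add.commute)

lemma carrier_Quot_R: "carrier (R Quot I) = cosets A I"
  by (auto simp: FactRing_def A_RCOSETS_def' a_r_coset_R cosets_def)

lemma ideal_norm_R: "ideal_norm R I = add_index A I"
  by (simp add: ideal_norm_def carrier_Quot_R add_index_def)

lemma mult_Quot_R:
  assumes "idl I" "x \<in> A" "y \<in> A"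
  shows "((+) x ` I) \<otimes>\<^bsub>R Quot I\<^esub> ((+) y ` I) = (+) (x * y) ` I"
proof -
  interpret ideal I R using assms(1) ideal_R_iff by blast
  show ?thesis using rcoset_mult_add[of x y] assms by (simp add: FactRing_def a_r_coset_R)
qed

lemma zero_Quot_R: "\<zero>\<^bsub>R Quot I\<^esub> = I"
  by (simp add: FactRing_def)

lemma cring_Quot_R: "idl I \<Longrightarrow> cring (R Quot I)"
  using ideal.quotient_is_cring[OF _ cring_R] ideal_R_iff by blast

lemma coset_in_sympow_cosets:
  assumes P: "maxprime P" and "i \<le> k" "y \<in> A"
  shows "(+) y ` sympow P k \<in> cosets (sympow P i) (sympow P k) \<longleftrightarrow> y \<in> sympow P i"
proof
  assume "(+) y ` sympow P k \<in> cosets (sympow P i) (sympow P k)"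
  then obtain x where x: "x \<in> sympow P i" "(+) y ` sympow P k = (+) x ` sympow P k"
    unfolding cosets_def by blast
  then have "y - x \<in> sympow P k" using coset_eq_iff[OF sympow_subgroup[OF P]] by blast
  then have "(y - x) + x \<in> sympow P i"
    using x(1) sympow_antimono[OF P \<open>i \<le> k\<close>] add_subgroup_add[OF sympow_subgroup[OF P]] by blast
  then show "y \<in> sympow P i" by simp
qed (simp add: cosets_def)

text \<open>The chain property is \<open>has_val_dvd_mod\<close>, and annihilators come from
  \<open>has_val_mult_iff\<close> with exponents \<open>i + (k - i) = k\<close>. The index
  \<open>min i k\<close> keeps the filtration at zero beyond \<open>k\<close>.\<close>

lemma chain_ring_Quot_sympow:
  assumes P: "maxprime P"
  shows "chain_ring (R Quot sympow P k) (\<lambda>i. cosets (sympow P (min i k)) (sympow P k)) k (add_index A P)"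
proof -
  let ?I = "sympow P k"
  let ?Q = "R Quot ?I" and ?F = "\<lambda>i. cosets (sympow P (min i k)) ?I"
  note iI = sympow_idl[OF P, of k] and sg = sympow_subgroup[OF P]
  note ceq = coset_eq_iff[OF sympow_subgroup[OF P, of k]]
  interpret Q: cring ?Q by (rule cring_Quot_R[OF iI])
  \<comment> \<open>A coset in step \<open>i\<close> but not in the next one is represented by an
    element of valuation exactly \<open>i\<close>, which is what the valuation lemmas apply
    to.\<close>
  have val: "\<exists>x. U = (+) x ` ?I \<and> has_val P x i"
    if U: "i < k" "U \<in> ?F i" "U \<notin> ?F (Suc i)" for U i
  proof -
    obtain x where x: "x \<in> sympow P i" "U = (+) x ` ?I" using U(1,2) by (auto simp: cosets_def)
    have "x \<notin> sympow P (Suc i)"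
    proof
      assume "x \<in> sympow P (Suc i)"
      then have "U \<in> ?F (Suc i)" using U(1) x(2) by (auto simp: cosets_def)
      then show False using U(3) by blast
    qed
    then show ?thesis using has_valI[OF P x(1)] x(2) by blast
  qed
  have val_A: "x \<in> A" if "has_val P x i" for x i
    using that unfolding has_val_def[OF P] by blast
  show ?thesis
  proof (rule chain_ring.intro[OF Q.cring_axioms], unfold_locales)
    show "?F 0 = carrier ?Q" by (simp add: carrier_Quot_R sympow_0[OF P])
    show "?F j \<subseteq> ?F i" if "i \<le> j" for i j
      using sympow_antimono[OF P, of "min i k" "min j k"] that unfolding cosets_def by (intro image_mono) auto
    show "?F k = {\<zero>\<^bsub>?Q\<^esub>}"
      by (simp add: zero_Quot_R cosets_self[OF sg])
    show "finite (carrier ?Q)" unfolding carrier_Quot_R by (rule finite_cosets_sympow[OF P])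
    show "card (?F i) = add_index A P ^ (k - i)" if "i \<le> k" for i
      using add_index_sympow[OF P that] that by (simp add: add_index_def)
    show "\<exists>r\<in>carrier ?Q. V = r \<otimes>\<^bsub>?Q\<^esub> U" if U: "i < k" "U \<in> ?F i" "U \<notin> ?F (Suc i)" "V \<in> ?F i" for i U V
    proof -
      obtain x where x: "U = (+) x ` ?I" "has_val P x i" using val[OF U(1-3)] by blast
      obtain y where y: "y \<in> sympow P i" "V = (+) y ` ?I" using U(1,4) by (auto simp: cosets_def)
      obtain r where r: "r \<in> A" "y - r * x \<in> ?I" using has_val_dvd_mod[OF P x(2) y(1)] by blast
      have "V = ((+) r ` ?I) \<otimes>\<^bsub>?Q\<^esub> U"
        using mult_Quot_R[OF iI r(1) val_A[OF x(2)]] ceq[of y "r * x"] r(2) x(1) y(2) by simp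
      moreover have "(+) r ` ?I \<in> carrier ?Q" using r(1) by (auto simp: carrier_Quot_R cosets_def)
      ultimately show ?thesis by blast
    qed
    show "U \<otimes>\<^bsub>?Q\<^esub> V = \<zero>\<^bsub>?Q\<^esub> \<longleftrightarrow> V \<in> ?F (k - i)"
      if U: "i < k" "U \<in> ?F i" "U \<notin> ?F (Suc i)" "V \<in> carrier ?Q" for i U V
    proof -
      obtain x where x: "U = (+) x ` ?I" "has_val P x i" using val[OF U(1-3)] by blast
      obtain y where y: "y \<in> A" "V = (+) y ` ?I" using U(4) by (auto simp: carrier_Quot_R cosets_def)
      have "U \<otimes>\<^bsub>?Q\<^esub> V = \<zero>\<^bsub>?Q\<^esub> \<longleftrightarrow> (+) (x * y) ` ?I = (+) 0 ` ?I"
        unfolding x(1) y(2) mult_Quot_R[OF iI val_A[OF x(2)] y(1)] zero_Quot_R by simp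
      also have "\<dots> \<longleftrightarrow> x * y \<in> sympow P (i + (k - i))" using ceq[of "x * y" 0] U(1) by simp
      also have "\<dots> \<longleftrightarrow> y \<in> sympow P (k - i)" by (rule has_val_mult_iff[OF P x(2) y(1)])
      also have "\<dots> \<longleftrightarrow> V \<in> ?F (k - i)"
        using coset_in_sympow_cosets[OF P _ y(1), of "k - i" k] y(2) by (simp add: min_def)
      finally show ?thesis .
    qed
  qed
qed

text \<open>The ideals are comaximal because an element of \<open>I\<close> outside \<open>Q\<close>
  is invertible modulo \<open>sympow Q k\<close>.\<close>

lemma chinese_remainder_sympow:
  assumes I: "idl I" and Q: "maxprime Q" "\<not> I \<subseteq> Q"
  obtains h where
    "bij_betw h (carrier (R Quot (I \<inter> sympow Q k))) (carrier (R Quot I) \<times> carrier (R Quot sympow Q k))"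
    "\<And>x y. x \<in> carrier (R Quot (I \<inter> sympow Q k)) \<Longrightarrow> y \<in> carrier (R Quot (I \<inter> sympow Q k)) \<Longrightarrow>
      h (x \<otimes>\<^bsub>R Quot (I \<inter> sympow Q k)\<^esub> y) =
        (fst (h x) \<otimes>\<^bsub>R Quot I\<^esub> fst (h y), snd (h x) \<otimes>\<^bsub>R Quot sympow Q k\<^esub> snd (h y))"
proof -
  let ?J = "sympow Q k"
  note J = sympow_idl[OF Q(1), of k]
  obtain x where x: "x \<in> I" "1 - x \<in> ?J" using comaximal_sympow[OF Q(1) I Q(2)] by blast
  have "I <+>\<^bsub>R\<^esub> ?J = carrier R"
  proof (intro equalityI subsetI)
    fix a assume "a \<in> carrier R"
    then have "a * x \<in> I" "a * (1 - x) \<in> ?J" using idl_mult[OF I _ x(1)] idl_mult[OF J _ x(2)] by auto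
    moreover have "a = a * x + a * (1 - x)" by (simp add: algebra_simps)
    ultimately show "a \<in> I <+>\<^bsub>R\<^esub> ?J" unfolding set_add_def' by auto
  next
    fix a assume "a \<in> I <+>\<^bsub>R\<^esub> ?J"
    then obtain b c where "b \<in> I" "c \<in> ?J" "a = b + c" unfolding set_add_def' by auto
    then show "a \<in> carrier R" using idl_sub[OF I] idl_sub[OF J] add_mem by simp
  qed
  then have "R Quot (I \<inter> ?J) \<simeq> RDirProd (R Quot I) (R Quot ?J)"
    using R.chinese_remainder_simple[of I ?J] I J by (simp add: ideal_R_iff)
  then obtain h where h: "h \<in> ring_iso (R Quot (I \<inter> ?J)) (RDirProd (R Quot I) (R Quot ?J))"
    unfolding is_ring_iso_def by blast
  show thesis
  proof (rule that[of h])
    show "bij_betw h (carrier (R Quot (I \<inter> ?J))) (carrier (R Quot I) \<times> carrier (R Quot ?J))"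
      using ring_iso_memE(5)[OF h] by (simp add: RDirProd_carrier)
    fix u v assume uv: "u \<in> carrier (R Quot (I \<inter> ?J))" "v \<in> carrier (R Quot (I \<inter> ?J))"
    have "h (u \<otimes>\<^bsub>R Quot (I \<inter> ?J)\<^esub> v) = h u \<otimes>\<^bsub>RDirProd (R Quot I) (R Quot ?J)\<^esub> h v"
      using ring_iso_memE(2)[OF h uv] .
    also have "\<dots> = (fst (h u) \<otimes>\<^bsub>R Quot I\<^esub> fst (h v), snd (h u) \<otimes>\<^bsub>R Quot ?J\<^esub> snd (h v))"
      by (simp add: RDirProd_def DirProd_def monoid.defs case_prod_unfold)
    finally show "h (u \<otimes>\<^bsub>R Quot (I \<inter> ?J)\<^esub> v) =
        (fst (h u) \<otimes>\<^bsub>R Quot I\<^esub> fst (h v), snd (h u) \<otimes>\<^bsub>R Quot ?J\<^esub> snd (h v))" .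
  qed
qed

definition class_num :: "nat \<Rightarrow> nat \<Rightarrow> 'a set \<Rightarrow> nat" where
  "class_num m n I = num_conj_classes (unipotent_group m n (R Quot I))"

lemma class_num_eq:
  assumes "idl I" "I \<noteq> {0}"
  shows "class_num m n I * add_index A I ^ (m + n) = add_index A I ^ (m * n) * num_parallel m n (R Quot I)"
  using cring.num_conj_classes_unipotent_group[OF cring_Quot_R[OF assms(1)]] finite_cosets_idl[OF assms]
  unfolding class_num_def by (simp add: carrier_Quot_R add_index_def)

lemma add_index_pos:
  assumes "idl I" "I \<noteq> {0}" shows "add_index A I > 0"
  using finite_cosets_idl[OF assms] zero_mem by (auto simp: add_index_def card_gt_0_iff cosets_def)

text \<open>By the Burnside identity the class number is \<open>num_parallel\<close> up to powers of
  the index. Both are multiplicative by the Chinese remainder theorem, and the non-zero index powers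
  can be cancelled.\<close>

lemma
  assumes I: "idl I" "I \<noteq> {0}" and Q: "maxprime Q" "\<not> I \<subseteq> Q"
  shows add_index_Int_sympow: "add_index A (I \<inter> sympow Q k) = add_index A I * add_index A (sympow Q k)"
    and class_num_Int_sympow: "class_num m n (I \<inter> sympow Q k) = class_num m n I * class_num m n (sympow Q k)"
proof -
  let ?J = "sympow Q k"
  note J = sympow_idl[OF Q(1), of k] sympow_nz[OF Q(1), of k]
  have IJ: "idl (I \<inter> ?J)" "I \<inter> ?J \<noteq> {0}" using idl_Int[OF I(1) J(1)] Int_sympow_nz[OF I Q] by auto
  obtain h where h: "bij_betw h (carrier (R Quot (I \<inter> ?J))) (carrier (R Quot I) \<times> carrier (R Quot ?J))"
    "\<And>x y. x \<in> carrier (R Quot (I \<inter> ?J)) \<Longrightarrow> y \<in> carrier (R Quot (I \<inter> ?J)) \<Longrightarrow>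
      h (x \<otimes>\<^bsub>R Quot (I \<inter> ?J)\<^esub> y) =
        (fst (h x) \<otimes>\<^bsub>R Quot I\<^esub> fst (h y), snd (h x) \<otimes>\<^bsub>R Quot ?J\<^esub> snd (h y))"
    using chinese_remainder_sympow[OF I(1) Q, of k] by blast
  show idx: "add_index A (I \<inter> ?J) = add_index A I * add_index A ?J"
    using bij_betw_same_card[OF h(1)] by (simp add: carrier_Quot_R add_index_def card_cartesian_product)
  have par: "num_parallel m n (R Quot (I \<inter> ?J)) = num_parallel m n (R Quot I) * num_parallel m n (R Quot ?J)"
  proof (rule num_parallel_prod[OF _ _ cring_Quot_R[OF IJ(1)] h])
    show "finite (carrier (R Quot I))" unfolding carrier_Quot_R by (rule finite_cosets_idl[OF I])
    show "finite (carrier (R Quot ?J))" unfolding carrier_Quot_R by (rule finite_cosets_idl[OF J])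
  qed
  let ?a = "add_index A I" and ?b = "add_index A ?J"
  have "class_num m n (I \<inter> ?J) * (?a ^ (m + n) * ?b ^ (m + n)) =
      (?a ^ (m * n) * num_parallel m n (R Quot I)) * (?b ^ (m * n) * num_parallel m n (R Quot ?J))"
    using class_num_eq[OF IJ, of m n] unfolding idx par by (simp add: power_mult_distrib mult_ac)
  also have "\<dots> = (class_num m n I * class_num m n ?J) * (?a ^ (m + n) * ?b ^ (m + n))"
    unfolding class_num_eq[OF I, symmetric] class_num_eq[OF J, symmetric] by (simp add: mult_ac)
  finally show "class_num m n (I \<inter> ?J) = class_num m n I * class_num m n ?J"
    using add_index_pos[OF I] add_index_pos[OF J] by simp
qed

lemma class_num_sympow:
  assumes P: "maxprime P" and "m \<ge> 1" "n \<ge> 1"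
  defines "q \<equiv> add_index A P"
  shows "class_num m n (sympow P k) * (q ^ k) ^ (m + n) = (q ^ k) ^ (m * n) * local_count m n q k"
proof -
  interpret chain_ring "R Quot sympow P k" "\<lambda>i. cosets (sympow P (min i k)) (sympow P k)" k q
    unfolding q_def by (rule chain_ring_Quot_sympow[OF P])
  show ?thesis
    using class_num_eq[OF sympow_idl[OF P] sympow_nz[OF P], of m n k] num_parallel_eq[OF assms(2,3)]
    by (simp add: add_index_A_sympow[OF P] q_def)
qed

text \<open>The trivial bound by the group order; it supplies the majorant for the convergence of
  the Euler product.\<close>

lemma class_num_le:
  assumes "idl I" "I \<noteq> {0}"
  shows "class_num m n I \<le> add_index A I ^ (m + n + m * n)"
proof -
  let ?G = "unipotent_group m n (R Quot I)"
  interpret Q: cring "R Quot I" by (rule cring_Quot_R[OF assms(1)])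
  have fin: "finite (carrier (R Quot I))" unfolding carrier_Quot_R by (rule finite_cosets_idl[OF assms])
  have finG: "finite (carrier ?G)"
    unfolding Q.carrier_unipotent_group using fin by (intro finite_cartesian_product finite_PiE) auto
  have "class_num m n I \<le> card (carrier ?G)"
    unfolding class_num_def num_conj_classes_def orbits_def Setcompr_eq_image
    using card_image_le[OF finG] by simp
  also have "\<dots> = add_index A I ^ (m + n + m * n)"
    unfolding Q.carrier_unipotent_group card_cartesian_product add_index_def carrier_Quot_R
    by (simp add: card_PiE power_add)
  finally show ?thesis .
qed

end

section \<open>The class counting zeta function\<close>

lemma of_nat_power_powr:
  fixes s :: complex shows "of_nat (q ^ k) powr s = (of_nat q powr s) ^ k"
proof (induction k)
  case (Suc k)
  have "of_nat (q ^ Suc k) powr s = of_nat q powr s * of_nat (q ^ k) powr s"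
    unfolding power_Suc of_nat_mult by (rule powr_times_real) auto
  then show ?case using Suc.IH by simp
qed simp

lemma norm_of_nat_powr:
  fixes s :: complex shows "norm (of_nat q powr s) = real q powr Re s"
  using norm_powr_real_powr[of "of_nat q" s] by simp

context dedekind_subring
begin

lemma class_counting_term_Int_sympow:
  assumes "idl I" "I \<noteq> {0}" "maxprime Q" "\<not> I \<subseteq> Q"
  shows "class_counting_term m n R s (I \<inter> sympow Q k) =
    class_counting_term m n R s I * class_counting_term m n R s (sympow Q k)"
proof -
  have "of_nat (add_index A (I \<inter> sympow Q k)) powr (- s) =
      of_nat (add_index A I) powr (- s) * (of_nat (add_index A (sympow Q k)) powr (- s) :: complex)"
    unfolding add_index_Int_sympow[OF assms] of_nat_mult by (rule powr_times_real) auto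
  then show ?thesis
    using class_num_Int_sympow[OF assms, of m n k]
    unfolding class_counting_term_def ideal_norm_R class_num_def by simp
qed

text \<open>The exponent of \<open>q\<close> gathers the Burnside factors \<open>q ^ (m * n)\<close>
  and \<open>q ^ (m + n)\<close> with the Dirichlet factor \<open>q powr (- s)\<close>. The result
  is the variable \<open>T\<close> of the generating function.\<close>

lemma class_counting_term_sympow:
  assumes P: "maxprime P" and mn: "m \<ge> 1" "n \<ge> 1"
  defines "q \<equiv> add_index A P"
  shows "class_counting_term m n R s (sympow P k) =
    of_nat (local_count m n q k) * (of_nat q powr (of_nat m * of_nat n - of_nat m - of_nat n - s)) ^ k"
proof -
  have q: "q \<ge> 2" using add_index_mp_ge_2[OF P] by (simp add: q_def)
  let ?q = "of_nat q :: complex"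
  let ?T = "?q powr (of_nat m * of_nat n - of_nat m - of_nat n - s)"
  have nz: "?q \<noteq> 0" using q by simp
  have "?q powr (of_nat m * of_nat n - of_nat m - of_nat n - s) * ?q powr of_nat (m + n) = ?q powr of_nat (m * n) * ?q powr (- s)"
    by (simp only: powr_add[symmetric]) (simp add: algebra_simps)
  then have T: "?T * ?q ^ (m + n) = ?q ^ (m * n) * ?q powr (- s)"
    by (simp only: powr_complexpow[OF nz])
  have "of_nat (class_num m n (sympow P k)) * (?q ^ k) ^ (m + n) = (?q ^ k) ^ (m * n) * of_nat (local_count m n q k)"
    using arg_cong[OF class_num_sympow[OF P mn, of k, folded q_def], of of_nat] by simp
  then have "(of_nat (class_num m n (sympow P k)) * (?q powr (- s)) ^ k) * (?q ^ (m + n)) ^ k =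
      of_nat (local_count m n q k) * (?q ^ (m * n) * ?q powr (- s)) ^ k"
    by (simp add: power_mult_distrib mult_ac power_mult[symmetric])
  also have "\<dots> = (of_nat (local_count m n q k) * ?T ^ k) * (?q ^ (m + n)) ^ k"
    unfolding T[symmetric] by (simp add: power_mult_distrib)
  finally have "of_nat (class_num m n (sympow P k)) * (?q powr (- s)) ^ k = of_nat (local_count m n q k) * ?T ^ k"
    using nz by simp
  then show ?thesis
    unfolding class_counting_term_def class_num_def ideal_norm_R add_index_A_sympow[OF P] q_def[symmetric]
      of_nat_power_powr .
qed

lemma norm_class_counting_term_sympow_le:
  assumes P: "maxprime P"
  shows "norm (class_counting_term m n R s (sympow P k)) \<le>
    (real (add_index A P) powr (real (m + n + m * n) - Re s)) ^ k"
proof -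
  define q where "q = add_index A P"
  have q: "q \<ge> 2" using add_index_mp_ge_2[OF P] by (simp add: q_def)
  have "class_num m n (sympow P k) \<le> (q ^ k) ^ (m + n + m * n)"
    using class_num_le[OF sympow_idl[OF P] sympow_nz[OF P]] by (simp add: add_index_A_sympow[OF P] q_def)
  then have "real (class_num m n (sympow P k)) \<le> (real q ^ k) ^ (m + n + m * n)"
    by (metis of_nat_le_iff of_nat_power)
  then have "norm (class_counting_term m n R s (sympow P k)) \<le> (real q ^ k) ^ (m + n + m * n) * (real q powr (- Re s)) ^ k"
    unfolding class_counting_term_def class_num_def[symmetric] ideal_norm_R add_index_A_sympow[OF P] q_def[symmetric]
      of_nat_power_powr norm_mult norm_power norm_of_nat_powr norm_of_nat
    by (intro mult_mono) auto
  also have "\<dots> = (real q ^ (m + n + m * n) * real q powr (- Re s)) ^ k"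
    by (simp add: power_mult_distrib flip: power_mult) (simp add: mult.commute)
  also have "real q ^ (m + n + m * n) * real q powr (- Re s) = real q powr (real (m + n + m * n) - Re s)"
    using q by (simp add: powr_realpow[symmetric] powr_add[symmetric] del: of_nat_add of_nat_mult)
  finally show ?thesis by (simp add: q_def)
qed

lemma class_counting_term_A: "class_counting_term m n R s A = 1"
proof -
  have A: "idl A" "A \<noteq> {0}" using idls_over_empty unfolding idls_over_def by blast+
  note idx = add_index_self[OF add_subgroup_A]
  interpret Q: cring "R Quot A" by (rule cring_Quot_R[OF A(1)])
  interpret G: group "unipotent_group m n (R Quot A)" by (rule Q.unipotent_group_is_group)
  have "class_num m n A \<le> 1" using class_num_le[OF A, of m n] by (simp add: idx)
  moreover have "class_num m n A \<noteq> 0"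
  proof -
    have fin: "finite (carrier (unipotent_group m n (R Quot A)))"
      unfolding Q.carrier_unipotent_group carrier_Quot_R using finite_cosets_idl[OF A]
      by (intro finite_cartesian_product finite_PiE) auto
    show ?thesis
      unfolding class_num_def num_conj_classes_def orbits_def Setcompr_eq_image
      using G.one_closed fin by (auto simp: card_eq_0_iff)
  qed
  ultimately have "class_num m n A = 1" by simp
  then show ?thesis by (simp add: class_counting_term_def ideal_norm_R idx class_num_def)
qed

end

text \<open>The norm of \<open>P\<close> is at least the least positive integer \<open>k\<close> in
  \<open>P\<close>, and at most \<open>k ^ d\<close> primes contain \<open>k\<close>. From the
  exponent \<open>d + 2\<close> on, the series is thus dominated by that of
  \<open>k powr (- 2)\<close>.\<close>

lemma (in nfield) summable_prime_norm_powr: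
  obtains d :: nat where "\<And>\<tau>. \<tau> \<ge> real d + 2 \<Longrightarrow>
    (\<lambda>P. real (add_index AI P) powr (- \<tau>)) summable_on {P. maxprime P}"
proof -
  obtain B where B: "finite B" "K \<subseteq> rat_span.span B" using number_field_finite_span[OF K] .
  define d where "d = card B"
  \<comment> \<open>the rational prime below \<open>P\<close>; at most \<open>k^d\<close> primes lie above \<open>k\<close>\<close>
  define l where "l P = (LEAST k. k > 0 \<and> of_nat k \<in> P)" for P :: "'a set"
  have l: "l P > 0" "of_nat (l P) \<in> P" "real (l P) \<le> real (add_index AI P)" if P: "maxprime P" for P
  proof -
    obtain a where a: "a \<in> P" "a \<noteq> 0" "a \<in> AI" using idl_nonzero[OF mp_idl[OF P] mp_nz[OF P]] .
    obtain N where N: "N > 0" "of_nat N \<in> (*) a ` AI" using nat_multiple[OF a(3,2)] .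
    then have "N > 0 \<and> of_nat N \<in> P" using principal_subset[OF mp_idl[OF P] a(1)] by blast
    then have lP: "l P > 0 \<and> of_nat (l P) \<in> P" unfolding l_def by (rule LeastI)
    then show "l P > 0" "of_nat (l P) \<in> P" by auto
    \<comment> \<open>The integers from 0 to \<open>l P - 1\<close> are incongruent modulo
      \<open>P\<close>, since a difference in \<open>P\<close> would contradict the minimality of
      \<open>l P\<close>.\<close>
    have "(\<lambda>i. (+) (of_nat i :: 'a) ` P) ` {..<l P} \<subseteq> cosets AI P"
      using O_of_nat by (auto simp: cosets_def)
    moreover have "inj_on (\<lambda>i. (+) (of_nat i :: 'a) ` P) {..<l P}"
    proof -
      have "False" if "i < j" "j < l P" "(+) (of_nat i :: 'a) ` P = (+) (of_nat j) ` P" for i j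
      proof -
        have "of_nat j - of_nat i \<in> P"
          using coset_eq_iff[OF idl_subgroup[OF mp_idl[OF P]], of "of_nat j" "of_nat i"] that(3) by simp
        then have "of_nat (j - i) \<in> P" using that(1) by (simp add: of_nat_diff)
        then have "l P \<le> j - i" unfolding l_def using that(1) by (intro Least_le) simp
        then show False using that by simp
      qed
      then show ?thesis unfolding inj_on_def by (metis lessThan_iff linorder_neqE_nat)
    qed
    ultimately have "card {..<l P} \<le> card (cosets AI P)"
      using finite_cosets_mp[OF P] by (metis card_inj_on_le)
    then show "real (l P) \<le> real (add_index AI P)" by (simp add: add_index_def)
  qed
  have "(\<lambda>P. real (add_index AI P) powr (- \<tau>)) summable_on {P. maxprime P}" if \<tau>: "\<tau> \<ge> real d + 2" for \<tau>
  proof (rule nonneg_bdd_above_summable_on)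
    define S where "S = (\<Sum>k. real k powr (- 2))"
    have sm: "summable (\<lambda>k. real k powr (- 2))" by (simp add: summable_real_powr_iff)
    show "bdd_above (sum (\<lambda>P. real (add_index AI P) powr (- \<tau>)) ` {F. F \<subseteq> {P. maxprime P} \<and> finite F})"
    proof (rule bdd_aboveI2)
      fix F assume "F \<in> {F. F \<subseteq> {P. maxprime P} \<and> finite F}"
      then have F: "finite F" "\<And>P. P \<in> F \<Longrightarrow> maxprime P" by auto
      have "sum (\<lambda>P. real (add_index AI P) powr (- \<tau>)) F \<le> (\<Sum>P\<in>F. real (l P) powr (- \<tau>))"
        using l[OF F(2)] \<tau> by (intro sum_mono powr_mono2') auto
      also have "\<dots> = (\<Sum>k\<in>l ` F. \<Sum>P\<in>{P \<in> F. l P = k}. real (l P) powr (- \<tau>))"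
        by (rule sum.image_gen[OF F(1)])
      also have "\<dots> \<le> (\<Sum>k\<in>l ` F. real k powr (- 2))"
      proof (rule sum_mono)
        fix k assume "k \<in> l ` F"
        then have k: "k > 0" using l F(2) by auto
        have nz: "of_nat k \<noteq> (0::'a)" using k by simp
        have sub: "{P \<in> F. l P = k} \<subseteq> {P. maxprime P \<and> of_nat k \<in> P}" using l(2) F(2) by auto
        have "card {P \<in> F. l P = k} \<le> card {P. maxprime P \<and> of_nat k \<in> P}"
          by (rule card_mono[OF finite_primes_containing[OF O_of_nat nz] sub])
        also have "\<dots> \<le> add_index AI ((*) (of_nat k) ` AI)" by (rule card_primes_containing[OF O_of_nat nz])
        also have "\<dots> \<le> k ^ d" using nat_quotient_bound[OF B k] by (simp add: d_def)
        finally have "real (card {P \<in> F. l P = k}) \<le> real k powr real d"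
          using k by (simp add: powr_realpow flip: of_nat_power)
        then have "real (card {P \<in> F. l P = k}) * real k powr (- \<tau>) \<le> real k powr real d * real k powr (- \<tau>)"
          by (rule mult_right_mono) simp
        also have "\<dots> = real k powr (real d - \<tau>)" by (simp add: powr_add[symmetric])
        also have "\<dots> \<le> real k powr (- 2)" using k \<tau> by (intro powr_mono) auto
        finally show "(\<Sum>P\<in>{P \<in> F. l P = k}. real (l P) powr (- \<tau>)) \<le> real k powr (- 2)" by simp
      qed
      also have "\<dots> \<le> S" unfolding S_def by (rule sum_le_suminf[OF sm]) (use F(1) in auto)
      finally show "sum (\<lambda>P. real (add_index AI P) powr (- \<tau>)) F \<le> S" .
    qed
  qed simp
  then show thesis using that by blast
qed

context nfield
begin

lemma euler_system_idls:
  "euler_system {P. maxprime P} idls_over (\<lambda>Q (I, k). I \<inter> sympow Q k) AI"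
proof
  show "idls_over {} = {AI}" by (rule idls_over_empty)
  show "bij_betw (\<lambda>(I, k). I \<inter> sympow Q k) (idls_over S \<times> UNIV) (idls_over (insert Q S))"
    if "S \<subseteq> {P. maxprime P}" "Q \<in> {P. maxprime P}" "Q \<notin> S" for S Q
    using bij_betw_idls_over[of Q S] that by simp
  show "idls_over S \<subseteq> idls_over T" if "S \<subseteq> T" for S T using that by (rule idls_over_mono)
  show "\<exists>S. finite S \<and> S \<subseteq> {P. maxprime P} \<and> I \<in> idls_over S" if "I \<in> idls_over {P. maxprime P}" for I
    using that finite_primes_over[of I] by (intro exI[of _ "{P. maxprime P \<and> I \<subseteq> P}"]) (auto simp: idls_over_def)
qed

text \<open>In \<open>q * (q ^ m * q ^ n)\<^sup>2 * T\<close> the exponent of \<open>q\<close> adds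
  up to \<open>m + n + m * n + 1 - s\<close>, so the condition on \<open>s\<close> is the smallness
  required by \<open>local_count_sums\<close>.\<close>

lemma local_factor:
  assumes P: "maxprime P" and mn: "m \<ge> 1" "n \<ge> 1" and s: "Re s > real (m + n + m * n) + 1"
  defines "q \<equiv> of_nat (add_index AI P) :: complex" and "M \<equiv> of_nat m :: complex" and "N \<equiv> of_nat n :: complex"
  shows "(\<lambda>k. class_counting_term m n R s (sympow P k)) abs_summable_on UNIV"
    and "(\<Sum>\<^sub>\<infinity>k. class_counting_term m n R s (sympow P k)) =
      (q powr (2 * M * N - M - N + 1 - 2 * s)
        - ((q + 1) * q ^ m - (q ^ m - q - 1) * q ^ n - q) * q powr (M * N - M - N - s) + 1) /
      ((1 - q powr (M * N + M - N - s)) * (1 - q powr (M * N + N - M - s)) * (1 - q powr (M * N + 1 - s)))"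
proof -
  let ?q = "add_index AI P"
  have q2: "?q \<ge> 2" using add_index_mp_ge_2[OF P] .
  have nz: "q \<noteq> 0" using q2 by (simp add: q_def)
  define T where "T = q powr (M * N - M - N - s)"
  have pw: "q ^ i * q powr z = q powr (of_nat i + z)" for i z
    by (simp only: powr_add powr_complexpow[OF nz])
  have small: "norm (q * (q ^ m * q ^ n)\<^sup>2 * T) < 1"
  proof -
    have "q * (q ^ m * q ^ n)\<^sup>2 * T = q ^ (1 + 2 * (m + n)) * T"
      by (simp add: power_add power_mult mult.commute power2_eq_square)
    also have "\<dots> = q powr (of_nat (1 + 2 * (m + n)) + (M * N - M - N - s))" unfolding T_def pw ..
    finally have "norm (q * (q ^ m * q ^ n)\<^sup>2 * T) = real ?q powr (1 + real (m + n + m * n) - Re s)"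
      by (simp add: q_def norm_of_nat_powr M_def N_def algebra_simps)
    also have "\<dots> < real ?q powr 0" using q2 s by (intro powr_less_mono) auto
    finally show ?thesis using q2 by simp
  qed
  note sums = local_count_sums[OF mn _ small[unfolded q_def]]
  have q1: "?q \<ge> 1" using q2 by simp
  have eq: "class_counting_term m n R s (sympow P k) = of_nat (local_count m n ?q k) * T ^ k" for k
    unfolding T_def q_def M_def N_def by (rule class_counting_term_sympow[OF P mn])
  have abs: "summable (\<lambda>k. norm (class_counting_term m n R s (sympow P k)))"
    unfolding eq by (rule sums(1)[OF q1])
  then show "(\<lambda>k. class_counting_term m n R s (sympow P k)) abs_summable_on UNIV"
    using norm_summable_imp_summable_on[of "\<lambda>k. norm (class_counting_term m n R s (sympow P k))"] by simp
  have "(\<Sum>\<^sub>\<infinity>k. class_counting_term m n R s (sympow P k)) =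
      (q * q ^ m * q ^ n * T\<^sup>2 - ((q + 1) * q ^ m - (q ^ m - q - 1) * q ^ n - q) * T + 1) /
        ((1 - q ^ m * q ^ m * T) * (1 - q ^ n * q ^ n * T) * (1 - q * q ^ m * q ^ n * T))"
    using norm_summable_imp_has_sum[OF abs] sums(2)[OF q1] unfolding eq q_def by (intro infsumI) simp
  also have "q * q ^ m * q ^ n * T\<^sup>2 = q powr (2 * M * N - M - N + 1 - 2 * s)"
  proof -
    have "q * q ^ m * q ^ n * T\<^sup>2 = q ^ (1 + m + n) * (T * T)" by (simp add: power_add power2_eq_square mult_ac)
    also have "\<dots> = q powr (of_nat (1 + m + n) + ((M * N - M - N - s) + (M * N - M - N - s)))"
      unfolding T_def powr_add[symmetric] pw ..
    also have "of_nat (1 + m + n) + ((M * N - M - N - s) + (M * N - M - N - s)) = 2 * M * N - M - N + 1 - 2 * s"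
      by (simp add: M_def N_def algebra_simps)
    finally show ?thesis .
  qed
  also have "q ^ m * q ^ m * T = q powr (M * N + M - N - s)"
    unfolding T_def power_add[symmetric] pw by (simp add: M_def N_def algebra_simps)
  also have "q ^ n * q ^ n * T = q powr (M * N + N - M - s)"
    unfolding T_def power_add[symmetric] pw by (simp add: M_def N_def algebra_simps)
  also have "q * q ^ m * q ^ n * T = q powr (M * N + 1 - s)"
  proof -
    have "q * q ^ m * q ^ n * T = q ^ (1 + m + n) * T" by (simp add: power_add mult_ac)
    then show ?thesis unfolding T_def pw by (simp add: M_def N_def algebra_simps)
  qed
  finally show "(\<Sum>\<^sub>\<infinity>k. class_counting_term m n R s (sympow P k)) =
      (q powr (2 * M * N - M - N + 1 - 2 * s)
        - ((q + 1) * q ^ m - (q ^ m - q - 1) * q ^ n - q) * q powr (M * N - M - N - s) + 1) /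
      ((1 - q powr (M * N + M - N - s)) * (1 - q powr (M * N + N - M - s)) * (1 - q powr (M * N + 1 - s)))"
    unfolding T_def .
qed

theorem class_counting_euler_product:
  assumes mn: "m \<ge> 1" "n \<ge> 1"
  obtains \<sigma> :: real where "\<And>s. Re s > \<sigma> \<Longrightarrow>
    class_counting_term m n R s abs_summable_on idls_over {P. maxprime P} \<and>
    has_abs_prod (\<lambda>P. \<Sum>\<^sub>\<infinity>k. class_counting_term m n R s (sympow P k))
      (\<Sum>\<^sub>\<infinity>I\<in>idls_over {P. maxprime P}. class_counting_term m n R s I) {P. maxprime P}"
    "\<sigma> \<ge> real (m + n + m * n) + 1"
proof -
  obtain d :: nat where d: "\<And>\<tau>. \<tau> \<ge> real d + 2 \<Longrightarrow>
      (\<lambda>P. real (add_index AI P) powr (- \<tau>)) summable_on {P. maxprime P}"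
    using summable_prime_norm_powr by blast
  \<comment> \<open>Terms are bounded by the norm to the power \<open>m + n + m * n - Re s\<close>,
    and prime norms are summable from the exponent \<open>d + 2\<close> on.\<close>
  define \<sigma> where "\<sigma> = real (m + n + m * n) + real d + 2"
  interpret euler_system "{P. maxprime P}" idls_over "\<lambda>Q (I, k). I \<inter> sympow Q k" AI
    by (rule euler_system_idls)
  have main: "class_counting_term m n R s abs_summable_on idls_over {P. maxprime P} \<and>
    has_abs_prod (\<lambda>P. \<Sum>\<^sub>\<infinity>k. class_counting_term m n R s (sympow P k))
      (\<Sum>\<^sub>\<infinity>I\<in>idls_over {P. maxprime P}. class_counting_term m n R s I) {P. maxprime P}"
    if s: "Re s > \<sigma>" for s
  proof -
    define \<tau> where "\<tau> = Re s - real (m + n + m * n)"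
    have \<tau>: "\<tau> \<ge> real d + 2" "\<tau> \<ge> 2" using s by (simp_all add: \<tau>_def \<sigma>_def)
    have s': "Re s > real (m + n + m * n) + 1" using s by (simp add: \<sigma>_def)
    let ?f = "class_counting_term m n R s" and ?g = "\<lambda>P k. class_counting_term m n R s (sympow P k)"
    \<comment> \<open>The terms from exponent 1 on are dominated by a geometric series with ratio
      \<open>w = real (add_index AI P) powr (- \<tau>)\<close>; the 2 bounds
      \<open>1 / (1 - w)\<close>, as \<open>w \<le> 1 / 2\<close>.\<close>
    let ?c = "\<lambda>P. 2 * real (add_index AI P) powr (- \<tau>)"
    have mult: "?f (case (I, k) of (I, k) \<Rightarrow> I \<inter> sympow Q k) = ?f I * ?g Q k"
      if "S \<subseteq> {P. maxprime P}" "Q \<in> {P. maxprime P}" "Q \<notin> S" "I \<in> idls_over S" for S Q I k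
      using class_counting_term_Int_sympow[of I Q m n s k] that by (auto simp: idls_over_def)
    have g0: "?g P 0 = 1" if "P \<in> {P. maxprime P}" for P
      using that class_counting_term_A by (simp add: sympow_0)
    have g: "?g P abs_summable_on UNIV" if "P \<in> {P. maxprime P}" for P
      using local_factor(1)[OF _ mn s'] that by simp
    have c: "(\<Sum>\<^sub>\<infinity>k. norm (?g P (Suc k))) \<le> ?c P" if "P \<in> {P. maxprime P}" for P
    proof -
      have P: "maxprime P" using that by simp
      define w where "w = real (add_index AI P) powr (- \<tau>)"
      have q2: "real (add_index AI P) \<ge> 2" using add_index_mp_ge_2[OF P] by simp
      have "w \<le> real (add_index AI P) powr (- 1)" unfolding w_def using q2 \<tau> by (intro powr_mono) auto
      also have "\<dots> \<le> 1 / 2" using q2 by (simp add: powr_minus_divide field_simps)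
      finally have w: "0 \<le> w" "w \<le> 1 / 2" by (simp_all add: w_def)
      have le: "norm (?g P (Suc k)) \<le> w * w ^ k" for k
        using norm_class_counting_term_sympow_le[OF P, of m n s "Suc k"] by (simp add: w_def \<tau>_def)
      have "(\<lambda>k. w * w ^ k) sums (w * (1 / (1 - w)))" using w by (intro sums_mult geometric_sums) simp
      then have hs: "((\<lambda>k. w * w ^ k) has_sum (w * (1 / (1 - w)))) UNIV"
        using w by (intro norm_summable_imp_has_sum) (auto simp: sums_iff abs_mult)
      have "(\<lambda>k. norm (?g P (Suc k))) summable_on UNIV"
        by (rule summable_on_comparison_test[OF has_sum_imp_summable[OF hs]]) (use le in auto)
      then have "(\<Sum>\<^sub>\<infinity>k. norm (?g P (Suc k))) \<le> w * (1 / (1 - w))"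
        using infsum_mono[OF _ has_sum_imp_summable[OF hs] le] infsumI[OF hs] by simp
      also have "\<dots> \<le> w * 2" using w by (intro mult_left_mono) (simp_all add: field_simps)
      finally show ?thesis by (simp add: w_def)
    qed
    have c_sum: "?c summable_on {P. maxprime P}" by (rule summable_on_cmult_right[OF d[OF \<tau>(1)]])
    show ?thesis
    proof
      show "?f abs_summable_on idls_over {P. maxprime P}"
        by (rule euler_product(1)[where f = ?f and g = ?g and c = ?c])
          (use class_counting_term_A mult g0 g c c_sum in blast)+
      show "has_abs_prod (\<lambda>P. \<Sum>\<^sub>\<infinity>k. ?g P k) (infsum ?f (idls_over {P. maxprime P})) {P. maxprime P}"
        by (rule euler_product(2)[where f = ?f and g = ?g and c = ?c])
          (use class_counting_term_A mult g0 g c c_sum in blast)+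
    qed
  qed
  have "real (m + n + m * n) + 1 \<le> \<sigma>" unfolding \<sigma>_def by linarith
  from that[OF main this] show thesis .
qed

end

theorem corollary1p9:
  fixes K :: "'a::field_char_0 set" and m n :: nat
  assumes "number_field K" and "1 \<le> m" and "m \<le> n"
  shows "\<exists>\<sigma>::real. \<forall>s::complex. Re s > \<sigma> \<longrightarrow>
    class_counting_term m n (ring_of_integers K) s
      abs_summable_on nonzero_ideals (ring_of_integers K) \<and>
    has_abs_prod
      (\<lambda>P. let q = (of_nat (ideal_norm (ring_of_integers K) P) :: complex);
               M = (of_nat m :: complex); N = (of_nat n :: complex)
           in (q powr (2 * M * N - M - N + 1 - 2 * s)
                 - ((q + 1) * q ^ m - (q ^ m - q - 1) * q ^ n - q) * q powr (M * N - M - N - s)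
                 + 1)
              / ((1 - q powr (M * N + M - N - s)) *
                 (1 - q powr (M * N + N - M - s)) *
                 (1 - q powr (M * N + 1 - s))))
      (class_counting_zeta m n (ring_of_integers K) s)
      (nonzero_primes (ring_of_integers K))"
proof -
  interpret nfield K by (rule nfield.intro[OF assms(1)])
  have mn: "m \<ge> 1" "n \<ge> 1" using assms by auto
  have O: "ring_of_integers K = R" by (simp add: ring_of_integers_def algints_def)
  obtain \<sigma> :: real where \<sigma>: "\<And>s. Re s > \<sigma> \<Longrightarrow>
      class_counting_term m n R s abs_summable_on idls_over {P. maxprime P} \<and>
      has_abs_prod (\<lambda>P. \<Sum>\<^sub>\<infinity>k. class_counting_term m n R s (sympow P k))
        (\<Sum>\<^sub>\<infinity>I\<in>idls_over {P. maxprime P}. class_counting_term m n R s I) {P. maxprime P}"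
    "\<sigma> \<ge> real (m + n + m * n) + 1"
    using class_counting_euler_product[OF mn] by blast
  \<comment> \<open>The closed form of the local series is available only at primes, so factors are
    exchanged on the index set of the product.\<close>
  have cong: "has_abs_prod f c S" if "has_abs_prod g c S" "\<And>x. x \<in> S \<Longrightarrow> f x = g x"
    for f g :: "'a set \<Rightarrow> complex" and c S
  proof -
    have "(\<lambda>x. norm (g x - 1)) summable_on S \<longleftrightarrow> (\<lambda>x. norm (f x - 1)) summable_on S"
      by (rule summable_on_cong) (simp add: that(2))
    moreover have "(prod g \<longlongrightarrow> c) (finite_subsets_at_top S) \<longleftrightarrow> (prod f \<longlongrightarrow> c) (finite_subsets_at_top S)"
      by (rule tendsto_cong, rule eventually_finite_subsets_at_top_weakI, rule prod.cong) (use that(2) in auto)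
    ultimately show ?thesis using that(1) unfolding has_abs_prod_def by simp
  qed
  show ?thesis
    unfolding O nonzero_ideals_R nonzero_primes_R class_counting_zeta_def ideal_norm_R Let_def
  proof (intro exI[of _ \<sigma>] allI impI conjI)
    fix s :: complex assume s: "Re s > \<sigma>"
    show "class_counting_term m n R s abs_summable_on idls_over {P. maxprime P}" using \<sigma>(1)[OF s] by blast
    have s': "Re s > real (m + n + m * n) + 1" using s \<sigma>(2) by simp
    show "has_abs_prod
      (\<lambda>P. (of_nat (add_index AI P) powr (2 * of_nat m * of_nat n - of_nat m - of_nat n + 1 - 2 * s)
          - ((of_nat (add_index AI P) + 1) * of_nat (add_index AI P) ^ m
              - (of_nat (add_index AI P) ^ m - of_nat (add_index AI P) - 1) * of_nat (add_index AI P) ^ n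
              - of_nat (add_index AI P)) * of_nat (add_index AI P) powr (of_nat m * of_nat n - of_nat m - of_nat n - s)
          + 1)
        / ((1 - of_nat (add_index AI P) powr (of_nat m * of_nat n + of_nat m - of_nat n - s)) *
           (1 - of_nat (add_index AI P) powr (of_nat m * of_nat n + of_nat n - of_nat m - s)) *
           (1 - of_nat (add_index AI P) powr (of_nat m * of_nat n + 1 - s))))
      (\<Sum>\<^sub>\<infinity>I\<in>idls_over {P. maxprime P}. class_counting_term m n R s I) {P. maxprime P}"
    proof (rule cong[OF conjunct2[OF \<sigma>(1)[OF s]]], goal_cases)
      case (1 P)
      then show ?case using local_factor(2)[OF _ mn s', of P] by simp
    qed
  qed
qed

end
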